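(* For any $x\in\mathbb R$, $n\ge1$ and $\delta>0$, $$\left|\frac{F_n(x+\frac\delta2)-F_n(x-\frac\delta2)}{\delta}-f(x)\right|\le\frac{(96M^2)^{1/3}}{\delta\,n^{1/3}}+\frac{M'}{4}\delta.$$ In particular, for any $\bar M\ge M$ and $\bar M'\ge M'$, set $$\delta_n:=2\big(96\bar M^2(\bar M')^{-3}\big)^{1/6}n^{-1/6}.$$ Then $$\left|\frac{F_n(x+\frac{\delta_n}2)-F_n(x-\frac{\delta_n}2)}{\delta_n}-f(x)\right|\le\big(96\bar M^2(\bar M')^3\big)^{1/6}n^{-1/6}.$$
   Context: Let $X_n$ be the number of comparisons used by randomized Quicksort (uniform random pivot) on $n$ distinct numbers. Equivalently, $X_0=0$ and $$X_n\stackrel{d}{=}X_{U_n-1}+X^*_{n-U_n}+n-1,$$ with $U_n$ uniform on $\{1,\dots,n\}$, $X_j^*\stackrel{d}{=}X_j$, all independent. Let $\mu_n=\mathbf EX_n=2(n+1)H_n-4n$, where $H_n=\sum_{k\le n}1/k$, and $Y_n=(X_n-\mu_n)/n$. Let $F_n$ be the distribution function of $Y_n$. $Y$ is the distributional limit of $Y_n$. Its law is the unique law with mean $0$ and finite variance satisfying $Y\stackrel{d}{=}UY+(1-U)Y^*+C(U)$, where $U\sim\mathrm{unif}(0,1)$, $Y^*\stackrel{d}{=}Y$, $U,Y,Y^*$ are independent, and $C(u)=2u\ln u+2(1-u)\ln(1-u)+1$. $Y$ has an infinitely differentiable density $f$ with $M:=\sup_x|f(x)|<\infty$ and $M':=\sup_x|f'(x)|<\infty$.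 *)

theory Defs
  imports "HOL-Probability.Probability"
begin

text \<open>Law of X_n, the number of comparisons of randomized Quicksort on n distinct keys:
  X_0 = 0 and X_{n+1} = X_{U-1} + X*_{n+1-U} + n with U uniform on {1..n+1}.
  Here j = U - 1 is uniform on {0..n}.\<close>
fun qs_cost :: "nat \<Rightarrow> nat pmf" where
  "qs_cost 0 = return_pmf 0"
| "qs_cost (Suc n) =
     bind_pmf (pmf_of_set {..n}) (\<lambda>j.
       bind_pmf (qs_cost j) (\<lambda>a.
         bind_pmf (qs_cost (n - j)) (\<lambda>b. return_pmf (a + b + n))))"

definition qs_mean :: "nat \<Rightarrow> real" where
  "qs_mean n = 2 * (real n + 1) * harm n - 4 * real n"

definition qs_law :: "nat \<Rightarrow> real measure" where
  "qs_law n = distr (measure_pmf (qs_cost n)) borel (\<lambda>k. (real k - qs_mean n) / real n)"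

definition qs_cdf :: "nat \<Rightarrow> real \<Rightarrow> real" where
  "qs_cdf n x = measure_pmf.prob (qs_cost n) {k. (real k - qs_mean n) / real n \<le> x}"

end

theory Submission
  imports Defs
begin

text \<open>Let \<open>Z\<^sub>n\<close> be the centred number of comparisons. The heart of the proof is a coupling with
  \<open>E(Z\<^sub>n / n - Y)\<^sup>2 \<le> 4 / n\<close> for a law of \<open>Y\<close> that does not depend on \<open>n\<close>. Instead of the limit law
  itself we take for \<open>Y\<close> a late iterate of the distributional fixed-point equation, with the
  uniform variable discretised to a grid that refines all the splits \<open>{1..n}\<close> in question; then
  everything is a finite sum. Coupling the splits of \<open>Z\<^sub>n\<close> and of \<open>(n + 1) Y\<close> monotonically gives a recursion for
  \<open>D\<^sub>n = E(Z\<^sub>n - (n + 1) Y)\<^sup>2\<close>. Its inhomogeneous part is bounded, because the variances are known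
  exactly, and the tolls differ by a first-order term and a relative entropy. Hence \<open>D\<^sub>n \<le> 4 n - 2\<close>,
  with small \<open>n\<close> treated by the independent coupling.

  Integrating the certificate \<open>1[a \<le> x] \<le> (1 - r\<^sup>2 ((b - x)\<^sup>+)\<^sup>2)\<^sup>+ + r\<^sup>2 (a - b)\<^sup>2\<close>
  against two such couplings, for \<open>n\<close> and for \<open>N \<rightarrow> \<infinity>\<close>, and optimising \<open>r\<close>, bounds
  the distance of the distribution functions of \<open>Z\<^sub>n / n\<close> and of the limit
  by \<open>(12 M\<^sup>2 / n)\<close> to the power \<open>1/3\<close>. The rest is a Taylor estimate of the
  limiting distribution function.\<close>

section \<open>Harmonic sums and the toll\<close>

text \<open>One auxiliary law serves all sizes up to a given \<open>N\<close>, so the couplings for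
  \<open>n\<close> and for \<open>N\<close> can be chained through it. The multiplier of
  \<open>Y\<close> is \<open>n + 1\<close> and not \<open>n\<close> because a subproblem of size
  \<open>s - 1\<close> then carries weight \<open>s\<close>, and the weights \<open>s\<close> and
  \<open>n + 1 - s\<close> of the two subproblems add up to that of the parent.

  The obstacle is the constant. Averaging \<open>4 n - 2\<close> over the two subproblems returns
  \<open>4 n - 8\<close>, so all bounded contributions together may amount to at most 6; for large
  \<open>n\<close> they come to about 5.4. This fits only because the mean-zero toll error is
  compared with a constant close to 1, which saves almost 1, and because its second-order part is
  split off with a weight depending on \<open>n\<close>. For moderate \<open>n\<close> it also
  matters that the values at \<open>n = 1, ..., 4\<close> lie below the line \<open>4 n - 2\<close>.

  The 12 comes from minimising \<open>2 M / (3 r) + 4 r^2 / n\<close> over \<open>r\<close>, where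
  \<open>2 / (3 r)\<close> is the area under the certificate beyond \<open>x\<close>. The 96 of the
  theorem is 8 times 12: two distribution functions are compared, and the factor 2 moves under the
  cube root.\<close>

definition harm2 :: "nat \<Rightarrow> real" where
  "harm2 n = (\<Sum>k=1..n. 1 / (real k)\<^sup>2)"

lemma harm2_simps [simp]:
  "harm2 0 = 0" "harm2 (Suc n) = harm2 n + 1 / (real n + 1)\<^sup>2"
  by (simp_all add: harm2_def add.commute)

lemma sum_Suc1: "(\<Sum>s=1..Suc n. f s) = (\<Sum>s=1..n. f s) + f (Suc n)" for f :: "nat \<Rightarrow> real"
  by simp

lemma inverse_Suc_eq: "1 / (real n + 1) * (real n + 1) = 1"
  by (simp add: field_simps)

lemma harm_Suc_real: "(harm (Suc n) :: real) = harm n + 1 / (real n + 1)"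
  by (simp add: harm_Suc field_simps)

lemma sum_harm: "(\<Sum>s=1..n. harm s :: real) = (real n + 1) * harm n - n"
proof (induction n)
  case (Suc n)
  define r where "r = 1 / (real n + 1)"
  have r: "r * (real n + 1) = 1" "r\<^sup>2 = 1 / (real n + 1)\<^sup>2" "harm (Suc n) / real (Suc n) = harm (Suc n) * r"
    by (simp_all add: r_def add_eq_0_iff power_divide add.commute)
  show ?case
    unfolding sum_Suc1 Suc r(3) unfolding harm_Suc_real harm2_simps of_nat_Suc r(2)[symmetric] r_def[symmetric]
    using r(1) by (simp add: algebra_simps)
next
  case 0
  show ?case by (simp add: harm_expand)
qed

lemma sum_times_harm:
  "(\<Sum>s=1..n. real s * harm s) = real n * (real n + 1) / 2 * harm n - real n * (real n - 1) / 4"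
proof (induction n)
  case (Suc n)
  define r where "r = 1 / (real n + 1)"
  have r: "r * (real n + 1) = 1" "r\<^sup>2 = 1 / (real n + 1)\<^sup>2" "harm (Suc n) / real (Suc n) = harm (Suc n) * r"
    by (simp_all add: r_def add_eq_0_iff power_divide add.commute)
  have nr: "r * real n = 1 - r" "r * (real n * real n) = real n - (1 - r)"
    using r(1) by algebra+
  show ?case
    unfolding sum_Suc1 Suc r(3) unfolding harm_Suc_real harm2_simps of_nat_Suc r(2)[symmetric] r_def[symmetric]
    using nr by (simp add: field_simps)
next
  case 0
  show ?case by (simp add: harm_expand)
qed

lemma sum_harm_square:
  "(\<Sum>s=1..n. (harm s)\<^sup>2 :: real) = (real n + 1) * (harm n)\<^sup>2 - (2 * real n + 1) * harm n + 2 * real n"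
proof (induction n)
  case (Suc n)
  show ?case
    unfolding sum_Suc1 Suc harm_Suc_real harm2_simps of_nat_Suc
    using inverse_Suc_eq[of n] by algebra
next
  case 0
  show ?case by (simp add: harm_expand)
qed

lemma sum_times_harm_square:
  "(\<Sum>s=1..n. (real s * harm s)\<^sup>2) =
     real n * (real n + 1) * (2 * real n + 1) / 6 * (harm n)\<^sup>2
     - (real n * (real n - 1) * (4 * real n + 1) / 18 + 1 / 6) * harm n
     + real n * (8 * (real n)\<^sup>2 - 15 * real n + 25) / 108"
proof (induction n)
  case (Suc n)
  then show ?case unfolding sum.cl_ivl_Suc using Suc
    by (simp add: harm_Suc_real divide_simps power2_eq_square) algebra
next
  case 0
  show ?case by (simp add: harm_expand)
qed

lemma sum_harm_div: "(\<Sum>s=1..n. harm s / real s) = ((harm n)\<^sup>2 + harm2 n) / 2"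
proof (induction n)
  case (Suc n)
  define r where "r = 1 / (real n + 1)"
  have r: "r * (real n + 1) = 1" "r\<^sup>2 = 1 / (real n + 1)\<^sup>2" "harm (Suc n) / real (Suc n) = harm (Suc n) * r"
    by (simp_all add: r_def add_eq_0_iff power_divide add.commute)
  show ?case
    unfolding sum_Suc1 Suc r(3) unfolding harm_Suc_real harm2_simps of_nat_Suc r(2)[symmetric] r_def[symmetric]
    by (simp add: field_simps power2_eq_square)
next
  case 0
  show ?case by (simp add: harm_expand)
qed

section \<open>Convolution sums of harmonic numbers\<close>

lemma sum_reflect: "(\<Sum>s=1..n. f (Suc n - s)) = (\<Sum>s=1..n. f s)"
  for f :: "nat \<Rightarrow> 'a::comm_monoid_add"
  using sum.atLeastAtMost_rev[of f 1 n] by simp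

lemma sum_inverse_conv:
  "(\<Sum>s=1..n. 1 / (real s * real (Suc n - s))) = 2 * harm n / (real n + 1)"
proof -
  have "(\<Sum>s=1..n. 1 / (real s * real (Suc n - s))) =
      (\<Sum>s=1..n. (1 / real s + 1 / real (Suc n - s)) / (real n + 1))"
  proof (rule sum.cong)
    fix s assume "s \<in> {1..n}"
    then have "real s > 0" "real (Suc n - s) > 0" "real n + 1 = real s + real (Suc n - s)" by auto
    then show "1 / (real s * real (Suc n - s)) = (1 / real s + 1 / real (Suc n - s)) / (real n + 1)"
      by (simp add: divide_simps)
  qed simp
  also have "\<dots> = ((\<Sum>s=1..n. 1 / real s) + (\<Sum>s=1..n. 1 / real (Suc n - s))) / (real n + 1)"
    by (simp only: sum_divide_distrib[symmetric] sum.distrib)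
  also have "(\<Sum>s=1..n. 1 / real (Suc n - s)) = (\<Sum>s=1..n. 1 / real s)"
    by (rule sum_reflect)
  also have "(\<Sum>s=1..n. 1 / real s) = harm n"
    by (simp add: harm_def field_simps)
  finally show ?thesis by simp
qed

text \<open>Discrete differentiation of a convolution: raising \<open>n\<close> by one replaces
  \<open>g\<close> by its increments. These are \<open>1 / k\<close> for \<open>harm\<close>, and
  \<open>harm k + 1\<close> for \<open>k * harm k\<close>, so each convolution below reduces to a
  simpler one.\<close>

lemma sum_conv_Suc:
  fixes f g :: "nat \<Rightarrow> real"
  shows "(\<Sum>s=1..Suc n. f s * g (Suc (Suc n) - s))
    = (\<Sum>s=1..n. f s * g (Suc n - s)) + (\<Sum>s=1..Suc n. f s * (g (Suc (Suc n) - s) - g (Suc n - s)))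
      + f (Suc n) * g 0"
  by (simp add: sum.distrib sum_subtractf algebra_simps)

lemma sum_harm_conv_inverse:
  "(\<Sum>s=1..n. harm (Suc n - s) / real s) = (harm (Suc n))\<^sup>2 - harm2 (Suc n)"
proof (induction n)
  case 0 then show ?case by (simp add: harm_expand)
next
  case (Suc n)
  have "(\<Sum>s=1..Suc n. 1 / real s * (harm (Suc (Suc n) - s) - harm (Suc n - s)))
      = (\<Sum>s=1..Suc n. 1 / (real s * real (Suc (Suc n) - s)))"
    by (rule sum.cong) (auto simp: Suc_diff_le harm_Suc_real field_simps of_nat_diff)
  also have "\<dots> = 2 * harm (Suc n) / (real (Suc n) + 1)" by (rule sum_inverse_conv)
  finally have d: "(\<Sum>s=1..Suc n. 1 / real s * (harm (Suc (Suc n) - s) - harm (Suc n - s)))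
      = 2 * harm (Suc n) / (real (Suc n) + 1)" .
  have "(\<Sum>s=1..Suc n. harm (Suc (Suc n) - s) / real s) =
     (\<Sum>s=1..Suc n. 1 / real s * harm (Suc (Suc n) - s))" by simp
  also have "\<dots> = (harm (Suc n))\<^sup>2 - harm2 (Suc n) + 2 * harm (Suc n) / (real (Suc n) + 1)"
    unfolding sum_conv_Suc[of "\<lambda>s. 1 / real s" harm] d using Suc by (simp add: harm_expand del: sum.cl_ivl_Suc)
  also have "\<dots> = (harm (Suc (Suc n)))\<^sup>2 - harm2 (Suc (Suc n))"
    unfolding harm_Suc_real[of "Suc n"] harm2_simps(2)[of "Suc n"] using inverse_Suc_eq[of "Suc n"] by (simp add: divide_simps power2_eq_square) algebra
  finally show ?case .
qed

lemma sum_harm_conv: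
  "(\<Sum>s=1..n. harm s * harm (Suc n - s) :: real) =
     (real n + 2) * ((harm (Suc n))\<^sup>2 - harm2 (Suc n)) - 2 * (real n + 1) * harm (Suc n) + 2 * (real n + 1)"
proof (induction n)
  case 0 then show ?case by (simp add: harm_expand)
next
  case (Suc n)
  have "(\<Sum>s=1..Suc n. harm s * (harm (Suc (Suc n) - s) - harm (Suc n - s)))
      = (\<Sum>s=1..Suc n. harm s / real (Suc (Suc n) - s))"
    by (rule sum.cong) (auto simp: Suc_diff_le harm_Suc_real field_simps of_nat_diff)
  also have "\<dots> = (\<Sum>s=1..Suc n. harm (Suc (Suc n) - s) / real s)"
    by (subst sum_reflect[symmetric], rule sum.cong) auto
  finally have d: "(\<Sum>s=1..Suc n. harm s * (harm (Suc (Suc n) - s) - harm (Suc n - s)))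
      = (harm (Suc (Suc n)))\<^sup>2 - harm2 (Suc (Suc n))" unfolding sum_harm_conv_inverse .
  define N where "N = real n"
  define h where "h = (harm (Suc n) :: real)"
  define g where "g = harm2 (Suc n)"
  define r where "r = 1 / (N + 2)"
  have r: "r * (N + 2) = 1" by (simp add: r_def N_def)
  have N: "real (Suc n) = N + 1" by (simp add: N_def)
  have h: "harm (Suc (Suc n)) = h + r" unfolding harm_Suc_real[of "Suc n"] by (simp add: h_def r_def N_def)
  have g: "harm2 (Suc (Suc n)) = g + r\<^sup>2" by (simp add: g_def r_def N_def power_divide)
  have e: "(N + 1 + 2) * ((h + r)\<^sup>2 - (g + r\<^sup>2)) = (N + 3) * (h\<^sup>2 - g) + 2 * h * (1 + r)"
    "2 * (N + 1 + 1) * (h + r) = 2 * (N + 2) * h + 2"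
    using r by algebra+
  show ?case unfolding sum_conv_Suc[of harm harm] d Suc h g N e
    unfolding N_def[symmetric] h_def[symmetric] g_def[symmetric] by (simp add: harm_expand algebra_simps power2_eq_square)
qed

lemma sum_times_harm_conv:
  "(\<Sum>s=1..n. (real s * harm s) * (real (Suc n - s) * harm (Suc n - s))) =
     real n * (real n + 1) * (real n + 2) / 6 * ((harm (Suc n))\<^sup>2 - harm2 (Suc n))
     - real n * (real n + 1) * (5 * real n + 4) / 18 * harm (Suc n)
     + real n * (real n + 1) * (37 * real n + 44) / 108"
proof (induction n)
  case 0 then show ?case by simp
next
  case (Suc n)
  define E where "E = (\<Sum>s=1..n. harm s * harm (Suc n - s) :: real)"
  define B where "B = (\<Sum>s=1..n. (real s * harm s) * harm (Suc n - s) :: real)"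
  \<comment> \<open>Averaging \<open>B\<close> with its reflection replaces the factor
    \<open>s\<close> by \<open>(n + 1) / 2\<close>, so that \<open>B\<close> becomes a multiple of
    the known convolution \<open>E\<close>.\<close>
  have "B = (\<Sum>s=1..n. (real (Suc n - s) * harm (Suc n - s)) * harm s)"
    unfolding B_def by (subst sum_reflect[symmetric], rule sum.cong) auto
  then have "2 * B = (\<Sum>s=1..n. (real s * harm s) * harm (Suc n - s) + (real (Suc n - s) * harm (Suc n - s)) * harm s)"
    by (simp add: B_def sum.distrib)
  also have "\<dots> = (\<Sum>s=1..n. (real n + 1) * (harm s * harm (Suc n - s)))"
    by (rule sum.cong) (auto simp: of_nat_diff algebra_simps)
  finally have B: "B = (real n + 1) / 2 * E" by (simp only: E_def sum_distrib_left[symmetric])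
  have "(\<Sum>s=1..Suc n. (real s * harm s) * (real (Suc (Suc n) - s) * harm (Suc (Suc n) - s) - real (Suc n - s) * harm (Suc n - s)))
      = (\<Sum>s=1..Suc n. (real s * harm s) * harm (Suc n - s) + real s * harm s)"
    by (rule sum.cong) (auto simp: Suc_diff_le harm_Suc_real field_simps of_nat_diff)
  also have "\<dots> = B + (\<Sum>s=1..Suc n. real s * harm s)"
    by (simp add: B_def sum.distrib harm_expand)
  finally have d: "(\<Sum>s=1..Suc n. (real s * harm s) * (real (Suc (Suc n) - s) * harm (Suc (Suc n) - s) - real (Suc n - s) * harm (Suc n - s)))
      = B + (\<Sum>s=1..Suc n. real s * harm s)" .
  define N where "N = real n"
  define h where "h = (harm (Suc n) :: real)"
  define g where "g = harm2 (Suc n)"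
  define r where "r = 1 / (N + 2)"
  have r: "r * (N + 2) = 1" by (simp add: r_def N_def)
  have N: "real (Suc n) = N + 1" by (simp add: N_def)
  have h: "harm (Suc (Suc n)) = h + r" unfolding harm_Suc_real[of "Suc n"] by (simp add: h_def r_def N_def)
  have g: "harm2 (Suc (Suc n)) = g + r\<^sup>2" by (simp add: g_def r_def N_def power_divide)
  have e1: "(N + 1) * (N + 1 + 1) * (N + 1 + 2) / 6 * ((h + r)\<^sup>2 - (g + r\<^sup>2))
      = (N + 1) * (N + 2) * (N + 3) / 6 * (h\<^sup>2 - g) + (N + 1) * (N + 3) / 3 * h"
    using r by algebra
  have e2: "(N + 1) * (N + 1 + 1) * (5 * (N + 1) + 4) / 18 * (h + r)
      = (N + 1) * (N + 2) * (5 * N + 9) / 18 * h + (N + 1) * (5 * N + 9) / 18"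
    using r by algebra
  show ?case unfolding sum_conv_Suc[of "\<lambda>s. real s * harm s" "\<lambda>s. real s * harm s"] d Suc B
      E_def sum_harm_conv sum_times_harm h g N e1 e2
    unfolding N_def[symmetric] h_def[symmetric] g_def[symmetric] of_nat_0 mult_zero_left mult_zero_right add_0_right
    by (simp add: field_simps power2_eq_square)
qed

text \<open>The centred toll of the recursion: \<open>n + \<mu>\<^sub>j + \<mu>\<^sub>n\<^sub>-\<^sub>1\<^sub>-\<^sub>j - \<mu>\<^sub>n - 1\<close> in terms of
  \<open>s = j + 1\<close>; the weights \<open>s\<close> and \<open>n + 1 - s\<close> add up to \<open>n + 1\<close>.\<close>

definition toll :: "nat \<Rightarrow> nat \<Rightarrow> real" where
  "toll n s = 2 * (real s * harm s) + 2 * (real (Suc n - s) * harm (Suc n - s))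
     - (real n + 1) * (2 * harm (Suc n) - 1)"

lemma sum_toll: "(\<Sum>s=1..n. toll n s) = 0"
proof -
  have "(\<Sum>s=1..n. real (Suc n - s) * harm (Suc n - s)) = (\<Sum>s=1..n. real s * harm s)"
    by (rule sum_reflect)
  then have "(\<Sum>s=1..n. toll n s) = 4 * (\<Sum>s=1..n. real s * harm s)
     - real n * ((real n + 1) * (2 * harm (Suc n) - 1))"
    unfolding toll_def sum_subtractf sum.distrib sum_distrib_left[symmetric] by (simp add: algebra_simps)
  also have "\<dots> = 0"
    unfolding sum_times_harm harm_Suc_real by (simp add: divide_simps) algebra
  finally show ?thesis .
qed

text \<open>The squares of harmonic numbers cancel between the sum of squares, the convolution and
  the centring constant. What survives is \<open>harm2\<close> and a single term linear in
  \<open>harm n\<close>; this is why the variances below have a closed form.\<close>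

lemma sum_toll_square:
  "(\<Sum>s=1..n. (toll n s)\<^sup>2) =
     (real n * (real n + 1) * (real n + 2) * (7 - 4 * harm2 n) - 7 * real n * (real n + 1) - 4 * harm n) / 3"
proof -
  define k where "k = (real n + 1) * (2 * harm (Suc n) - 1)"
  let ?p = "\<lambda>s::nat. real s * harm s :: real"
  have r1: "(\<Sum>s=1..n. ?p (Suc n - s)) = (\<Sum>s=1..n. ?p s)" by (rule sum_reflect)
  have r2: "(\<Sum>s=1..n. (?p (Suc n - s))\<^sup>2) = (\<Sum>s=1..n. (?p s)\<^sup>2)" by (rule sum_reflect)
  have "(\<Sum>s=1..n. (toll n s)\<^sup>2) = (\<Sum>s=1..n. 4 * (?p s)\<^sup>2 + 4 * (?p (Suc n - s))\<^sup>2
      + 8 * (?p s * ?p (Suc n - s)) - 4 * k * ?p s - 4 * k * ?p (Suc n - s) + k\<^sup>2)"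
    unfolding toll_def k_def by (rule sum.cong) (simp_all add: power2_eq_square algebra_simps)
  also have "\<dots> = 8 * (\<Sum>s=1..n. (?p s)\<^sup>2) + 8 * (\<Sum>s=1..n. ?p s * ?p (Suc n - s))
      - 8 * k * (\<Sum>s=1..n. ?p s) + real n * k\<^sup>2"
    unfolding sum_subtractf sum.distrib sum_distrib_left[symmetric] r1 r2 by simp
  also have "\<dots> = (real n * (real n + 1) * (real n + 2) * (7 - 4 * harm2 n) - 7 * real n * (real n + 1) - 4 * harm n) / 3"
  proof -
    define N where "N = real n"
    define h where "h = (harm (Suc n) :: real)"
    define g where "g = harm2 (Suc n)"
    define r where "r = 1 / (N + 1)"
    have r: "r * (N + 1) = 1" by (simp add: r_def N_def add_eq_0_iff)
    have h: "harm n = h - r" by (simp add: h_def harm_Suc_real r_def N_def)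
    have g: "harm2 n = g - r\<^sup>2" by (simp add: g_def r_def N_def power_divide)
    have k: "k = (N + 1) * (2 * h - 1)" by (simp add: k_def h_def N_def)
    have s1: "(\<Sum>s=1..n. ?p s) = N * (N + 1) / 2 * h - N / 2 - N * (N - 1) / 4"
      unfolding sum_times_harm h N_def[symmetric] using r by algebra
    have a1: "N * (N + 1) * (2 * N + 1) / 6 * (h - r)\<^sup>2
        = N * (N + 1) * (2 * N + 1) / 6 * h\<^sup>2 - N * (2 * N + 1) / 3 * h + (2 * N - 1 + r) / 6"
      using r by algebra
    have a2: "(N * (N - 1) * (4 * N + 1) / 18 + 1 / 6) * (h - r)
        = (N * (N - 1) * (4 * N + 1) / 18 + 1 / 6) * h - (4 * N\<^sup>2 - 7 * N + 6 - 6 * r) / 18 - r / 6"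
      using r by algebra
    have a3: "N * (N + 1) * (N + 2) * (7 - 4 * (g - r\<^sup>2)) = N * (N + 1) * (N + 2) * (7 - 4 * g) + 4 * (N + 1 - r)"
      using r by algebra
    show ?thesis
      unfolding s1 sum_times_harm_square sum_times_harm_conv h g
      unfolding N_def[symmetric] h_def[symmetric] g_def[symmetric] k a1 a2 a3 by (simp add: field_simps power2_eq_square)
  qed
  finally show ?thesis .
qed

section \<open>The centred cost law and its variance\<close>

text \<open>Every law built below, joint laws included, has finite support; this one condition
  replaces all integrability arguments.\<close>

abbreviation fin_pmf :: "'a pmf \<Rightarrow> bool" where
  "fin_pmf p \<equiv> finite (set_pmf p)"

abbreviation expect :: "'a pmf \<Rightarrow> ('a \<Rightarrow> real) \<Rightarrow> real" where
  "expect p f \<equiv> measure_pmf.expectation p f"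

lemma expect_bind:
  assumes "fin_pmf p" "\<And>x. x \<in> set_pmf p \<Longrightarrow> fin_pmf (f x)"
  shows "expect (bind_pmf p f) h = expect p (\<lambda>x. expect (f x) h)"
  by (subst pmf_expectation_bind[of "set_pmf p"])
     (use assms in \<open>auto simp: integral_measure_pmf[of "set_pmf p"]\<close>)

lemma expect_linear:
  assumes "fin_pmf p"
  shows "expect p (\<lambda>x. f x + g x) = expect p f + expect p g"
    and "expect p (\<lambda>x. f x - g x) = expect p f - expect p g"
  by (rule Bochner_Integration.integral_add Bochner_Integration.integral_diff;
      rule integrable_measure_pmf_finite[OF assms])+

lemma expect_mono:
  assumes "fin_pmf p" "\<And>x. x \<in> set_pmf p \<Longrightarrow> f x \<le> g x"
  shows "expect p f \<le> expect p g"
  by (rule integral_mono_AE)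
     (use assms in \<open>auto simp: integrable_measure_pmf_finite AE_measure_pmf_iff\<close>)

lemma expect_pair:
  assumes "fin_pmf p" "fin_pmf q"
  shows "expect (bind_pmf p (\<lambda>x. bind_pmf q (\<lambda>y. return_pmf (F x y)))) G
    = expect p (\<lambda>x. expect q (\<lambda>y. G (F x y)))"
  using assms by (simp add: expect_bind)

text \<open>Pythagoras: with independent centred variables all mixed terms vanish, those with the
  constant \<open>c\<close> included.\<close>

lemma expect_indep_square:
  assumes "fin_pmf p" "fin_pmf q" "expect p f = 0" "expect q g = 0"
  shows "expect p (\<lambda>x. expect q (\<lambda>y. (f x + g y + c)\<^sup>2))
    = expect p (\<lambda>x. (f x)\<^sup>2) + expect q (\<lambda>y. (g y)\<^sup>2) + c\<^sup>2"
proof -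
  have "expect q (\<lambda>y. (f x + g y + c)\<^sup>2) = (f x)\<^sup>2 + 2 * c * f x + expect q (\<lambda>y. (g y)\<^sup>2) + c\<^sup>2" for x
  proof -
    have "(\<lambda>y. (f x + g y + c)\<^sup>2) = (\<lambda>y. (g y)\<^sup>2 + 2 * (f x + c) * g y + (f x + c)\<^sup>2)"
      by (auto simp: power2_eq_square algebra_simps)
    then show ?thesis using assms(2,4)
      by (simp add: expect_linear power2_eq_square algebra_simps)
  qed
  then show ?thesis using assms(1,3) by (simp add: expect_linear)
qed

lemma expect_pmf_of_set_1:
  assumes "n \<ge> 1"
  shows "expect (pmf_of_set {1..n}) f = (\<Sum>s=1..n. f s) / real n"
  using assms by (subst integral_pmf_of_set) auto

text \<open>Centred but not divided by \<open>n\<close>: the recursion stays additive, and the empty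
  subproblem \<open>n = 0\<close> needs no convention for a quotient.\<close>

definition cost_law :: "nat \<Rightarrow> real pmf" where
  "cost_law n = map_pmf (\<lambda>k. real k - qs_mean n) (qs_cost n)"

lemma fin_qs_cost: "fin_pmf (qs_cost n)"
proof (induction n rule: less_induct)
  case (less n)
  then show ?case by (cases n) (auto simp: set_pmf_of_set)
qed

lemma fin_cost_law: "fin_pmf (cost_law n)"
  using fin_qs_cost by (simp add: cost_law_def)

lemma cost_law_0: "cost_law 0 = return_pmf 0"
  by (simp add: cost_law_def qs_mean_def harm_def)

lemma toll_eq:
  assumes "s \<in> {1..n}"
  shows "toll n s = real n - 1 + qs_mean (s - 1) + qs_mean (n - s) - qs_mean n"
proof -
  obtain j where j: "s = Suc j" "j < n" using assms by (cases s) auto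
  obtain i where i: "n = j + Suc i" using j by (metis less_iff_Suc_add add_Suc_right)
  have 1: "real (Suc j) * harm (Suc j) = real (Suc j) * harm j + 1"
      "real (Suc i) * harm (Suc i) = real (Suc i) * harm i + 1"
      "(real n + 1) * harm (Suc n) = (real n + 1) * harm n + 1"
    by (simp_all add: harm_Suc_real field_simps)
  have s: "Suc n - s = Suc i" "n - s = i" "s - 1 = j" using j i by auto
  have "toll n s = 2 * (real (Suc j) * harm (Suc j)) + 2 * (real (Suc i) * harm (Suc i)) - 2 * ((real n + 1) * harm (Suc n)) + (real n + 1)"
    unfolding toll_def s using j by (simp add: algebra_simps)
  then show ?thesis unfolding qs_mean_def s 1 using i by (simp add: algebra_simps)
qed

lemma cost_law_rec:
  assumes "n \<ge> 1"
  shows "cost_law n = bind_pmf (pmf_of_set {1..n}) (\<lambda>s. bind_pmf (cost_law (s - 1)) (\<lambda>a.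
     bind_pmf (cost_law (n - s)) (\<lambda>b. return_pmf (a + b + toll n s))))"
proof -
  obtain k where k: "n = Suc k" using assms by (cases n) auto
  have i: "{1..n} = Suc ` {..k}" unfolding k
    by (metis One_nat_def atMost_atLeast0 image_Suc_atLeastAtMost)
  have u: "pmf_of_set {1..n} = map_pmf Suc (pmf_of_set {..k})"
    unfolding i by (rule map_pmf_of_set_inj[symmetric]) auto
  have t: "toll n (Suc j) = real k + qs_mean j + qs_mean (k - j) - qs_mean n" if "j \<le> k" for j
    using toll_eq[of "Suc j" n] that k by auto
  have "cost_law n = bind_pmf (pmf_of_set {..k}) (\<lambda>j. bind_pmf (qs_cost j) (\<lambda>a.
     bind_pmf (qs_cost (k - j)) (\<lambda>b. return_pmf (real (a + b + k) - qs_mean n))))"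
    by (simp add: cost_law_def k map_bind_pmf)
  also have "\<dots> = bind_pmf (pmf_of_set {..k}) (\<lambda>j. bind_pmf (cost_law j) (\<lambda>a.
     bind_pmf (cost_law (k - j)) (\<lambda>b. return_pmf (a + b + toll n (Suc j)))))"
    by (rule bind_pmf_cong) (auto simp: cost_law_def bind_map_pmf t algebra_simps)
  finally show ?thesis unfolding u bind_map_pmf by (simp add: k)
qed

lemma expect_cost_law: "expect (cost_law n) (\<lambda>x. x) = 0"
proof (induction n rule: less_induct)
  case (less n)
  show ?case
  proof (cases "n = 0")
    case False
    then have n: "n \<ge> 1" by simp
    have "expect (cost_law n) (\<lambda>x. x) = (\<Sum>s=1..n. expect (cost_law (s - 1)) (\<lambda>a. expect (cost_law (n - s)) (\<lambda>b. a + b + toll n s))) / n"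
      using n unfolding cost_law_rec[OF n]
      by (subst expect_bind) (simp_all add: expect_bind fin_cost_law expect_pmf_of_set_1[OF n, simplified] set_pmf_of_set)
    also have "(\<Sum>s=1..n. expect (cost_law (s - 1)) (\<lambda>a. expect (cost_law (n - s)) (\<lambda>b. a + b + toll n s))) = (\<Sum>s=1..n. toll n s)"
      using less by (intro sum.cong) (auto simp: expect_linear fin_cost_law)
    finally show ?thesis using sum_toll[of n] by simp
  qed (simp add: cost_law_0)
qed

definition cost_var :: "nat \<Rightarrow> real" where
  "cost_var n = expect (cost_law n) (\<lambda>x. x\<^sup>2)"

lemma cost_var_rec:
  assumes "n \<ge> 1"
  shows "real n * cost_var n = 2 * (\<Sum>s=1..n. cost_var (s - 1)) + (\<Sum>s=1..n. (toll n s)\<^sup>2)"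
proof -
  have "cost_var n = (\<Sum>s=1..n. expect (cost_law (s - 1)) (\<lambda>a. expect (cost_law (n - s)) (\<lambda>b. (a + b + toll n s)\<^sup>2))) / n"
      using assms unfolding cost_law_rec[OF assms] cost_var_def
      by (subst expect_bind) (simp_all add: expect_bind fin_cost_law expect_pmf_of_set_1[OF assms, simplified] set_pmf_of_set)
  also have "\<dots> = (\<Sum>s=1..n. cost_var (s - 1) + cost_var (n - s) + (toll n s)\<^sup>2) / n"
    by (simp add: expect_indep_square fin_cost_law expect_cost_law cost_var_def)
  also have "\<dots> = ((\<Sum>s=1..n. cost_var (s - 1)) + (\<Sum>s=1..n. cost_var (Suc n - s - 1)) + (\<Sum>s=1..n. (toll n s)\<^sup>2)) / n"
    by (simp add: sum.distrib)
  also have "(\<Sum>s=1..n. cost_var (Suc n - s - 1)) = (\<Sum>s=1..n. cost_var (s - 1))"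
    by (rule sum_reflect)
  finally show ?thesis using assms by (simp add: field_simps)
qed

text \<open>The classical variance
  \<open>7 n^2 + 13 n - 2 (n + 1) H_n - 4 (n + 1)^2 H_n^(2)\<close>, rewritten at
  \<open>Suc n\<close>. Subtracting two consecutive instances of \<open>cost_var_rec\<close> removes
  the sum over all smaller sizes and leaves a first-order recurrence.\<close>

lemma cost_var_eq:
  "cost_var n = (real n + 1)\<^sup>2 * (7 - 4 * harm2 (Suc n)) - (real n + 1) * (2 * harm (Suc n) + 1)"
proof (induction n)
  case 0
  then show ?case by (simp add: cost_var_def cost_law_0 harm_expand)
next
  case (Suc n)
  have a: "real n * cost_var n = 2 * (\<Sum>s=1..n. cost_var (s - 1)) + (\<Sum>s=1..n. (toll n s)\<^sup>2)"
    by (cases "n = 0") (use cost_var_rec[of n] in auto)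
  have b: "real (Suc n) * cost_var (Suc n) = 2 * (\<Sum>s=1..Suc n. cost_var (s - 1)) + (\<Sum>s=1..Suc n. (toll (Suc n) s)\<^sup>2)"
    by (rule cost_var_rec) simp
  have q: "(\<Sum>s=1..n. (toll n s)\<^sup>2) =
      (real n * (real n + 1) * (real n + 2) * (7 - 4 * harm2 (Suc n)) - (7 * real n - 4) * (real n + 1) - 4 * harm (Suc n)) / 3"
    unfolding sum_toll_square harm2_simps harm_Suc_real power_one_over[symmetric]
    using inverse_Suc_eq[of n] by algebra
  have "(real n + 1) * cost_var (Suc n) = (real n + 2) * cost_var n
     + (\<Sum>s=1..Suc n. (toll (Suc n) s)\<^sup>2) - (\<Sum>s=1..n. (toll n s)\<^sup>2)"
    using a b by (simp add: algebra_simps)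
  also have "\<dots> = (real n + 1) * ((real n + 2)\<^sup>2 * (7 - 4 * harm2 (Suc n)) - (real n + 2) * (2 * harm (Suc n) + 1) - 6)"
    unfolding sum_toll_square[of "Suc n"] Suc q of_nat_Suc by algebra
  finally have "(real n + 1) * cost_var (Suc n) = (real n + 1) * ((real n + 2)\<^sup>2 * (7 - 4 * harm2 (Suc n)) - (real n + 2) * (2 * harm (Suc n) + 1) - 6)" .
  moreover have "real n + 1 \<noteq> 0" by linarith
  ultimately have "cost_var (Suc n) = (real n + 2)\<^sup>2 * (7 - 4 * harm2 (Suc n)) - (real n + 2) * (2 * harm (Suc n) + 1) - 6"
    by (metis mult_left_cancel)
  moreover have "1 + real n + 1 = real n + 2" by simp
  moreover have "1 / (real n + 2) * (real n + 2) = 1" by simp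
  ultimately show ?case
    unfolding harm_Suc_real[of "Suc n"] harm2_simps(2)[of "Suc n"] of_nat_Suc power_one_over[symmetric] by algebra
qed

section \<open>An auxiliary self-similar law\<close>

lemma harm2_diff_bounds:
  assumes "a \<le> b"
  shows "1 / (real a + 1) - 1 / (real b + 1) \<le> harm2 b - harm2 a"
    and "a \<ge> 1 \<Longrightarrow> harm2 b - harm2 a \<le> 1 / real a - 1 / real b"
proof -
  show "1 / (real a + 1) - 1 / (real b + 1) \<le> harm2 b - harm2 a"
    using assms
  proof (induction b rule: dec_induct)
    case (step b)
    have "1 / (real b + 1) - 1 / (real b + 2) \<le> 1 / (real b + 1)\<^sup>2"
      by (simp add: divide_simps power2_eq_square)
    then show ?case using step by (simp add: algebra_simps)
  qed simp
  show "harm2 b - harm2 a \<le> 1 / real a - 1 / real b" if "a \<ge> 1"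
    using assms
  proof (induction b rule: dec_induct)
    case (step b)
    then have "real b > 0" using that by auto
    then have "1 / (real b + 1)\<^sup>2 \<le> 1 / real b - 1 / (real b + 1)"
      by (simp add: divide_simps power2_eq_square)
    then show ?case using step by (simp add: algebra_simps)
  qed simp
qed

lemma harm_le_real: "(harm n :: real) \<le> real n"
proof (induction n)
  case (Suc n)
  have "1 / (real n + 1) \<le> 1" by simp
  then show ?case using Suc unfolding harm_Suc_real of_nat_Suc by linarith
next
  case 0
  show ?case by (simp add: harm_expand)
qed

text \<open>The fixed point \<open>v\<close> of the variance recursion of the discretised equation:
  the two squared weights \<open>S / (K + 1)\<close> and \<open>1 - S / (K + 1)\<close> have total
  mean \<open>(2 K + 1) / (3 (K + 1))\<close>, and solving for \<open>v\<close> gives this quotient.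
  It tends to \<open>7 - 2 pi^2 / 3\<close>, about 0.42.\<close>

definition split_var :: "nat \<Rightarrow> real" where
  "split_var K = 3 * (\<Sum>s=1..K. (toll K s)\<^sup>2) / (real K * (real K + 1) * (real K + 2))"

lemma split_var_nonneg: "split_var K \<ge> 0"
  unfolding split_var_def by (intro divide_nonneg_nonneg mult_nonneg_nonneg sum_nonneg) auto

lemma split_var_eq:
  assumes "K \<ge> 1"
  shows "split_var K = 7 - 4 * harm2 K - 7 / (real K + 2) - 4 * harm K / (real K * (real K + 1) * (real K + 2))"
proof -
  have "real K > 0" using assms by simp
  then show ?thesis unfolding split_var_def sum_toll_square by (simp add: divide_simps) algebra
qed

lemma split_var_le_harm2:
  assumes "1 \<le> a" "a \<le> K"
  shows "split_var K \<le> 7 - 4 * harm2 a - 4 / (real a + 1)"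
proof -
  have "4 * harm K / (real K * (real K + 1) * (real K + 2)) \<ge> 0"
    by (simp add: harm_nonneg)
  moreover have "4 / (real K + 1) \<le> 7 / (real K + 2)" using assms by (simp add: divide_simps)
  moreover have "1 / (real a + 1) - 1 / (real K + 1) \<le> harm2 K - harm2 a"
    by (rule harm2_diff_bounds) (use assms in simp)
  ultimately show ?thesis using split_var_eq[of K] assms by simp
qed

text \<open>Stopping the sum at 10 gives 0.4373, against a limit of about 0.4203.\<close>

lemma split_var_le:
  assumes "K \<ge> 10"
  shows "split_var K \<le> 11 / 25"
  using split_var_le_harm2[of 10 K] assms by (simp add: eval_nat_numeral)

text \<open>Needed when the multiplier \<open>n + 1\<close> of the auxiliary variable is finally
  exchanged for \<open>n\<close>. The 11 is 7 + 4, from the last two terms of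
  \<open>split_var_eq\<close>; the bound \<open>harm (Suc n) \<ge> 3/2\<close> makes the negative
  term of the exact variance large enough to absorb the telescoping loss
  \<open>4 / (n + 1)\<close>.\<close>

lemma cost_var_le_split_var:
  assumes "1 \<le> n" "n < K"
  shows "cost_var n \<le> (real n + 1)\<^sup>2 * (split_var K + 11 / real K)"
proof -
  have h: "(harm (Suc n) :: real) \<ge> 3 / 2"
  proof -
    have "(harm (Suc n) :: real) \<ge> harm 2"
      using assms unfolding harm_def by (intro sum_mono2) auto
    then show ?thesis by (simp add: harm_expand)
  qed
  have hk: "4 * harm K / (real K * (real K + 1) * (real K + 2)) \<le> 4 / real K"
  proof -
    have "4 * harm K / (real K * (real K + 1) * (real K + 2)) \<le> 4 * real K / (real K * (real K + 1) * (real K + 2))"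
      by (intro divide_right_mono mult_left_mono harm_le_real) auto
    also have "\<dots> = 4 / ((real K + 1) * (real K + 2))" using assms by simp
    also have "\<dots> \<le> 4 / real K" using assms by (intro frac_le) (auto simp: algebra_simps)
    finally show ?thesis .
  qed
  have "7 / (real K + 2) \<le> 7 / real K" using assms by (simp add: divide_simps)
  moreover have "harm2 K - harm2 (Suc n) \<le> 1 / real (Suc n) - 1 / real K"
    by (rule harm2_diff_bounds(2)) (use assms in auto)
  ultimately have "7 - 4 * harm2 (Suc n) - 4 / (real n + 1) \<le> split_var K + 11 / real K"
  proof -
    have d: "1 / real (Suc n) = 1 / (real n + 1)" "4 / (real n + 1) = 4 * (1 / (real n + 1))"
      "7 / real K = 7 * (1 / real K)" "4 / real K = 4 * (1 / real K)" "11 / real K = 11 * (1 / real K)"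
      by simp_all
    show ?thesis if "7 / (real K + 2) \<le> 7 / real K"
        "harm2 K - harm2 (Suc n) \<le> 1 / real (Suc n) - 1 / real K"
    proof -
      have "K \<ge> 1" "1 / real K \<ge> 0" using assms by simp_all
      from split_var_eq[OF this(1)] this(2) that hk show ?thesis unfolding d by linarith
    qed
  qed
  then have "(real n + 1)\<^sup>2 * (7 - 4 * harm2 (Suc n) - 4 / (real n + 1)) \<le> (real n + 1)\<^sup>2 * (split_var K + 11 / real K)"
    by (intro mult_left_mono) auto
  moreover have "(real n + 1)\<^sup>2 * (4 / (real n + 1)) = (real n + 1) * 4"
    by (simp add: power2_eq_square)
  moreover have "(real n + 1) * (2 * harm (Suc n) + 1) \<ge> (real n + 1) * 4"
    using h by (intro mult_left_mono) auto
  ultimately show ?thesis unfolding cost_var_eq by (simp only: right_diff_distrib)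
qed

text \<open>A discrete version of the limiting distributional equation, in which the uniform variable
  is replaced by \<open>S / (K + 1)\<close> with \<open>S\<close> uniform on \<open>{1..K}\<close>. The variance of the starting law is
  the one that the equation preserves.\<close>

primrec split_law :: "nat \<Rightarrow> nat \<Rightarrow> real pmf" where
  "split_law K 0 = map_pmf (\<lambda>b. if b then sqrt (split_var K) else - sqrt (split_var K)) (bernoulli_pmf (1/2))"
| "split_law K (Suc k) = bind_pmf (pmf_of_set {1..K}) (\<lambda>S. bind_pmf (split_law K k) (\<lambda>y.
     bind_pmf (split_law K k) (\<lambda>z. return_pmf
       (real S / (real K + 1) * y + real (Suc K - S) / (real K + 1) * z + toll K S / (real K + 1)))))"

lemma fin_split_law: "K \<ge> 1 \<Longrightarrow> fin_pmf (split_law K k)"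
  by (induction k) (auto simp: set_pmf_of_set set_pmf_bernoulli)

lemma expect_split_law:
  assumes "K \<ge> 1"
  shows "expect (split_law K k) (\<lambda>y. y) = 0"
proof (induction k)
  case (Suc k)
  have "expect (split_law K (Suc k)) (\<lambda>y. y) = (\<Sum>S=1..K. expect (split_law K k) (\<lambda>y. expect (split_law K k) (\<lambda>z.
      real S / (real K + 1) * y + real (Suc K - S) / (real K + 1) * z + toll K S / (real K + 1)))) / K"
    using assms unfolding split_law.simps
    by (subst expect_bind) (simp_all add: expect_bind fin_split_law expect_pmf_of_set_1[OF assms, simplified] set_pmf_of_set)
  also have "\<dots> = (\<Sum>S=1..K. toll K S / (real K + 1)) / K"
    using assms by (simp add: expect_linear fin_split_law Suc)
  also have "\<dots> = 0" using sum_toll[of K] by (simp add: sum_divide_distrib[symmetric])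
  finally show ?case .
qed simp

lemma expect_split_law_square:
  assumes "K \<ge> 1"
  shows "expect (split_law K k) (\<lambda>y. y\<^sup>2) = split_var K"
proof (induction k)
  case 0
  then show ?case using split_var_nonneg by simp
next
  case (Suc k)
  define v where "v = split_var K"
  have K: "real K > 0" using assms by simp
  have "expect (split_law K (Suc k)) (\<lambda>y. y\<^sup>2) = (\<Sum>S=1..K. expect (split_law K k) (\<lambda>y. expect (split_law K k) (\<lambda>z.
      (real S / (real K + 1) * y + real (Suc K - S) / (real K + 1) * z + toll K S / (real K + 1))\<^sup>2))) / K"
    using assms unfolding split_law.simps
    by (subst expect_bind) (simp_all add: expect_bind fin_split_law expect_pmf_of_set_1[OF assms, simplified] set_pmf_of_set)
  also have "\<dots> = (\<Sum>S=1..K. (real S / (real K + 1))\<^sup>2 * v + (real (Suc K - S) / (real K + 1))\<^sup>2 * v + (toll K S / (real K + 1))\<^sup>2) / K"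
  proof (intro arg_cong2[where f = "(/)"] sum.cong refl)
    fix S
    have lin: "expect (split_law K k) (\<lambda>y. c * y) = 0" "expect (split_law K k) (\<lambda>y. (c * y)\<^sup>2) = c\<^sup>2 * v" for c
      using assms by (simp_all add: expect_split_law Suc power_mult_distrib v_def)
    show "expect (split_law K k) (\<lambda>y. expect (split_law K k) (\<lambda>z.
      (real S / (real K + 1) * y + real (Suc K - S) / (real K + 1) * z + toll K S / (real K + 1))\<^sup>2))
      = (real S / (real K + 1))\<^sup>2 * v + (real (Suc K - S) / (real K + 1))\<^sup>2 * v + (toll K S / (real K + 1))\<^sup>2"
      by (subst expect_indep_square) (simp_all only: fin_split_law[OF assms] lin)
  qed
  also have "\<dots> = ((\<Sum>S=1..K. (real S)\<^sup>2) * v + (\<Sum>S=1..K. (real (Suc K - S))\<^sup>2) * v + (\<Sum>S=1..K. (toll K S)\<^sup>2)) / ((real K + 1)\<^sup>2 * K)"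
    by (simp add: sum.distrib power_divide sum_divide_distrib sum_distrib_right add_divide_distrib)
  also have "(\<Sum>S=1..K. (real (Suc K - S))\<^sup>2) = (\<Sum>S=1..K. (real S)\<^sup>2)"
    by (rule sum_reflect)
  also have "(\<Sum>S=1..K. (real S)\<^sup>2) = real K * (real K + 1) * (2 * real K + 1) / 6"
    by (induction K) (auto simp: power2_eq_square field_simps)
  also have "(\<Sum>S=1..K. (toll K S)\<^sup>2) = v * (real K * (real K + 1) * (real K + 2)) / 3"
    using K by (simp add: v_def split_var_def)
  also have "(real K * (real K + 1) * (2 * real K + 1) / 6 * v + real K * (real K + 1) * (2 * real K + 1) / 6 * v
     + v * (real K * (real K + 1) * (real K + 2)) / 3) / ((real K + 1)\<^sup>2 * K) = v"
  proof -
    have "real K * (real K + 1) * (2 * real K + 1) / 6 * v + real K * (real K + 1) * (2 * real K + 1) / 6 * v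
     + v * (real K * (real K + 1) * (real K + 2)) / 3 = v * ((real K + 1)\<^sup>2 * K)"
      by (simp add: field_simps power2_eq_square)
    moreover have "(real K + 1)\<^sup>2 * K \<noteq> 0" using K by simp
    ultimately show ?thesis by (simp only: nonzero_mult_div_cancel_right not_False_eq_True)
  qed
  finally show ?case unfolding v_def .
qed

text \<open>Some joint law with this cost suffices; optimality plays no part. Finite support lets
  the coupling of one size be assembled from those of smaller sizes as a finite mixture.\<close>

definition coupled :: "nat \<Rightarrow> real pmf \<Rightarrow> real \<Rightarrow> bool" where
  "coupled n q B \<longleftrightarrow> (\<exists>Q. fin_pmf Q \<and> map_pmf fst Q = cost_law n \<and> map_pmf snd Q = q \<and>
     expect Q (\<lambda>p. (fst p - (real n + 1) * snd p)\<^sup>2) \<le> B)"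

lemma coupled_mono: "coupled n q B \<Longrightarrow> B \<le> B' \<Longrightarrow> coupled n q B'"
  unfolding coupled_def by (blast intro: order_trans)

lemma coupled_indep:
  assumes "K \<ge> 1"
  shows "coupled n (split_law K k) (cost_var n + (real n + 1)\<^sup>2 * split_var K)"
proof -
  let ?q = "split_law K k"
  define Q where "Q = bind_pmf (cost_law n) (\<lambda>a. bind_pmf ?q (\<lambda>y. return_pmf (a, y)))"
  have fin: "fin_pmf Q" using fin_cost_law fin_split_law[OF assms] by (auto simp: Q_def)
  have 1: "map_pmf fst Q = cost_law n" "map_pmf snd Q = ?q"
    by (simp_all add: Q_def map_bind_pmf bind_return_pmf')
  note fin_y = fin_split_law[OF assms, of k]
  have m: "(- real n - 1)\<^sup>2 = (real n + 1)\<^sup>2" by (simp add: power2_eq_square algebra_simps)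
  have "expect Q (\<lambda>p. (fst p - (real n + 1) * snd p)\<^sup>2) =
     expect (cost_law n) (\<lambda>a. expect ?q (\<lambda>y. (a + (- (real n + 1)) * y + 0)\<^sup>2))"
    unfolding Q_def by (subst expect_pair) (simp_all add: fin_cost_law fin_y algebra_simps)
  also have "\<dots> = cost_var n + (real n + 1)\<^sup>2 * split_var K"
    by (subst expect_indep_square)
       (simp_all add: fin_cost_law fin_y expect_cost_law expect_split_law[OF assms] cost_var_def
          expect_split_law_square[OF assms] power_mult_distrib m del: mult_minus_left)
  finally show ?thesis using fin 1 unfolding coupled_def by (intro exI[of _ Q]) auto
qed

section \<open>The recursive coupling\<close>

text \<open>With \<open>K = n * R\<close>, reading the coarse split off the fine index
  \<open>S\<close> is the monotone coupling of the uniform laws on \<open>{1..n}\<close> and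
  \<open>{1..K}\<close>: each coarse value owns \<open>R\<close> consecutive fine ones.\<close>

definition block :: "nat \<Rightarrow> nat \<Rightarrow> nat" where
  "block R S = Suc ((S - 1) div R)"

lemma block_eq:
  assumes "i < R"
  shows "block R (Suc (j * R + i)) = Suc j"
  using assms by (simp add: block_def)

lemma block_in: "S \<in> {1..n * R} \<Longrightarrow> block R S \<in> {1..n}"
  by (auto simp: block_def div_less_iff_less_mult Suc_le_eq)
     (metis (no_types, lifting) Suc_le_eq Suc_pred div_less_iff_less_mult less_le_trans lessI mult_is_0 not_gr_zero le_0_eq)

lemma block_decomp:
  assumes "S \<in> {1..n * R}"
  obtains j i where "j < n" "i < R" "S = Suc (j * R + i)"
proof
  have R: "R > 0" using assms by (cases R) auto
  then show "(S - 1) mod R < R" by simp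
  show "(S - 1) div R < n" using block_in[OF assms] by (simp add: block_def Suc_le_eq)
  show "S = Suc ((S - 1) div R * R + (S - 1) mod R)" using assms by simp
qed

lemma sum_blocks:
  "(\<Sum>S=1..n * R. f S) = (\<Sum>s=1..n. \<Sum>i<R. f (Suc ((s - 1) * R + i)))"
  for f :: "nat \<Rightarrow> 'a::comm_monoid_add"
proof -
  have "(\<Sum>S=1..n * R. f S) = (\<Sum>S<n * R. f (Suc S))"
    by (simp add: sum.atLeast1_atMost_eq)
  also have "\<dots> = (\<Sum>j<n. \<Sum>S=j * R..<j * R + R. f (Suc S))"
    by (rule sum.nat_group[symmetric])
  also have "\<dots> = (\<Sum>j<n. \<Sum>i<R. f (Suc (j * R + i)))"
  proof (rule sum.cong[OF refl])
    fix j
    show "(\<Sum>S=j * R..<j * R + R. f (Suc S)) = (\<Sum>i<R. f (Suc (j * R + i)))"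
      using sum.shift_bounds_nat_ivl[of "\<lambda>S. f (Suc S)" 0 "j * R" R]
      by (simp add: atLeast0LessThan add.commute)
  qed
  finally show ?thesis by (simp add: sum.atLeast1_atMost_eq)
qed

text \<open>The grouping commutes with reflection. Hence the second subproblem is matched with the
  reflected fine index, and both subproblems contribute the same sum.\<close>

lemma block_reflect:
  assumes "S \<in> {1..n * R}"
  shows "block R (Suc (n * R) - S) = Suc n - block R S"
proof -
  obtain j i where ji: "j < n" "i < R" "S = Suc (j * R + i)"
    using block_decomp[OF assms] .
  obtain l where l: "n = j + Suc l" using ji by (metis less_iff_Suc_add add_Suc_right)
  have "Suc (n * R) - S = Suc (l * R + (R - 1 - i))"
    using ji by (simp add: l algebra_simps)
  then have "block R (Suc (n * R) - S) = Suc l"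
    using block_eq[of "R - 1 - i" R l] ji by simp
  moreover have "block R S = Suc j" using ji by (simp add: block_eq)
  ultimately show ?thesis using l by simp
qed

lemma map_block_pmf:
  assumes "n \<ge> 1" "R \<ge> 1"
  shows "map_pmf (block R) (pmf_of_set {1..n * R}) = pmf_of_set {1..n}"
proof (rule pmf_eqI)
  fix s
  have nR: "{1..n * R} \<noteq> {}" "{1..n} \<noteq> {}" using assms by auto
  have "{1..n * R} \<inter> block R -` {s} = (if s \<in> {1..n} then (\<lambda>i. Suc ((s - 1) * R + i)) ` {..<R} else {})"
  proof (intro set_eqI iffI)
    fix S assume "S \<in> {1..n * R} \<inter> block R -` {s}"
    then have S: "S \<in> {1..n * R}" "block R S = s" by auto
    obtain j i where ji: "j < n" "i < R" "S = Suc (j * R + i)" using block_decomp[OF S(1)] .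
    then show "S \<in> (if s \<in> {1..n} then (\<lambda>i. Suc ((s - 1) * R + i)) ` {..<R} else {})"
      using S(2) by (auto simp: block_eq)
  next
    fix S assume "S \<in> (if s \<in> {1..n} then (\<lambda>i. Suc ((s - 1) * R + i)) ` {..<R} else {})"
    then obtain i where s: "s \<in> {1..n}" "i < R" "S = Suc ((s - 1) * R + i)" by (auto split: if_splits)
    have "Suc ((s - 1) * R + i) \<le> (s - 1) * R + R" using s by simp
    also have "\<dots> = s * R" using s by (cases s) auto
    also have "\<dots> \<le> n * R" using s by simp
    finally show "S \<in> {1..n * R} \<inter> block R -` {s}" using s by (auto simp: block_eq)
  qed
  then have "card ({1..n * R} \<inter> block R -` {s}) = (if s \<in> {1..n} then R else 0)"
    by (auto simp: card_image inj_on_def)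
  then show "pmf (map_pmf (block R) (pmf_of_set {1..n * R})) s = pmf (pmf_of_set {1..n}) s"
    using nR assms by (simp add: pmf_map measure_pmf_of_set indicator_def)
qed

text \<open>As \<open>S\<close> moves inside a block, the multiplier \<open>P\<close> moves away
  from the weight for which a coupling bound is known. After expanding the squares only the
  covariance is unknown, and it can be eliminated between the two multipliers. Since both variances
  are known, the change of multiplier is an identity and loses nothing.\<close>

lemma expect_scaled_diff_square:
  assumes "fin_pmf Q" "map_pmf fst Q = cost_law n" "map_pmf snd Q = split_law K k" "K \<ge> 1"
  shows "expect Q (\<lambda>p. (fst p - P * snd p)\<^sup>2) =
     P / (real n + 1) * expect Q (\<lambda>p. (fst p - (real n + 1) * snd p)\<^sup>2)
     + (P - (real n + 1)) * (P * split_var K - cost_var n / (real n + 1))"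
    and "expect Q (\<lambda>p. fst p - P * snd p) = 0"
proof -
  have f: "expect Q (\<lambda>p. g (fst p)) = expect (cost_law n) g" for g :: "real \<Rightarrow> real"
    unfolding assms(2)[symmetric] by simp
  have s: "expect Q (\<lambda>p. g (snd p)) = expect (split_law K k) g" for g :: "real \<Rightarrow> real"
    unfolding assms(3)[symmetric] by simp
  define X where "X = expect Q (\<lambda>p. fst p * snd p)"
  have e: "expect Q (\<lambda>p. (fst p - r * snd p)\<^sup>2) = cost_var n - 2 * r * X + r\<^sup>2 * split_var K" for r
  proof -
    have "(\<lambda>p. (fst p - r * snd p)\<^sup>2) = (\<lambda>p. (fst p)\<^sup>2 - (2 * r) * (fst p * snd p) + r\<^sup>2 * (snd p)\<^sup>2)"
      by (auto simp: power2_eq_square algebra_simps)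
    then show ?thesis
      using f[of "\<lambda>x. x\<^sup>2"] s[of "\<lambda>x. x\<^sup>2"] assms(1)
      by (simp add: expect_linear cost_var_def expect_split_law_square[OF assms(4)] X_def)
  qed
  define m where "m = real n + 1"
  have m: "m \<noteq> 0" unfolding m_def by linarith
  show "expect Q (\<lambda>p. (fst p - P * snd p)\<^sup>2) =
     P / (real n + 1) * expect Q (\<lambda>p. (fst p - (real n + 1) * snd p)\<^sup>2)
     + (P - (real n + 1)) * (P * split_var K - cost_var n / (real n + 1))"
    unfolding e m_def[symmetric] using m by (simp add: field_simps power2_eq_square)
  show "expect Q (\<lambda>p. fst p - P * snd p) = 0"
    using f[of "\<lambda>x. x"] s[of "\<lambda>x. x"] assms(1)
    by (simp add: expect_linear expect_cost_law expect_split_law[OF assms(4)])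
qed

text \<open>Given \<open>S\<close>, the two subproblems use independent copies of their
  optimal-to-date couplings. Their errors have mean zero for every multiplier, so cross terms
  vanish; reflecting \<open>S\<close> turns the second error sum into the first, whence the factor
  2. The toll difference is deterministic given \<open>S\<close> and enters as a square.\<close>

lemma coupled_step:
  fixes D :: "nat \<Rightarrow> real"
  assumes n: "n \<ge> 1" and R: "R \<ge> 1" and K: "K = n * R"
    and IH: "\<And>s. s \<in> {1..n} \<Longrightarrow> coupled (s - 1) (split_law K k) (D s)"
  defines "P \<equiv> \<lambda>S. (real n + 1) / (real K + 1) * real S"
  shows "coupled n (split_law K (Suc k))
    ((\<Sum>S=1..K. 2 * (P S / real (block R S) * D (block R S)
          + (P S - real (block R S)) * (P S * split_var K - cost_var (block R S - 1) / real (block R S)))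
        + (toll n (block R S) - (real n + 1) / (real K + 1) * toll K S)\<^sup>2) / real K)"
proof -
  have K1: "K \<ge> 1" using n R K by simp
  have "\<forall>s\<in>{1..n}. \<exists>Q. fin_pmf Q \<and> map_pmf fst Q = cost_law (s - 1) \<and> map_pmf snd Q = split_law K k \<and>
     expect Q (\<lambda>p. (fst p - (real (s - 1) + 1) * snd p)\<^sup>2) \<le> D s"
    using IH unfolding coupled_def by auto
  from bchoice[OF this] obtain Q where Q: "\<And>s. s \<in> {1..n} \<Longrightarrow> fin_pmf (Q s)"
      "\<And>s. s \<in> {1..n} \<Longrightarrow> map_pmf fst (Q s) = cost_law (s - 1)"
      "\<And>s. s \<in> {1..n} \<Longrightarrow> map_pmf snd (Q s) = split_law K k"
      "\<And>s. s \<in> {1..n} \<Longrightarrow> expect (Q s) (\<lambda>p. (fst p - (real (s - 1) + 1) * snd p)\<^sup>2) \<le> D s"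
    by blast
  let ?b = "block R"
  let ?W = "bind_pmf (pmf_of_set {1..K}) (\<lambda>S. bind_pmf (Q (?b S)) (\<lambda>p. bind_pmf (Q (Suc n - ?b S)) (\<lambda>p'.
    return_pmf (fst p + fst p' + toll n (?b S),
       real S / (real K + 1) * snd p + real (Suc K - S) / (real K + 1) * snd p' + toll K S / (real K + 1)))))"
  have set: "set_pmf (pmf_of_set {1..K}) = {1..K}" using K1 by (simp add: set_pmf_of_set)
  have b: "?b S \<in> {1..n}" "Suc n - ?b S \<in> {1..n}" if "S \<in> {1..K}" for S
    using block_in[of S n R] that K by auto
  have fin: "fin_pmf ?W"
    unfolding set_bind_pmf set using Q(1) b by (intro finite_UN_I) auto
  have "map_pmf fst ?W = bind_pmf (pmf_of_set {1..K}) (\<lambda>S. bind_pmf (map_pmf fst (Q (?b S))) (\<lambda>a.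
     bind_pmf (map_pmf fst (Q (Suc n - ?b S))) (\<lambda>b. return_pmf (a + b + toll n (?b S)))))"
    by (simp add: map_bind_pmf bind_map_pmf)
  also have "\<dots> = bind_pmf (pmf_of_set {1..K}) (\<lambda>S. bind_pmf (cost_law (?b S - 1)) (\<lambda>a.
     bind_pmf (cost_law (n - ?b S)) (\<lambda>b. return_pmf (a + b + toll n (?b S)))))"
  proof (rule bind_pmf_cong[OF refl])
    fix S assume "S \<in> set_pmf (pmf_of_set {1..K})"
    then have "S \<in> {1..K}" by (simp only: set)
    from Q(2)[OF b(1)[OF this]] Q(2)[OF b(2)[OF this]]
    show "bind_pmf (map_pmf fst (Q (?b S))) (\<lambda>a. bind_pmf (map_pmf fst (Q (Suc n - ?b S))) (\<lambda>b. return_pmf (a + b + toll n (?b S))))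
      = bind_pmf (cost_law (?b S - 1)) (\<lambda>a. bind_pmf (cost_law (n - ?b S)) (\<lambda>b. return_pmf (a + b + toll n (?b S))))"
      by simp
  qed
  also have "\<dots> = bind_pmf (map_pmf ?b (pmf_of_set {1..K})) (\<lambda>s. bind_pmf (cost_law (s - 1)) (\<lambda>a.
     bind_pmf (cost_law (n - s)) (\<lambda>b. return_pmf (a + b + toll n s))))"
    by (simp only: bind_map_pmf)
  also have "\<dots> = cost_law n"
    unfolding K map_block_pmf[OF n R] cost_law_rec[OF n, symmetric] ..
  finally have fst: "map_pmf fst ?W = cost_law n" .
  have "map_pmf snd ?W = bind_pmf (pmf_of_set {1..K}) (\<lambda>S. bind_pmf (map_pmf snd (Q (?b S))) (\<lambda>y.
     bind_pmf (map_pmf snd (Q (Suc n - ?b S))) (\<lambda>z. return_pmf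
       (real S / (real K + 1) * y + real (Suc K - S) / (real K + 1) * z + toll K S / (real K + 1)))))"
    by (simp add: map_bind_pmf bind_map_pmf)
  also have "\<dots> = split_law K (Suc k)"
    unfolding split_law.simps
  proof (rule bind_pmf_cong[OF refl])
    fix S assume "S \<in> set_pmf (pmf_of_set {1..K})"
    then have "S \<in> {1..K}" by (simp only: set)
    from Q(3)[OF b(1)[OF this]] Q(3)[OF b(2)[OF this]]
    show "bind_pmf (map_pmf snd (Q (?b S))) (\<lambda>y. bind_pmf (map_pmf snd (Q (Suc n - ?b S))) (\<lambda>z. return_pmf
       (real S / (real K + 1) * y + real (Suc K - S) / (real K + 1) * z + toll K S / (real K + 1))))
      = bind_pmf (split_law K k) (\<lambda>y. bind_pmf (split_law K k) (\<lambda>z. return_pmf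
       (real S / (real K + 1) * y + real (Suc K - S) / (real K + 1) * z + toll K S / (real K + 1))))"
      by simp
  qed
  finally have snd: "map_pmf snd ?W = split_law K (Suc k)" .
  define T where "T S = expect (Q (?b S)) (\<lambda>p. (fst p - P S * snd p)\<^sup>2)" for S
  define e where "e S = toll n (?b S) - (real n + 1) / (real K + 1) * toll K S" for S
  have sq: "expect (Q (?b S)) (\<lambda>p. expect (Q (Suc n - ?b S)) (\<lambda>p'.
      ((fst p - P S * snd p) + (fst p' - P (Suc K - S) * snd p') + e S)\<^sup>2)) = T S + T (Suc K - S) + (e S)\<^sup>2"
    if S: "S \<in> {1..K}" for S
  proof -
    have r: "?b (Suc K - S) = Suc n - ?b S" using block_reflect[of S n R] S K by simp
    show ?thesis unfolding T_def r
      by (rule expect_indep_square)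
         (use Q b[OF S] K1 in \<open>auto intro!: expect_scaled_diff_square(2)\<close>)
  qed
  have Tle: "T S \<le> P S / real (?b S) * D (?b S)
          + (P S - real (?b S)) * (P S * split_var K - cost_var (?b S - 1) / real (?b S))"
    if S: "S \<in> {1..K}" for S
  proof -
    have s: "real (?b S - 1) + 1 = real (?b S)" using b[OF S] by auto
    have "P S / real (?b S) * expect (Q (?b S)) (\<lambda>p. (fst p - real (?b S) * snd p)\<^sup>2) \<le> P S / real (?b S) * D (?b S)"
      using Q(4)[OF b(1)[OF S]] unfolding s by (intro mult_left_mono) (auto simp: P_def)
    then show ?thesis unfolding T_def
      using expect_scaled_diff_square(1)[of "Q (?b S)" "?b S - 1" K k "P S"] Q b[OF S] K1 unfolding s by simp
  qed
  have "expect ?W (\<lambda>p. (fst p - (real n + 1) * snd p)\<^sup>2) =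
     (\<Sum>S=1..K. expect (Q (?b S)) (\<lambda>p. expect (Q (Suc n - ?b S)) (\<lambda>p'.
      ((fst p + fst p' + toll n (?b S)) - (real n + 1) * (real S / (real K + 1) * snd p + real (Suc K - S) / (real K + 1) * snd p' + toll K S / (real K + 1)))\<^sup>2))) / K"
    using Q(1) b by (subst expect_bind)
      (simp_all add: expect_bind expect_pmf_of_set_1[OF K1, simplified] set[simplified])
  also have "\<dots> = (\<Sum>S=1..K. T S + T (Suc K - S) + (e S)\<^sup>2) / K"
  proof (intro arg_cong2[where f = "(/)"] sum.cong refl)
    fix S assume S: "S \<in> {1..K}"
    have "fst p + fst p' + toll n (?b S) - (real n + 1) * (real S / (real K + 1) * snd p + real (Suc K - S) / (real K + 1) * snd p' + toll K S / (real K + 1))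
      = (fst p - P S * snd p) + (fst p' - P (Suc K - S) * snd p') + e S" for p p' :: "real \<times> real"
      by (simp add: P_def e_def algebra_simps)
    then show "expect (Q (?b S)) (\<lambda>p. expect (Q (Suc n - ?b S)) (\<lambda>p'.
      (fst p + fst p' + toll n (?b S) - (real n + 1) * (real S / (real K + 1) * snd p + real (Suc K - S) / (real K + 1) * snd p' + toll K S / (real K + 1)))\<^sup>2))
      = T S + T (Suc K - S) + (e S)\<^sup>2" using sq[OF S] by (simp only:)
  qed
  also have "\<dots> = (\<Sum>S=1..K. 2 * T S + (e S)\<^sup>2) / K"
    using sum_reflect[of T K] by (simp add: sum.distrib sum_distrib_left[symmetric])
  also have "\<dots> \<le> (\<Sum>S=1..K. 2 * (P S / real (?b S) * D (?b S)
          + (P S - real (?b S)) * (P S * split_var K - cost_var (?b S - 1) / real (?b S))) + (e S)\<^sup>2) / K"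
    using Tle by (intro divide_right_mono sum_mono add_right_mono mult_left_mono) auto
  finally show ?thesis using fin fst snd unfolding coupled_def e_def by (intro exI[of _ ?W]) auto
qed

section \<open>Comparison of tolls\<close>

text \<open>By convexity \<open>1 / (b + 1)\<close> is at most the integral of the reciprocal over
  the unit interval centred at \<open>b + 1\<close>. The companion lower bound uses the trapezoidal
  rule on \<open>[b, b + 1]\<close>; both are exact to the order of the half-reciprocals.\<close>

lemma harm_diff_le:
  assumes "a \<le> b"
  shows "harm b - harm a \<le> ln (real b + 1/2) - ln (real a + 1/2)"
  using assms
proof (induction b rule: dec_induct)
  case (step b)
  have "ln (real b + 1/2 + 1) - ln (real b + 1/2) \<ge> 2 * (real b + 1/2 + 1 - (real b + 1/2)) / (real b + 1/2 + (real b + 1/2 + 1))"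
    using ln_inverse_approx_ge[of "real b + 1/2" "real b + 1/2 + 1"] by simp
  moreover have "2 * (real b + 1/2 + 1 - (real b + 1/2)) / (real b + 1/2 + (real b + 1/2 + 1)) = 1 / (real b + 1)"
    by (simp add: divide_simps)
  moreover have "real (Suc b) + 1/2 = real b + 1/2 + 1" by simp
  ultimately show ?case using step.IH unfolding harm_Suc_real by simp
qed simp

lemma harm_diff_ge:
  assumes "1 \<le> a" "a \<le> b"
  shows "harm b - harm a \<ge> ln (real b) - ln (real a) - (1 / real a - 1 / real b) / 2"
  using assms(2)
proof (induction b rule: dec_induct)
  case (step b)
  then have b: "real b > 0" using assms by simp
  have "ln (real b + 1) - ln (real b) \<le> (inverse (real b) + inverse (real b + 1)) / 2"
    using ln_inverse_approx_le[of "real b" 1] b by simp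
  moreover define u v w where "u = 1 / real b" "v = 1 / (real b + 1)" "w = 1 / real a"
  ultimately show ?case using step.IH
    unfolding harm_Suc_real of_nat_Suc add.commute[of 1 "real b"] inverse_eq_divide u_v_w_def[symmetric] by argo
qed simp

lemma ln_one_plus_ge:
  fixes x :: real
  assumes "x \<ge> 0"
  shows "ln (1 + x) \<ge> x - x\<^sup>2 / 2"
proof (cases "x = 0")
  case False
  then have "ln (1 + x) - ln 1 \<ge> 2 * (1 + x - 1) / (1 + (1 + x))"
    using assms ln_inverse_approx_ge[of 1 "1 + x"] by simp
  moreover have "2 * x / (2 + x) \<ge> x - x\<^sup>2 / 2"
  proof -
    have "(x - x\<^sup>2 / 2) * (2 + x) \<le> 2 * x"
      using assms by (simp add: algebra_simps power2_eq_square)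
    then show ?thesis using assms by (simp add: pos_le_divide_eq)
  qed
  ultimately show ?thesis by simp
qed simp

text \<open>Moves the half-integer arguments of \<open>harm_diff_le\<close> to integers, where upper
  and lower bounds share the form \<open>ln x + 1 / (2 x)\<close> and differ by at most
  \<open>1 / (8 x^2)\<close>.\<close>

lemma ln_half_shift:
  fixes x :: real
  assumes "x > 0"
  shows "ln (x + 1/2) - ln x \<le> 1 / (2 * x)" "ln (x + 1/2) - ln x \<ge> 1 / (2 * x) - 1 / (8 * x\<^sup>2)"
proof -
  have "ln (x + 1/2) = ln (x * (1 + 1 / (2 * x)))"
    using assms by (simp add: distrib_left)
  also have "\<dots> = ln x + ln (1 + 1 / (2 * x))"
    using assms by (intro ln_mult_pos) (auto intro: add_pos_pos)
  finally have e: "ln (x + 1/2) - ln x = ln (1 + 1 / (2 * x))" by simp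
  show "ln (x + 1/2) - ln x \<le> 1 / (2 * x)"
    unfolding e using assms by (intro ln_add_one_self_le_self) simp
  show "ln (x + 1/2) - ln x \<ge> 1 / (2 * x) - 1 / (8 * x\<^sup>2)"
    unfolding e using ln_one_plus_ge[of "1 / (2 * x)"] assms by (simp add: power_divide power_mult_distrib)
qed

text \<open>Gibbs' inequality, and the bound of relative entropy by the chi-square divergence. Both
  follow from \<open>ln z \<le> z - 1\<close>, applied to the ratios in one order and in the
  other.\<close>

lemma relative_entropy_bounds:
  fixes p q s t :: real
  assumes "p > 0" "q > 0" "s > 0" "t > 0" "p + q = s + t"
  shows "p * (ln p - ln s) + q * (ln q - ln t) \<ge> 0"
    and "p * (ln p - ln s) + q * (ln q - ln t) \<le> (p - s)\<^sup>2 * (1 / s + 1 / t)"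
proof -
  have l: "x * (ln x - ln y) \<ge> x - y" "x * (ln x - ln y) \<le> x * (x - y) / y" if "x > 0" "y > 0" for x y :: real
  proof -
    have "ln (y / x) \<le> y / x - 1" using that by (intro ln_le_minus_one) simp
    then have "ln y - ln x \<le> y / x - 1" using that by (simp add: ln_div)
    then have "x * (ln y - ln x) \<le> x * (y / x - 1)" using that by (intro mult_left_mono) auto
    then show "x * (ln x - ln y) \<ge> x - y" using that by (simp add: algebra_simps)
    have "ln (x / y) \<le> x / y - 1" using that by (intro ln_le_minus_one) simp
    then have "ln x - ln y \<le> x / y - 1" using that by (simp add: ln_div)
    then have "x * (ln x - ln y) \<le> x * (x / y - 1)" using that by (intro mult_left_mono) auto
    then show "x * (ln x - ln y) \<le> x * (x - y) / y" using that by (simp add: field_simps)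
  qed
  show "p * (ln p - ln s) + q * (ln q - ln t) \<ge> 0"
    using l(1)[of p s] l(1)[of q t] assms by linarith
  have q: "q = s + t - p" using assms by simp
  have "p * (p - s) / s + q * (q - t) / t = (p - s)\<^sup>2 * (1 / s + 1 / t)"
    unfolding q using assms(3,4) by (simp add: field_simps power2_eq_square)
  then show "p * (ln p - ln s) + q * (ln q - ln t) \<le> (p - s)\<^sup>2 * (1 / s + 1 / t)"
    using l(2)[of p s] l(2)[of q t] assms by linarith
qed

text \<open>First-order comparison of the tolls of two splits with almost the same proportions. The
  relative entropy of the two splits is the second-order remainder.\<close>

lemma toll_difference:
  fixes s t S T :: nat and c :: real
  defines "m \<equiv> real s + real t" and "M \<equiv> real S + real T"
  defines "p \<equiv> m / M * real S" and "q \<equiv> m / M * real T"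
  defines "x \<equiv> p - real s"
  assumes pos: "1 \<le> s" "1 \<le> t" and le: "s \<le> S" "t \<le> T"
    and c: "1 \<le> c" "p \<le> c * real s" "q \<le> c * real t"
  defines "e \<equiv> 2 * (real s * harm s + real t * harm t - m * harm (s + t))
      - 2 * (p * harm S + q * harm T - m * harm (S + T))"
  defines "L \<equiv> (harm s - 1 / (2 * real s)) - (harm t - 1 / (2 * real t))"
  shows "\<bar>(1 - m / M - e) - 2 * x * L\<bar> \<le> (1 / real s + 1 / real t) * (2 * x\<^sup>2 + c / 4)"
proof -
  define a a' b where "a = (harm S - harm s :: real)" "a' = (harm T - harm t :: real)"
    "b = (harm (S + T) - harm (s + t) :: real)"
  have r: "real s > 0" "real t > 0" "real S > 0" "real T > 0" "m > 0" "M > 0"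
    using pos le by (auto simp: m_def M_def)
  have pq: "p + q = m" "q - real t = - x" "p > 0" "q > 0"
  proof -
    have "p + q = m / M * M" unfolding p_def q_def M_def by (simp only: distrib_left)
    then show 1: "p + q = m" using r by simp
    show "q - real t = - x" using 1 by (simp add: x_def m_def)
    show "p > 0" "q > 0" using r by (simp_all add: p_def q_def)
  qed
  have lnS: "ln (real S) - ln (real s) = (ln p - ln (real s)) + (ln M - ln m)"
    using r by (simp add: p_def ln_mult ln_div)
  have lnT: "ln (real T) - ln (real t) = (ln q - ln (real t)) + (ln M - ln m)"
    using r by (simp add: q_def ln_mult ln_div)
  \<comment> \<open>Because \<open>p\<close> and \<open>q\<close> are proportional to
    \<open>S\<close> and \<open>T\<close>, the common factor \<open>ln M - ln m\<close> cancels in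
    \<open>d\<close>, and the logarithms leave exactly this relative entropy of
    \<open>(p, q)\<close> against \<open>(s, t)\<close>.\<close>
  define E where "E = p * (ln p - ln (real s)) + q * (ln q - ln (real t))"
  have E: "0 \<le> E" "E \<le> x\<^sup>2 * (1 / real s + 1 / real t)"
    using relative_entropy_bounds[of p q "real s" "real t"] pq r by (auto simp: E_def x_def m_def)
  define d where "d = m * b - p * a - q * a'"
  have e: "e = 2 * d - 2 * x * (harm s - harm t)"
  proof -
    have "real s = p - x" "real t = q + x" using pq by (auto simp: x_def)
    then show ?thesis unfolding e_def d_def a_a'_b_def by (simp only:) (simp add: algebra_simps)
  qed
  have pS: "p * (1 / real S) = m / M" "q * (1 / real T) = m / M" using r by (simp_all add: p_def q_def)
  have ps: "p * (1 / real s) = 1 + x / real s" "q * (1 / real t) = 1 - x / real t"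
    using r pq by (simp_all add: x_def field_simps)
  have mM: "m * (1 / M) = m / M" by simp
  \<comment> \<open>The half-reciprocals left over after the logarithms have formed
    \<open>-E\<close>. Twice \<open>B\<close> accounts for \<open>1 - m / M\<close> and for the
    corrections \<open>1 / (2 s)\<close>, \<open>1 / (2 t)\<close> in \<open>L\<close>; hence the
    shift by \<open>1 - m / M\<close> in the claim.\<close>
  define B where "B = 1/2 + x * (1 / real s - 1 / real t) / 2 - m / M / 2"
  have upper: "d \<le> - E + B + 1 / (8 * m)"
  proof -
    have "b \<le> ln (M + 1/2) - ln (m + 1/2)"
      using harm_diff_le[of "s + t" "S + T"] le by (simp add: a_a'_b_def m_def M_def)
    also have "\<dots> \<le> (ln M - ln m) + 1 / (2 * M) - (1 / (2 * m) - 1 / (8 * m\<^sup>2))"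
      using ln_half_shift(1)[of M] ln_half_shift(2)[of m] r by linarith
    finally have "m * b \<le> m * ((ln M - ln m) + 1 / (2 * M) - (1 / (2 * m) - 1 / (8 * m\<^sup>2)))"
      using r by (intro mult_left_mono) auto
    also have "\<dots> = m * (ln M - ln m) + m / M / 2 - (1/2 - 1 / (8 * m))"
      using r by (simp add: field_simps power2_eq_square)
    finally have 1: "m * b \<le> m * (ln M - ln m) + m / M / 2 - (1/2 - 1 / (8 * m))" .
    have "p * a \<ge> p * (ln (real S) - ln (real s) - (1 / real s - 1 / real S) / 2)"
      using harm_diff_ge[of s S] pos le pq by (intro mult_left_mono) (auto simp: a_a'_b_def)
    then have 2: "p * a \<ge> p * (ln p - ln (real s)) + p * (ln M - ln m) - (p * (1 / real s) - p * (1 / real S)) / 2"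
      unfolding lnS by (simp add: algebra_simps)
    have "q * a' \<ge> q * (ln (real T) - ln (real t) - (1 / real t - 1 / real T) / 2)"
      using harm_diff_ge[of t T] pos le pq by (intro mult_left_mono) (auto simp: a_a'_b_def)
    then have 3: "q * a' \<ge> q * (ln q - ln (real t)) + q * (ln M - ln m) - (q * (1 / real t) - q * (1 / real T)) / 2"
      unfolding lnT by (simp add: algebra_simps)
    have 4: "p * (ln M - ln m) + q * (ln M - ln m) = m * (ln M - ln m)"
      unfolding pq(1)[symmetric] by (simp add: algebra_simps)
    have 5: "x * (1 / real s - 1 / real t) = x / real s - x / real t" by (simp add: algebra_simps)
    define u v w z where "u = m / M" "v = 1 / (8 * m)" "w = x / real s" "z = x / real t"
    show ?thesis using 1 2[unfolded ps pS] 3[unfolded ps pS] 4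
      unfolding d_def E_def B_def 5 u_v_w_z_def[symmetric] by argo
  qed
  have lower: "d \<ge> - E + B - (p / (real s)\<^sup>2 + q / (real t)\<^sup>2) / 8"
  proof -
    have "b \<ge> ln M - ln m - (1 / m - 1 / M) / 2"
      using harm_diff_ge[of "s + t" "S + T"] le pos by (simp add: a_a'_b_def m_def M_def)
    then have "m * b \<ge> m * (ln M - ln m - (1 / m - 1 / M) / 2)"
      using r by (intro mult_left_mono) auto
    also have "m * (ln M - ln m - (1 / m - 1 / M) / 2) = m * (ln M - ln m) - 1/2 + m / M / 2"
      using r by (simp add: field_simps)
    finally have 1: "m * b \<ge> m * (ln M - ln m) - 1/2 + m / M / 2" .
    have "a \<le> (ln (real S) - ln (real s)) + 1 / real S / 2 - (1 / real s / 2 - 1 / (real s)\<^sup>2 / 8)"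
      using harm_diff_le[of s S] le ln_half_shift(1)[of "real S"] ln_half_shift(2)[of "real s"] r
      by (simp add: a_a'_b_def)
    then have "p * a \<le> p * ((ln (real S) - ln (real s)) + 1 / real S / 2 - (1 / real s / 2 - 1 / (real s)\<^sup>2 / 8))"
      using pq by (intro mult_left_mono) auto
    then have 2: "p * a \<le> p * (ln p - ln (real s)) + p * (ln M - ln m) + p * (1 / real S) / 2 - (p * (1 / real s) / 2 - p / (real s)\<^sup>2 / 8)"
      unfolding lnS by (simp add: algebra_simps)
    have "a' \<le> (ln (real T) - ln (real t)) + 1 / real T / 2 - (1 / real t / 2 - 1 / (real t)\<^sup>2 / 8)"
      using harm_diff_le[of t T] le ln_half_shift(1)[of "real T"] ln_half_shift(2)[of "real t"] r
      by (simp add: a_a'_b_def)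
    then have "q * a' \<le> q * ((ln (real T) - ln (real t)) + 1 / real T / 2 - (1 / real t / 2 - 1 / (real t)\<^sup>2 / 8))"
      using pq by (intro mult_left_mono) auto
    then have 3: "q * a' \<le> q * (ln q - ln (real t)) + q * (ln M - ln m) + q * (1 / real T) / 2 - (q * (1 / real t) / 2 - q / (real t)\<^sup>2 / 8)"
      unfolding lnT by (simp add: algebra_simps)
    have 4: "p * (ln M - ln m) + q * (ln M - ln m) = m * (ln M - ln m)"
      unfolding pq(1)[symmetric] by (simp add: algebra_simps)
    have 5: "x * (1 / real s - 1 / real t) = x / real s - x / real t" by (simp add: algebra_simps)
    define u w z where "u = m / M" "w = x / real s" "z = x / real t"
    define v v' where "v = p / (real s)\<^sup>2" "v' = q / (real t)\<^sup>2"
    show ?thesis using 1 2[unfolded ps pS] 3[unfolded ps pS] 4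
      unfolding d_def E_def B_def 5 u_w_z_def[symmetric] v_v'_def[symmetric] by argo
  qed
  have main: "(1 - m / M - e) - 2 * x * L = 2 * (B - d)"
  proof -
    define u v where "u = 1 / real s" "v = 1 / real t"
    have "1 / (2 * real s) = u / 2" "1 / (2 * real t) = v / 2" by (simp_all add: u_v_def)
    then show ?thesis
      unfolding e B_def L_def u_v_def[symmetric] by (simp only:) (simp add: field_simps)
  qed
  have "p / (real s)\<^sup>2 \<le> c * (1 / real s)" "q / (real t)\<^sup>2 \<le> c * (1 / real t)"
    using c r by (simp_all add: power2_eq_square field_simps)
  then have h1: "(p / (real s)\<^sup>2 + q / (real t)\<^sup>2) / 4 \<le> (1 / real s + 1 / real t) * (c / 4)"
    by (simp add: algebra_simps)
  have "1 / m \<le> 1 / real s" using r by (simp add: m_def field_simps)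
  also have "\<dots> \<le> 1 / real s * c" using c r by (simp add: divide_right_mono)
  also have "\<dots> \<le> (1 / real s + 1 / real t) * c" using c r by (intro mult_right_mono) auto
  finally have h2: "1 / (4 * m) \<le> (1 / real s + 1 / real t) * (c / 4)" by simp
  have h3: "2 * (B - d) \<le> 2 * E + (p / (real s)\<^sup>2 + q / (real t)\<^sup>2) / 4" using lower by argo
  have h4: "2 * (B - d) \<ge> - (1 / (4 * m))"
  proof -
    define v where "v = 1 / (8 * m)"
    have "1 / (4 * m) = 2 * v" by (simp add: v_def)
    then show ?thesis using upper[folded v_def] E(1) by argo
  qed
  have h5: "(1 / real s + 1 / real t) * (2 * x\<^sup>2 + c / 4)
     = 2 * (x\<^sup>2 * (1 / real s + 1 / real t)) + (1 / real s + 1 / real t) * (c / 4)"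
    by (simp add: algebra_simps)
  have h6: "x\<^sup>2 * (1 / real s + 1 / real t) \<ge> 0" using r by simp
  show ?thesis unfolding main h5 using h1 h2 h3 h4 h6 E(2) by argo
qed

text \<open>\<open>x i\<close> is the excess of the fine weight over the label of its block. Its
  block mean is proportional to \<open>2 s - (n + 1)\<close>, hence antisymmetric under reflection.
  The 1/3 is the mean square of a uniform variable on the unit interval measured from an endpoint,
  the situation of the outermost blocks for large \<open>n\<close>.\<close>

lemma sum_block_offsets:
  fixes n R s :: nat
  assumes R: "R \<ge> 1" and s: "1 \<le> s" "s \<le> n"
  defines "x \<equiv> \<lambda>i. (real n + 1) / (real (n * R) + 1) * real (Suc ((s - 1) * R + i)) - real s"
  shows "(\<Sum>i<R. x i) = real R * ((real R - 1) / (2 * (real (n * R) + 1)) * (2 * real s - (real n + 1)))"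
    and "(\<Sum>i<R. (x i)\<^sup>2) \<le> real R / 3"
proof -
  define M where "M = real n * real R + 1"
  define t where "t = real n + 1 - real s"
  have M: "M > 0" by (simp add: M_def add_nonneg_pos)
  have x: "x i = ((real n + 1) * real i - t * (real R - 1)) / M" for i
  proof -
    have "real (Suc ((s - 1) * R + i)) = (real s - 1) * real R + real i + 1" using s by (simp add: of_nat_diff)
    then have "x i = ((real n + 1) * ((real s - 1) * real R + real i + 1) - real s * M) / M"
      using M unfolding x_def by (simp add: M_def[symmetric] diff_divide_distrib)
    also have "(real n + 1) * ((real s - 1) * real R + real i + 1) - real s * M = (real n + 1) * real i - t * (real R - 1)"
      by (simp add: M_def t_def algebra_simps)
    finally show ?thesis .
  qed
  have s1: "(\<Sum>i<R. real i) = real R * (real R - 1) / 2"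
    by (induction R) (auto simp: field_simps)
  have s2: "(\<Sum>i<R. (real i)\<^sup>2) = real R * (real R - 1) * (2 * real R - 1) / 6"
    by (induction R) (auto simp: field_simps power2_eq_square)
  have "(\<Sum>i<R. x i) = ((real n + 1) * (\<Sum>i<R. real i) - real R * (t * (real R - 1))) / M"
    unfolding x by (simp add: sum_divide_distrib[symmetric] sum_subtractf sum_distrib_left)
  also have "\<dots> = real R * ((real R - 1) / (2 * M) * (2 * real s - (real n + 1)))"
    unfolding s1 t_def using M by (simp add: field_simps)
  finally show "(\<Sum>i<R. x i) = real R * ((real R - 1) / (2 * (real (n * R) + 1)) * (2 * real s - (real n + 1)))"
    by (simp add: M_def)
  have "(\<Sum>i<R. (x i)\<^sup>2) = (\<Sum>i<R. (real n + 1)\<^sup>2 * (real i)\<^sup>2 - 2 * (real n + 1) * t * (real R - 1) * real i + (t * (real R - 1))\<^sup>2) / M\<^sup>2"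
    unfolding x power_divide sum_divide_distrib[symmetric]
    by (intro arg_cong2[where f="(/)"] sum.cong) (auto simp: power2_eq_square algebra_simps)
  also have "\<dots> = ((real n + 1)\<^sup>2 * (\<Sum>i<R. (real i)\<^sup>2) - 2 * (real n + 1) * t * (real R - 1) * (\<Sum>i<R. real i) + real R * (t * (real R - 1))\<^sup>2) / M\<^sup>2"
    by (simp add: sum.distrib sum_subtractf sum_distrib_left)
  also have "\<dots> = real R * ((real R - 1) * ((real n + 1)\<^sup>2 * (2 * real R - 1) / 6 - real s * t * (real R - 1))) / M\<^sup>2"
  proof -
    have "(real n + 1)\<^sup>2 * (real R * (real R - 1) * (2 * real R - 1) / 6) - 2 * (real n + 1) * t * (real R - 1) * (real R * (real R - 1) / 2)
        + real R * (t * (real R - 1))\<^sup>2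
      = real R * ((real R - 1) * ((real n + 1)\<^sup>2 * (2 * real R - 1) / 6 - real s * t * (real R - 1)))"
      by (simp add: t_def power2_eq_square field_simps)
    then show ?thesis unfolding s1 s2 by (simp only:)
  qed
  also have "\<dots> \<le> real R * (M\<^sup>2 / 3) / M\<^sup>2"
  proof (intro divide_right_mono mult_left_mono)
    have st: "real s * t \<ge> real n"
    proof -
      have "(real s - 1) * (real n - real s) \<ge> 0" using s by simp
      then show ?thesis by (simp add: t_def algebra_simps)
    qed
    have "real s * t * (real R - 1) \<ge> real n * (real R - 1)"
      using st R by (intro mult_right_mono) auto
    then have "(real R - 1) * ((real n + 1)\<^sup>2 * (2 * real R - 1) / 6 - real s * t * (real R - 1))
       \<le> (real R - 1) * ((real n + 1)\<^sup>2 * (2 * real R - 1) / 6 - real n * (real R - 1))"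
      using R by (intro mult_left_mono) auto
    also have "\<dots> \<le> M\<^sup>2 / 3"
    proof -
      \<comment> \<open>Shifted to nonnegative variables, the difference of the two sides is a
        polynomial with nonnegative coefficients.\<close>
      define k r where "k = real n - 1" "r = real R - 1"
      have kr: "k \<ge> 0" "r \<ge> 0" "real n = k + 1" "real R = r + 1" using s R by (auto simp: k_r_def)
      have "M\<^sup>2 / 3 - (real R - 1) * ((real n + 1)\<^sup>2 * (2 * real R - 1) / 6 - real n * (real R - 1))
        = (k * k * (3 * r + 2) / 2 + k * (r * r + 4 * r + 4) + 2 * r + 4) / 3"
        unfolding M_def kr by (simp add: field_simps power2_eq_square)
      also have "\<dots> \<ge> 0" using kr by (intro divide_nonneg_nonneg add_nonneg_nonneg mult_nonneg_nonneg) auto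
      finally show ?thesis by simp
    qed
    finally show "(real R - 1) * ((real n + 1)\<^sup>2 * (2 * real R - 1) / 6 - real s * t * (real R - 1)) \<le> M\<^sup>2 / 3" .
  qed auto
  also have "\<dots> = real R / 3" using M by simp
  finally show "(\<Sum>i<R. (x i)\<^sup>2) \<le> real R / 3" .
qed

text \<open>The factor \<open>L\<close> of \<open>toll_difference\<close>. As
  \<open>harm s - 1 / (2 * s)\<close> is \<open>ln s\<close> plus Euler's constant up to order
  \<open>1 / s^2\<close>, this is a discrete \<open>ln (s / (n + 1 - s))\<close>, half the
  derivative of the toll in \<open>s\<close>.\<close>

definition split_lin :: "nat \<Rightarrow> nat \<Rightarrow> real" where
  "split_lin n s = (harm s - 1 / (2 * real s)) - (harm (Suc n - s) - 1 / (2 * real (Suc n - s)))"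

definition split_inv :: "nat \<Rightarrow> nat \<Rightarrow> real" where
  "split_inv n s = 1 / real s + 1 / real (Suc n - s)"

lemma weighted_square_add_le:
  fixes u v a :: real
  assumes "a > 0"
  shows "(u + v)\<^sup>2 \<le> (1 + a) * u\<^sup>2 + (1 + 1 / a) * v\<^sup>2"
proof -
  have "(1 + a) * u\<^sup>2 + (1 + 1 / a) * v\<^sup>2 - (u + v)\<^sup>2 = (a * u - v)\<^sup>2 / a"
    using assms by (simp add: field_simps power2_eq_square)
  also have "\<dots> \<ge> 0" using assms by simp
  finally show ?thesis by simp
qed

text \<open>The linear term and the remainder of \<open>toll_difference\<close> are squared
  separately with a free weight \<open>a\<close>, to be chosen per \<open>n\<close>. Only
  \<open>x\<^sup>2\<close> may remain on the right, since second moments are what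
  \<open>sum_block_offsets\<close> controls.\<close>

lemma toll_error_square:
  fixes n R s i :: nat and a :: real
  assumes n: "n \<ge> 1" and s: "s \<in> {1..n}" and i: "i < R" and a: "a > 0"
  defines "K \<equiv> n * R" and "S \<equiv> Suc ((s - 1) * R + i)"
  defines "l \<equiv> (real n + 1) / (real K + 1)" and "c \<equiv> (real n + 1) / real n"
  defines "x \<equiv> l * real S - real s"
  shows "(1 - l - (toll n s - l * toll K S))\<^sup>2 \<le>
    (1 + a) * (4 * x\<^sup>2 * (split_lin n s)\<^sup>2) + (1 + 1 / a) * ((split_inv n s)\<^sup>2 * ((4 + c) * x\<^sup>2 + c\<^sup>2 / 16))"
proof -
  define t where "t = Suc n - s"
  define T where "T = Suc K - S"
  have R: "R \<ge> 1" using i by simp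
  have st: "1 \<le> s" "1 \<le> t" "s + t = Suc n" using s by (auto simp: t_def)
  have SsR: "S \<le> s * R"
  proof -
    have "S \<le> (s - 1) * R + R" using i by (simp add: S_def)
    also have "\<dots> = s * R" using s by (cases s) auto
    finally show ?thesis .
  qed
  have sS: "s \<le> S"
  proof -
    have "s - 1 \<le> (s - 1) * R" using R by (cases R) auto
    then show ?thesis unfolding S_def by linarith
  qed
  have SK: "S \<le> K" using SsR s unfolding K_def by (meson atLeastAtMost_iff le_trans mult_le_mono1)
  have ST: "S + T = Suc K" using SK by (simp add: T_def)
  have Keq: "K = (s - 1) * R + t * R"
    using s by (simp add: K_def t_def distrib_right[symmetric])
  then have TtR: "T \<le> t * R" by (simp add: T_def S_def)
  have tT: "t \<le> T"
  proof -
    obtain r where r: "R = Suc r" using R by (cases R) auto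
    have "T = t * R - i" using Keq by (simp add: T_def S_def)
    moreover have "t * r \<ge> r" "i \<le> r" using st i r by auto
    moreover have "t * R = t + t * r" using r by simp
    ultimately show ?thesis by linarith
  qed
  have m: "real s + real t = real n + 1" using st(3) by linarith
  have M: "real S + real T = real K + 1" using ST by linarith
  have l0: "l > 0" by (simp add: l_def)
  have lR: "l * (u * R) \<le> c * u" if "u \<ge> 0" for u :: real
  proof -
    have "l * real R \<le> c"
    proof -
      have "l * real R = (real n + 1) * (real R / (real n * real R + 1))" by (simp add: l_def K_def)
      also have "\<dots> \<le> (real n + 1) * (1 / real n)"
      proof (intro mult_left_mono)
        have "real n * real R + 1 > 0" by (intro add_nonneg_pos) auto
        then show "real R / (real n * real R + 1) \<le> 1 / real n"
          using n by (simp add: divide_simps)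
      qed simp
      finally show ?thesis by (simp add: c_def)
    qed
    then have "l * real R * u \<le> c * u" using that by (rule mult_right_mono)
    then show ?thesis by (simp add: mult_ac)
  qed
  have pS: "l * real S \<le> c * real s"
  proof -
    have "real S \<le> real s * R" using SsR by (metis of_nat_le_iff of_nat_mult)
    then have "l * real S \<le> l * (real s * R)" using l0 by simp
    also have "\<dots> \<le> c * real s" by (rule lR) simp
    finally show ?thesis .
  qed
  have qT: "l * real T \<le> c * real t"
  proof -
    have "real T \<le> real t * R" using TtR by (metis of_nat_le_iff of_nat_mult)
    then have "l * real T \<le> l * (real t * R)" using l0 by simp
    also have "\<dots> \<le> c * real t" by (rule lR) simp
    finally show ?thesis .
  qed
  have c1: "1 \<le> c" using n by (simp add: c_def)
  define y where "y = 1 - l - (toll n s - l * toll K S) - 2 * x * split_lin n s"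
  have y: "\<bar>y\<bar> \<le> split_inv n s * (2 * x\<^sup>2 + c / 4)"
  proof -
    have "toll n s - l * toll K S = 2 * (real s * harm s + real t * harm t - (real s + real t) * harm (s + t))
      - 2 * (l * real S * harm S + l * real T * harm T - (real s + real t) * harm (S + T))"
    proof -
      have lw: "l * ((real K + 1) * w) = (real n + 1) * w" for w by (simp add: l_def)
      have "l * toll K S = 2 * (l * real S * harm S) + 2 * (l * real T * harm T) - (real n + 1) * (2 * harm (Suc K) - 1)"
        unfolding toll_def T_def[symmetric] right_diff_distrib[of l] lw distrib_left[of l] by simp
      then show ?thesis unfolding m ST st(3) toll_def[of n] t_def[symmetric] by (simp add: algebra_simps)
    qed
    then show ?thesis
      using toll_difference[of s t S T c] st sS tT c1 pS qT
      unfolding y_def split_lin_def split_inv_def t_def[symmetric] x_def m M l_def[symmetric] by simp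
  qed
  \<comment> \<open>Reduces the fourth power of \<open>x\<close> in the squared remainder to
    \<open>x\<^sup>2\<close>. Both signs come from the ratio bound \<open>c\<close>, applied to
    \<open>s\<close> and to the complementary part \<open>t\<close>.\<close>
  have x1: "\<bar>x\<bar> \<le> 1"
  proof -
    have lST: "l * real S + l * real T = real s + real t"
    proof -
      have "l * real S + l * real T = l * (real K + 1)" using M by (simp add: distrib_left[symmetric])
      then show ?thesis unfolding m by (simp add: l_def)
    qed
    have "c * real s - real s \<le> 1" "c * real t - real t \<le> 1"
      using n s st(3) by (auto simp: c_def field_simps t_def)
    then show ?thesis using pS qT lST unfolding x_def by linarith
  qed
  have "y\<^sup>2 \<le> (split_inv n s * (2 * x\<^sup>2 + c / 4))\<^sup>2"
    using y by (metis power2_abs power_mono abs_ge_zero)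
  also have "\<dots> = (split_inv n s)\<^sup>2 * (4 * (x\<^sup>2 * x\<^sup>2) + c * x\<^sup>2 + c\<^sup>2 / 16)"
    by (simp add: power2_eq_square field_simps)
  also have "\<dots> \<le> (split_inv n s)\<^sup>2 * ((4 + c) * x\<^sup>2 + c\<^sup>2 / 16)"
  proof (intro mult_left_mono)
    have "x\<^sup>2 \<le> 1" using x1 by (simp add: abs_square_le_1)
    then have "x\<^sup>2 * x\<^sup>2 \<le> 1 * x\<^sup>2" by (intro mult_right_mono) auto
    then show "4 * (x\<^sup>2 * x\<^sup>2) + c * x\<^sup>2 + c\<^sup>2 / 16 \<le> (4 + c) * x\<^sup>2 + c\<^sup>2 / 16" by (simp add: algebra_simps)
  qed simp
  finally have y2: "y\<^sup>2 \<le> (split_inv n s)\<^sup>2 * ((4 + c) * x\<^sup>2 + c\<^sup>2 / 16)" .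
  have "(1 - l - (toll n s - l * toll K S))\<^sup>2 = (2 * x * split_lin n s + y)\<^sup>2"
    by (rule arg_cong[where f = "\<lambda>z. z\<^sup>2"]) (simp add: y_def)
  also have "\<dots> \<le> (1 + a) * (2 * x * split_lin n s)\<^sup>2 + (1 + 1 / a) * y\<^sup>2"
    by (rule weighted_square_add_le[OF a])
  also have "\<dots> \<le> (1 + a) * (4 * x\<^sup>2 * (split_lin n s)\<^sup>2) + (1 + 1 / a) * ((split_inv n s)\<^sup>2 * ((4 + c) * x\<^sup>2 + c\<^sup>2 / 16))"
    using y2 a by (intro add_mono mult_left_mono) (auto simp: power_mult_distrib)
  finally show ?thesis .
qed

text \<open>The previous bounds averaged block by block. Terms linear in the offset keep their exact
  block mean, which is where \<open>th\<close> comes from; the quadratic ones use the bound 1/3. The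
  negative last term comes from the vanishing mean of the toll error.\<close>

lemma coupled_recursion:
  fixes D :: "nat \<Rightarrow> real" and a :: real
  assumes n: "n \<ge> 1" and R: "R \<ge> 1" and K: "K = n * R" and a: "a > 0"
    and IH: "\<And>s. s \<in> {1..n} \<Longrightarrow> coupled (s - 1) (split_law K k) (D s)"
  defines "th \<equiv> (real R - 1) / (2 * (real K + 1))" and "c \<equiv> (real n + 1) / real n"
    and "m \<equiv> real n + 1"
  shows "coupled n (split_law K (Suc k))
     (2 / real n * (\<Sum>s=1..n. (1 + th * (2 * real s - m) / real s) * D s)
      + 2 / real n * th * (\<Sum>s=1..n. (2 * real s - m) * (real s * split_var K - cost_var (s - 1) / real s))
      + 2 / 3 * split_var K
      + (1 + a) * (4 / 3) * (\<Sum>s=1..n. (split_lin n s)\<^sup>2) / real n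
      + (1 + 1 / a) * ((4 + c) / 3 + c\<^sup>2 / 16) * (\<Sum>s=1..n. (split_inv n s)\<^sup>2) / real n
      - (1 - m / (real K + 1))\<^sup>2)"
    (is "coupled n _ ?B")
proof (rule coupled_mono[OF coupled_step[OF n R K IH]])
  fix s assume "s \<in> {1..n}" then show "s \<in> {1..n}" .
next
  define l where "l = (real n + 1) / (real K + 1)"
  define v where "v = split_var K"
  define S where "S s i = Suc ((s - 1) * R + i)" for s i
  define x where "x s i = l * real (S s i) - real s" for s i
  define g where "g s = real s * v - cost_var (s - 1) / real s" for s
  define e where "e s i = toll n s - l * toll K (S s i)" for s i
  have c0: "c > 0" using n by (simp add: c_def)
  have blk: "block R (S s i) = s" if "s \<in> {1..n}" "i < R" for s i
    using block_eq[of i R "s - 1"] that by (simp add: S_def)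
  have R0: "real R > 0" "real n > 0" using R n by auto
  have x1: "(\<Sum>i<R. x s i) = real R * (th * (2 * real s - m))"
    and x2: "(\<Sum>i<R. (x s i)\<^sup>2) \<le> real R / 3" if "s \<in> {1..n}" for s
    using sum_block_offsets[OF R, of s n] that unfolding x_def S_def l_def th_def m_def K by auto
  have step: "(\<Sum>S=1..K. 2 * (l * real S / real (block R S) * D (block R S)
          + (l * real S - real (block R S)) * (l * real S * split_var K - cost_var (block R S - 1) / real (block R S)))
        + (toll n (block R S) - l * toll K S)\<^sup>2)
    = (\<Sum>s=1..n. \<Sum>i<R. 2 * ((1 + x s i / real s) * D s + x s i * g s + (x s i)\<^sup>2 * v) + (e s i)\<^sup>2)"
    unfolding K sum_blocks S_def[symmetric]
  proof (intro sum.cong refl)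
    fix s i assume "s \<in> {1..n}" "i \<in> {..<R}"
    then have b: "block R (S s i) = s" and s: "real s > 0" using blk by auto
    have "l * real (S s i) / real s = 1 + x s i / real s" using s by (simp add: x_def field_simps)
    moreover have "l * real (S s i) = x s i + real s" by (simp add: x_def)
    ultimately show "2 * (l * real (S s i) / real (block R (S s i)) * D (block R (S s i))
          + (l * real (S s i) - real (block R (S s i))) * (l * real (S s i) * split_var (n * R) - cost_var (block R (S s i) - 1) / real (block R (S s i))))
        + (toll n (block R (S s i)) - l * toll (n * R) (S s i))\<^sup>2
      = 2 * ((1 + x s i / real s) * D s + x s i * g s + (x s i)\<^sup>2 * v) + (e s i)\<^sup>2"
      unfolding b K[symmetric] v_def[symmetric]
      by (simp add: g_def e_def power2_eq_square algebra_simps)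
  qed
  have e0: "(\<Sum>s=1..n. \<Sum>i<R. e s i) = 0"
  proof -
    have "(\<Sum>s=1..n. \<Sum>i<R. e s i) = real R * (\<Sum>s=1..n. toll n s) - l * (\<Sum>s=1..n. \<Sum>i<R. toll K (S s i))"
      by (simp add: e_def sum_subtractf sum_distrib_left)
    also have "(\<Sum>s=1..n. \<Sum>i<R. toll K (S s i)) = (\<Sum>S=1..K. toll K S)"
      unfolding K S_def sum_blocks ..
    finally show ?thesis by (simp only: sum_toll)
  qed
  \<comment> \<open>\<open>e\<close> has total sum zero, so its mean square equals the mean square
    distance from \<open>1 - l\<close> minus \<open>(1 - l)\<^sup>2\<close>. The expansion of the
    toll is around \<open>1 - l\<close>, and the subtracted square is close to 1 on a fine
    grid.\<close>
  have e2: "(\<Sum>s=1..n. \<Sum>i<R. (e s i)\<^sup>2) = (\<Sum>s=1..n. \<Sum>i<R. (1 - l - e s i)\<^sup>2) - real n * real R * (1 - l)\<^sup>2"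
  proof -
    have "(1 - l - e s i)\<^sup>2 = (e s i)\<^sup>2 - 2 * (1 - l) * e s i + (1 - l)\<^sup>2" for s i
      by (simp add: power2_eq_square algebra_simps)
    then have "(\<Sum>s=1..n. \<Sum>i<R. (1 - l - e s i)\<^sup>2)
      = (\<Sum>s=1..n. \<Sum>i<R. (e s i)\<^sup>2) - 2 * (1 - l) * (\<Sum>s=1..n. \<Sum>i<R. e s i) + real n * real R * (1 - l)\<^sup>2"
      by (simp only: sum.distrib sum_subtractf sum_distrib_left[symmetric]) simp
    then show ?thesis unfolding e0 by simp
  qed
  define k1 where "k1 = (4 + c) / 3 + c\<^sup>2 / 16"
  have err: "(\<Sum>i<R. (1 - l - e s i)\<^sup>2) \<le> real R * ((1 + a) * (4 / 3) * (split_lin n s)\<^sup>2 + (1 + 1 / a) * k1 * (split_inv n s)\<^sup>2)"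
    if s: "s \<in> {1..n}" for s
  proof -
    define A B where "A = (1 + a) * 4 * (split_lin n s)\<^sup>2" "B = (1 + 1 / a) * (split_inv n s)\<^sup>2"
    have AB: "A \<ge> 0" "B \<ge> 0" using a by (auto simp: A_B_def)
    have "(\<Sum>i<R. (1 - l - e s i)\<^sup>2) \<le> (\<Sum>i<R. (A + B * (4 + c)) * (x s i)\<^sup>2 + B * (c\<^sup>2 / 16))"
    proof (rule sum_mono)
      fix i assume "i \<in> {..<R}"
      then have "i < R" by simp
      have K': "n * R = K" by (simp add: K)
      define w where "w = 1 + 1 / a"
      note * = toll_error_square[OF n s \<open>i < R\<close> a]
      show "(1 - l - e s i)\<^sup>2 \<le> (A + B * (4 + c)) * (x s i)\<^sup>2 + B * (c\<^sup>2 / 16)"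
        using *[unfolded K', folded S_def l_def c_def, folded x_def e_def]
        unfolding A_B_def w_def[symmetric] by (simp add: algebra_simps)
    qed
    also have "\<dots> = (A + B * (4 + c)) * (\<Sum>i<R. (x s i)\<^sup>2) + real R * (B * (c\<^sup>2 / 16))"
      by (simp add: sum.distrib sum_distrib_left)
    also have "\<dots> \<le> (A + B * (4 + c)) * (real R / 3) + real R * (B * (c\<^sup>2 / 16))"
      using x2[OF s] AB c0 by (intro add_right_mono mult_left_mono) auto
    also have "\<dots> = real R * ((1 + a) * (4 / 3) * (split_lin n s)\<^sup>2 + (1 + 1 / a) * k1 * (split_inv n s)\<^sup>2)"
    proof -
      define w where "w = 1 + 1 / a"
      show ?thesis unfolding A_B_def k1_def w_def[symmetric] by (simp add: field_simps)
    qed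
    finally show ?thesis .
  qed
  have main: "(\<Sum>i<R. 2 * ((1 + x s i / real s) * D s + x s i * g s + (x s i)\<^sup>2 * v))
     \<le> real R * (2 * ((1 + th * (2 * real s - m) / real s) * D s + th * (2 * real s - m) * g s + v / 3))"
    if s: "s \<in> {1..n}" for s
  proof -
    have "(\<Sum>i<R. 2 * ((1 + x s i / real s) * D s + x s i * g s + (x s i)\<^sup>2 * v))
      = (\<Sum>i<R. 2 * D s + 2 * (D s / real s + g s) * x s i + 2 * v * (x s i)\<^sup>2)"
      by (rule sum.cong) (auto simp: algebra_simps)
    also have "\<dots> = real R * (2 * D s) + 2 * (D s / real s + g s) * (\<Sum>i<R. x s i) + 2 * v * (\<Sum>i<R. (x s i)\<^sup>2)"
      by (simp add: sum.distrib sum_distrib_left)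
    also have "\<dots> \<le> real R * (2 * D s) + 2 * (D s / real s + g s) * (real R * (th * (2 * real s - m))) + 2 * v * (real R / 3)"
      unfolding x1[OF s] using x2[OF s] split_var_nonneg[of K] by (intro add_left_mono mult_left_mono) (auto simp: v_def)
    also have "\<dots> = real R * (2 * ((1 + th * (2 * real s - m) / real s) * D s + th * (2 * real s - m) * g s + v / 3))"
    proof -
      have "real s \<noteq> 0" using s by auto
      then show ?thesis by (simp add: field_simps)
    qed
    finally show ?thesis .
  qed
  have "(\<Sum>s=1..n. \<Sum>i<R. 2 * ((1 + x s i / real s) * D s + x s i * g s + (x s i)\<^sup>2 * v) + (e s i)\<^sup>2)
    = (\<Sum>s=1..n. \<Sum>i<R. 2 * ((1 + x s i / real s) * D s + x s i * g s + (x s i)\<^sup>2 * v))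
      + (\<Sum>s=1..n. \<Sum>i<R. (1 - l - e s i)\<^sup>2) - real n * real R * (1 - l)\<^sup>2"
    by (simp only: sum.distrib e2)
  also have "\<dots> \<le> (\<Sum>s=1..n. real R * (2 * ((1 + th * (2 * real s - m) / real s) * D s + th * (2 * real s - m) * g s + v / 3)))
      + (\<Sum>s=1..n. real R * ((1 + a) * (4 / 3) * (split_lin n s)\<^sup>2 + (1 + 1 / a) * k1 * (split_inv n s)\<^sup>2))
      - real n * real R * (1 - l)\<^sup>2"
    by (intro diff_right_mono add_mono sum_mono main err)
  also have "\<dots> = real K * ?B"
  proof -
    have a1: "(\<Sum>s=1..n. real R * (2 * ((1 + th * (2 * real s - m) / real s) * D s + th * (2 * real s - m) * g s + v / 3)))
      = real R * (2 * (\<Sum>s=1..n. (1 + th * (2 * real s - m) / real s) * D s) + 2 * th * (\<Sum>s=1..n. (2 * real s - m) * g s) + 2 * real n * (v / 3))"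
      by (simp add: sum.distrib sum_distrib_left distrib_left mult_ac)
    have a2: "(\<Sum>s=1..n. real R * ((1 + a) * (4 / 3) * (split_lin n s)\<^sup>2 + (1 + 1 / a) * k1 * (split_inv n s)\<^sup>2))
      = real R * ((1 + a) * (4 / 3) * (\<Sum>s=1..n. (split_lin n s)\<^sup>2) + (1 + 1 / a) * k1 * (\<Sum>s=1..n. (split_inv n s)\<^sup>2))"
      by (simp only: sum_distrib_left[symmetric] sum.distrib)
    define X1 X2 X3 X4 where "X1 = (\<Sum>s=1..n. (1 + th * (2 * real s - m) / real s) * D s)"
      "X2 = (\<Sum>s=1..n. (2 * real s - m) * g s)" "X3 = (\<Sum>s=1..n. (split_lin n s)\<^sup>2)"
      "X4 = (\<Sum>s=1..n. (split_inv n s)\<^sup>2)"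
    have K': "real K = real n * real R" by (simp add: K)
    have l: "m / (real K + 1) = l" by (simp add: l_def m_def)
    show ?thesis
      unfolding a1 a2 l k1_def[symmetric] v_def[symmetric] g_def[symmetric] X1_X2_X3_X4_def[symmetric] unfolding K'
      using R0 by (simp add: field_simps)
  qed
  finally show "(\<Sum>S=1..K. 2 * ((real n + 1) / (real K + 1) * real S / real (block R S) * D (block R S)
          + ((real n + 1) / (real K + 1) * real S - real (block R S)) * ((real n + 1) / (real K + 1) * real S * split_var K - cost_var (block R S - 1) / real (block R S)))
        + (toll n (block R S) - (real n + 1) / (real K + 1) * toll K S)\<^sup>2) / real K \<le> ?B"
    unfolding step[unfolded l_def] using R0 by (simp add: K pos_divide_le_eq mult.commute)
qed

section \<open>Numerical bounds\<close>

lemma sum_inverse_square: "(\<Sum>s=1..n. (1 / real s)\<^sup>2) = harm2 n"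
  by (simp add: harm2_def power_divide)

lemma sum_split_inv_square:
  "(\<Sum>s=1..n. (split_inv n s)\<^sup>2) = 2 * harm2 n + 4 * harm n / (real n + 1)"
proof -
  have "(split_inv n s)\<^sup>2 = (1 / real s)\<^sup>2 + (1 / real (Suc n - s))\<^sup>2 + 2 * (1 / (real s * real (Suc n - s)))" for s
    by (simp add: split_inv_def power2_sum)
  then have "(\<Sum>s=1..n. (split_inv n s)\<^sup>2) =
     (\<Sum>s=1..n. (1 / real s)\<^sup>2) + (\<Sum>s=1..n. (1 / real (Suc n - s))\<^sup>2) + 2 * (\<Sum>s=1..n. 1 / (real s * real (Suc n - s)))"
    by (simp only: sum.distrib sum_distrib_left)
  also have "(\<Sum>s=1..n. (1 / real (Suc n - s))\<^sup>2) = (\<Sum>s=1..n. (1 / real s)\<^sup>2)"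
    by (rule sum_reflect)
  finally show ?thesis unfolding sum_inverse_square sum_inverse_conv by simp
qed

text \<open>Divided by \<open>n\<close> this tends to \<open>pi^2 / 3\<close>, the variance of the
  logistic variable \<open>ln (U / (1 - U))\<close>. It is the largest contribution to the
  recursion.\<close>

lemma sum_split_lin_square:
  fixes n :: nat
  defines "m \<equiv> real n + 1" and "h \<equiv> harm (Suc n)" and "g \<equiv> harm2 (Suc n)"
  shows "(\<Sum>s=1..n. (split_lin n s)\<^sup>2) = (2 * m - 1/2) * g - h\<^sup>2 - 2 * h + h / m + 1 / (2 * m\<^sup>2)"
proof -
  let ?h = "harm :: nat \<Rightarrow> real"
  have m0: "m > 0" by (simp add: m_def)
  define r where "r = 1 / m"
  have r: "r * m = 1" using m0 by (simp add: r_def)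
  have hn: "?h n = h - r" "harm2 n = g - r\<^sup>2"
    by (simp_all add: h_def g_def r_def m_def harm_Suc_real power_divide)
  have e: "(split_lin n s)\<^sup>2 = (?h s)\<^sup>2 + (?h (Suc n - s))\<^sup>2 - 2 * (?h s * ?h (Suc n - s))
     + (?h s / real (Suc n - s) + ?h (Suc n - s) / real s) - (?h s / real s + ?h (Suc n - s) / real (Suc n - s))
     + (1 / 4) * ((1 / real s)\<^sup>2 + (1 / real (Suc n - s))\<^sup>2) - (1 / 2) * (1 / (real s * real (Suc n - s)))" for s
  proof -
    define a b u v where "a = ?h s" "b = ?h (Suc n - s)" "u = 1 / real s" "v = 1 / real (Suc n - s)"
    have "split_lin n s = (a - u / 2) - (b - v / 2)" by (simp add: split_lin_def a_b_u_v_def)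
    then have "(split_lin n s)\<^sup>2 = ((a - u / 2) - (b - v / 2))\<^sup>2" by (simp only:)
    also have "\<dots> = a\<^sup>2 + b\<^sup>2 - 2 * (a * b) + (a * v + b * u) - (a * u + b * v)
      + (1 / 4) * (u\<^sup>2 + v\<^sup>2) - (1 / 2) * (u * v)"
      by (simp add: power2_eq_square field_simps)
    finally show ?thesis by (simp add: a_b_u_v_def)
  qed
  have r1: "(\<Sum>s=1..n. (?h (Suc n - s))\<^sup>2) = (\<Sum>s=1..n. (?h s)\<^sup>2)" by (rule sum_reflect)
  have r2: "(\<Sum>s=1..n. ?h (Suc n - s) / real (Suc n - s)) = (\<Sum>s=1..n. ?h s / real s)" by (rule sum_reflect)
  have r3: "(\<Sum>s=1..n. (1 / real (Suc n - s))\<^sup>2) = (\<Sum>s=1..n. (1 / real s)\<^sup>2)" by (rule sum_reflect)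
  have r4: "(\<Sum>s=1..n. ?h s / real (Suc n - s)) = (\<Sum>s=1..n. ?h (Suc n - s) / real s)"
    by (subst sum_reflect[symmetric], rule sum.cong) auto
  have "(\<Sum>s=1..n. (split_lin n s)\<^sup>2) = (m * (?h n)\<^sup>2 - (2 * real n + 1) * ?h n + 2 * real n) * 2
     - 2 * ((real n + 2) * (h\<^sup>2 - g) - 2 * m * h + 2 * m)
     + 2 * (h\<^sup>2 - g) - ((?h n)\<^sup>2 + harm2 n) + harm2 n / 2 - ?h n / m"
    unfolding e sum.distrib sum_subtractf sum_distrib_left[symmetric] r1 r2 r3 r4
      sum_harm_square sum_harm_conv sum_harm_conv_inverse sum_harm_div sum_inverse_square sum_inverse_conv
    by (simp add: m_def h_def g_def)
  also have "\<dots> = (2 * m - 1/2) * g - h\<^sup>2 - 2 * h + h / m + 1 / (2 * m\<^sup>2)"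
  proof -
    have n: "real n = m - 1" by (simp add: m_def)
    have q: "h / m = h * r" "(h - r) / m = (h - r) * r" "1 / (2 * m\<^sup>2) = r\<^sup>2 / 2" by (simp_all add: r_def power_divide)
    have q1: "m * (h - r)\<^sup>2 = m * h\<^sup>2 - 2 * h + r"
      using r by algebra
    have q2: "(2 * (m - 1) + 1) * (h - r) = (2 * m - 1) * h - 2 + r"
      using r by algebra
    show ?thesis unfolding hn n q q1 q2 by (simp add: power2_eq_square field_simps)
  qed
  finally show ?thesis .
qed

text \<open>Chebyshev's sum inequality for increasing antisymmetric weights and a decreasing
  \<open>f\<close>: pairing \<open>s\<close> with \<open>n + 1 - s\<close> leaves products of
  factors of opposite sign.\<close>

lemma antisym_weighted_sum_nonpos:
  assumes "\<And>s. 1 \<le> s \<Longrightarrow> s < n \<Longrightarrow> f (Suc s) \<le> (f s :: real)"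
  shows "(\<Sum>s=1..n. (2 * real s - (real n + 1)) * f s) \<le> 0"
proof -
  have anti: "f b \<le> f a" if "a \<le> b" "1 \<le> a" "b \<le> n" for a b
    using that
  proof (induction b rule: dec_induct)
    case (step b)
    then have "f (Suc b) \<le> f b" by (intro assms) auto
    then show ?case using step by simp
  qed simp
  have "(\<Sum>s=1..n. (2 * real s - (real n + 1)) * f s) = (\<Sum>s=1..n. (2 * real (Suc n - s) - (real n + 1)) * f (Suc n - s))"
    by (rule sum_reflect[symmetric])
  also have "\<dots> = (\<Sum>s=1..n. - (2 * real s - (real n + 1)) * f (Suc n - s))"
    by (rule sum.cong) (auto simp: of_nat_diff)
  finally have "2 * (\<Sum>s=1..n. (2 * real s - (real n + 1)) * f s)
      = (\<Sum>s=1..n. (2 * real s - (real n + 1)) * f s) + (\<Sum>s=1..n. - (2 * real s - (real n + 1)) * f (Suc n - s))"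
    by simp
  also have "\<dots> = (\<Sum>s=1..n. (2 * real s - (real n + 1)) * (f s - f (Suc n - s)))"
    by (simp add: sum.distrib[symmetric] algebra_simps)
  also have "\<dots> \<le> 0"
  proof (rule sum_nonpos)
    fix s assume s: "s \<in> {1..n}"
    show "(2 * real s - (real n + 1)) * (f s - f (Suc n - s)) \<le> 0"
    proof (cases "Suc n - s \<le> s")
      case True
      then have "f s \<le> f (Suc n - s)" using s by (intro anti) auto
      moreover have "2 * real s - (real n + 1) \<ge> 0" using True s by linarith
      ultimately show ?thesis by (intro mult_nonneg_nonpos) auto
    next
      case False
      then have "f (Suc n - s) \<le> f s" using s by (intro anti) auto
      moreover have "2 * real s - (real n + 1) \<le> 0" using False s by linarith
      ultimately show ?thesis by (intro mult_nonpos_nonneg) auto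
    qed
  qed
  finally show ?thesis by simp
qed

text \<open>By the exact variance, the second factor is a decreasing function \<open>f\<close> plus
  \<open>2 * harm s\<close>. The decreasing part contributes at most zero, the harmonic part is
  summed exactly. That \<open>f\<close> decreases rests on the upper bound for
  \<open>split_var K\<close> in terms of \<open>harm2\<close>.\<close>

lemma cross_term_le:
  assumes "n < K"
  shows "(\<Sum>s=1..n. (2 * real s - (real n + 1)) * (real s * split_var K - cost_var (s - 1) / real s))
    \<le> (real n + 1) * (real n + 2 - 2 * harm (Suc n))"
proof -
  define f where "f s = 1 - real s * (7 - split_var K - 4 * harm2 s)" for s
  have g: "real s * split_var K - cost_var (s - 1) / real s = f s + 2 * harm s" if "s \<in> {1..n}" for s
  proof -
    have "s \<noteq> 0" and s: "Suc (s - 1) = s" "real (s - 1) + 1 = real s" using that by auto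
    then have "cost_var (s - 1) / real s = real s * (7 - 4 * harm2 s) - (2 * harm s + 1)"
      unfolding cost_var_eq s by (simp add: power2_eq_square diff_divide_distrib)
    then show ?thesis by (simp add: f_def algebra_simps)
  qed
  have "(\<Sum>s=1..n. (2 * real s - (real n + 1)) * f s) \<le> 0"
  proof (rule antisym_weighted_sum_nonpos)
    fix s assume s: "1 \<le> s" "s < n"
    have "split_var K \<le> 7 - 4 * harm2 (Suc s) - 4 / (real (Suc s) + 1)"
      using s assms by (intro split_var_le_harm2) auto
    moreover have "4 * real s / (real s + 1)\<^sup>2 \<le> 4 / (real s + 2)"
      by (simp add: divide_simps power2_eq_square) (simp add: algebra_simps)
    moreover have "f s - f (Suc s) = (7 - split_var K - 4 * harm2 (Suc s)) - 4 * real s / (real s + 1)\<^sup>2"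
    proof -
      define w where "w = 1 / (real s + 1)\<^sup>2"
      have w: "harm2 s = harm2 (Suc s) - w" "4 * real s / (real s + 1)\<^sup>2 = 4 * real s * w" by (simp_all add: w_def)
      show ?thesis unfolding f_def w of_nat_Suc by (simp only: algebra_simps)
    qed
    moreover have "real (Suc s) + 1 = real s + 2" by simp
    ultimately show "f (Suc s) \<le> f s" by (simp only:)
  qed
  moreover have "(\<Sum>s=1..n. (2 * real s - (real n + 1)) * (2 * harm s)) = (real n + 1) * (real n + 2 - 2 * harm (Suc n))"
  proof -
    have "(\<Sum>s=1..n. (2 * real s - (real n + 1)) * (2 * harm s))
       = 4 * (\<Sum>s=1..n. real s * harm s) - 2 * (real n + 1) * (\<Sum>s=1..n. harm s)"
    proof -
      have "(2 * real s - (real n + 1)) * (2 * harm s) = 4 * (real s * harm s) - 2 * (real n + 1) * harm s" for s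
        by (simp add: algebra_simps)
      then show ?thesis by (simp only: sum_subtractf sum_distrib_left)
    qed
    also have "\<dots> = (real n + 1) * (real n + 2 - 2 * harm (Suc n))"
      unfolding sum_times_harm sum_harm harm_Suc_real
      by (simp add: field_simps)
    finally show ?thesis .
  qed
  moreover have "(\<Sum>s=1..n. (2 * real s - (real n + 1)) * (real s * split_var K - cost_var (s - 1) / real s))
     = (\<Sum>s=1..n. (2 * real s - (real n + 1)) * f s) + (\<Sum>s=1..n. (2 * real s - (real n + 1)) * (2 * harm s))"
    unfolding sum.distrib[symmetric] distrib_left[symmetric]
    by (rule sum.cong) (use g in auto)
  ultimately show ?thesis by simp
qed

text \<open>The values up to 4 are the independent-coupling bound
  \<open>cost_var n + (n + 1)^2 * 11/25\<close>, rounded up (exact at \<open>n = 0\<close>). At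
  \<open>n = 5\<close> that bound is 17.68 and still below \<open>4 n - 2 = 18\<close>; at
  \<open>n = 6\<close> it exceeds 22, and the recursion takes over.\<close>

definition dist_bound :: "nat \<Rightarrow> real" where
  "dist_bound n = (if n = 0 then 11/25 else if n = 1 then 9/5 else if n = 2 then 4
     else if n = 3 then 73/10 else if n = 4 then 119/10 else 4 * real n - 2)"

lemma dist_bound_nonneg: "dist_bound n \<ge> 0"
  by (simp add: dist_bound_def)

lemma dist_bound_le: "n \<ge> 1 \<Longrightarrow> dist_bound n \<le> 4 * real n - 2"
  by (simp add: dist_bound_def)

lemma small_dist_bound:
  assumes "n \<le> 5" "v \<le> 11/25"
  shows "cost_var n + (real n + 1)\<^sup>2 * v \<le> dist_bound n"
proof -
  have "(real n + 1)\<^sup>2 * v \<le> (real n + 1)\<^sup>2 * (11/25)" using assms by (intro mult_left_mono) auto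
  moreover have "n = 0 \<or> n = 1 \<or> n = 2 \<or> n = 3 \<or> n = 4 \<or> n = 5" using assms by auto
  then have "cost_var n + (real n + 1)\<^sup>2 * (11/25) \<le> dist_bound n"
    by (elim disjE) (simp_all add: cost_var_eq dist_bound_def harm_Suc_real eval_nat_numeral harm_expand)
  ultimately show ?thesis by linarith
qed

lemma dist_bound_sum:
  fixes th :: real
  assumes n: "n \<ge> 6" and th: "0 \<le> th" "th \<le> 1 / (2 * real n)"
  shows "2 / real n * (\<Sum>s=1..n. (1 + th * (2 * real s - (real n + 1)) / real s) * dist_bound (s - 1))
    \<le> 4 * real n - 8 + 6 / (real n)\<^sup>2 * ((real n + 1) * harm (Suc n) - 1 - 2 * real n) - 912 / 100 / real n"
proof -
  define m where "m = real n + 1"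
  define eta :: "nat \<Rightarrow> real" where "eta s = dist_bound (s - 1) - (4 * real s - 6)" for s
  let ?w = "\<lambda>s. 1 + th * (2 * real s - m) / real s"
  have n0: "real n > 0" using n by simp
  have mn: "m > 0" by (simp add: m_def)
  have "(\<Sum>s=1..n. ?w s * dist_bound (s - 1)) = (\<Sum>s=1..n. ?w s * (4 * real s - 6)) + (\<Sum>s=1..n. ?w s * eta s)"
    by (simp only: sum.distrib[symmetric] distrib_left[symmetric] eta_def) simp
  also have "(\<Sum>s=1..n. ?w s * eta s) = (\<Sum>s=1..5. ?w s * eta s)"
    by (rule sum.mono_neutral_right) (use n in \<open>auto simp: eta_def dist_bound_def\<close>)
  \<comment> \<open>The deviations from the line \<open>4 s - 6\<close> are 2.44, -0.2, -2, -2.7 and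
    -2.1, with sum -4.56. The bracket is the same sum with weights \<open>1 / s\<close>, which the
    weight \<open>1 + 2 th - th m / s\<close> calls for.\<close>
  also have "\<dots> = (1 + 2 * th) * (- 456 / 100) - th * m * (122/50 - 1/10 - 2/3 - 27/40 - 21/50)"
    by (simp add: eval_nat_numeral eta_def dist_bound_def field_simps)
  also have "(\<Sum>s=1..n. ?w s * (4 * real s - 6)) = 2 * real n * m - 6 * real n + th * (6 * m * harm n - 12 * real n)"
  proof -
    have "(\<Sum>s=1..n. ?w s * (4 * real s - 6)) = (\<Sum>s=1..n. (4 + 8 * th) * real s - (6 + (12 + 4 * m) * th) + 6 * m * th * (1 / real s))"
      by (rule sum.cong) (auto simp: field_simps)
    also have "\<dots> = (4 + 8 * th) * (\<Sum>s=1..n. real s) - real n * (6 + (12 + 4 * m) * th) + 6 * m * th * (\<Sum>s=1..n. 1 / real s)"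
      by (simp add: sum.distrib sum_subtractf sum_distrib_left)
    also have "(\<Sum>s=1..n. real s) = real n * m / 2"
      unfolding m_def by (induction n) (auto simp: field_simps)
    also have "(\<Sum>s=1..n. 1 / real s) = harm n"
      by (simp add: harm_def inverse_eq_divide)
    finally show ?thesis by (simp add: field_simps)
  qed
  also have "2 * real n * m - 6 * real n + th * (6 * m * harm n - 12 * real n)
      + ((1 + 2 * th) * (- 456 / 100) - th * m * (122/50 - 1/10 - 2/3 - 27/40 - 21/50))
    \<le> 2 * real n * m - 6 * real n + 1 / (2 * real n) * (6 * m * harm n - 12 * real n) - 456 / 100"
  proof -
    have "harm n \<ge> (harm 6 :: real)"
      using n unfolding harm_def by (intro sum_mono2) auto
    then have "harm n \<ge> (2 :: real)" by (simp add: harm_expand)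
    then have "6 * m * harm n \<ge> 6 * m * 2" using mn by (intro mult_left_mono) auto
    then have "6 * m * harm n - 12 * real n \<ge> 0" by (simp add: m_def)
    then have "th * (6 * m * harm n - 12 * real n) \<le> 1 / (2 * real n) * (6 * m * harm n - 12 * real n)"
      using th by (intro mult_right_mono) auto
    moreover have "th * m * (122/50 - 1/10 - 2/3 - 27/40 - 21/50) \<ge> 0"
      using th mn by (intro mult_nonneg_nonneg) auto
    moreover have "(1 + 2 * th) * (- 456 / 100) \<le> - 456 / 100" using th by simp
    ultimately show ?thesis by linarith
  qed
  finally have "2 / real n * (\<Sum>s=1..n. ?w s * dist_bound (s - 1))
     \<le> 2 / real n * (2 * real n * m - 6 * real n + 1 / (2 * real n) * (6 * m * harm n - 12 * real n) - 456 / 100)"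
    using n0 by (intro mult_left_mono) auto
  also have "\<dots> = 4 * m - 12 + 6 / (real n)\<^sup>2 * (m * harm n - 2 * real n) - 912 / 100 / real n"
    using n0 by (simp add: field_simps power2_eq_square)
  also have "m * harm n = m * harm (Suc n) - 1"
    using mn by (simp add: harm_Suc_real m_def[symmetric] distrib_left)
  finally show ?thesis unfolding m_def by simp
qed

text \<open>The contraction: 2/3 is the mean of \<open>U^2 + (1 - U)^2\<close> for uniform
  \<open>U\<close>. An error proportional to \<open>(n + 1)^2\<close> shrinks by this factor with
  every iterate.\<close>

lemma square_weight_sum_le:
  fixes th :: real
  assumes n: "n \<ge> 1" and th: "th \<le> 1 / (2 * real n)"
  shows "2 / real n * (\<Sum>s=1..n. (1 + th * (2 * real s - (real n + 1)) / real s) * (real s)\<^sup>2) \<le> 2 / 3 * (real n + 1)\<^sup>2"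
proof -
  define m where "m = real n + 1"
  have n0: "real n \<ge> 1" using n by simp
  have "(\<Sum>s=1..n. (1 + th * (2 * real s - m) / real s) * (real s)\<^sup>2)
    = (\<Sum>s=1..n. (1 + 2 * th) * (real s)\<^sup>2 - th * m * real s)"
    by (rule sum.cong) (auto simp: field_simps power2_eq_square)
  also have "\<dots> = (1 + 2 * th) * (\<Sum>s=1..n. (real s)\<^sup>2) - th * m * (\<Sum>s=1..n. real s)"
    by (simp add: sum_subtractf sum_distrib_left)
  also have "(\<Sum>s=1..n. real s) = real n * m / 2"
    unfolding m_def by (induction n) (auto simp: field_simps)
  also have "(\<Sum>s=1..n. (real s)\<^sup>2) = real n * m * (2 * real n + 1) / 6"
    unfolding m_def by (induction n) (auto simp: field_simps power2_eq_square)
  also have "(1 + 2 * th) * (real n * m * (2 * real n + 1) / 6) - th * m * (real n * m / 2)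
    = real n * m * (2 * real n + 1) / 6 + th * (real n * m * (real n - 1) / 6)"
    by (simp add: m_def field_simps)
  also have "\<dots> \<le> real n * m * (2 * real n + 1) / 6 + 1 / (2 * real n) * (real n * m * (real n - 1) / 6)"
    using th n0 by (intro add_left_mono mult_right_mono) (auto simp: m_def)
  finally have "2 / real n * (\<Sum>s=1..n. (1 + th * (2 * real s - m) / real s) * (real s)\<^sup>2)
    \<le> 2 / real n * (real n * m * (2 * real n + 1) / 6 + 1 / (2 * real n) * (real n * m * (real n - 1) / 6))"
    using n0 by (intro mult_left_mono) auto
  also have "\<dots> = m * (2 * real n + 1) / 3 + m * (real n - 1) / (6 * real n)"
    using n0 by (simp add: field_simps)
  also have "\<dots> \<le> m * (2 * real n + 1) / 3 + m / 6"
  proof -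
    have "m * (real n - 1) / (6 * real n) \<le> m * real n / (6 * real n)"
      using n0 by (intro divide_right_mono mult_left_mono) (auto simp: m_def)
    then show ?thesis using n0 by simp
  qed
  also have "\<dots> \<le> 2 / 3 * m\<^sup>2" using n0 by (simp add: m_def power2_eq_square field_simps)
  finally show ?thesis by (simp add: m_def)
qed

text \<open>The bounds for the terms of \<open>coupled_recursion\<close> minus the target
  \<open>4 n - 2\<close>, with \<open>h\<close> and \<open>g\<close> standing for
  \<open>harm (Suc n)\<close> and \<open>harm2 (Suc n)\<close>; the geometric remainder is kept
  apart. The leading -6 is -8 + 2, and 22/75 is two thirds of 11/25.\<close>

definition rec_gap :: "real \<Rightarrow> real \<Rightarrow> real \<Rightarrow> real" where
  "rec_gap n h g = - 6 + 6 / n\<^sup>2 * ((n + 1) * h - 1 - 2 * n) - 912 / 100 / n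
     + (n + 1) * (n + 2 - 2 * h) / n\<^sup>2 + 22 / 75
     + (1 + 8 / (n + 4)) * (4 / 3) * ((2 * (n + 1) - 1/2) * g - h\<^sup>2 - 2 * h + h / (n + 1) + 1 / (2 * (n + 1)\<^sup>2)) / n
     + ((n + 12) / 8) * ((4 + (n + 1) / n) / 3 + ((n + 1) / n)\<^sup>2 / 16)
        * (2 * (g - 1 / (n + 1)\<^sup>2) + 4 * (h - 1 / (n + 1)) / (n + 1)) / n
     - 98 / 100"

lemma harm_numeral_real: "(harm (numeral k) :: real) = harm (pred_numeral k) + 1 / numeral k"
  and harm2_numeral: "harm2 (numeral k) = harm2 (pred_numeral k) + 1 / (numeral k)\<^sup>2"
proof -
  have k: "real (pred_numeral k) + 1 = numeral k"
    by (metis numeral_eq_Suc of_nat_numeral of_nat_Suc add.commute)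
  show "(harm (numeral k) :: real) = harm (pred_numeral k) + 1 / numeral k"
    using harm_Suc_real[of "pred_numeral k"] unfolding k numeral_eq_Suc[of k, symmetric] .
  show "harm2 (numeral k) = harm2 (pred_numeral k) + 1 / (numeral k)\<^sup>2"
    using harm2_simps(2)[of "pred_numeral k"] unfolding k numeral_eq_Suc[of k, symmetric] .
qed

lemma rec_gap_small:
  assumes "6 \<le> n" "n < 40"
  shows "rec_gap (real n) (harm (Suc n)) (harm2 (Suc n)) \<le> 0"
proof -
  have "{6..<40} = {6::nat, 7, 8, 9, 10, 11, 12, 13, 14, 15, 16, 17, 18, 19, 20, 21, 22, 23, 24, 25, 26, 27, 28, 29, 30, 31, 32, 33, 34, 35, 36, 37, 38, 39}"
    by code_simp
  with assms have "n \<in> {6, 7, 8, 9, 10, 11, 12, 13, 14, 15, 16, 17, 18, 19, 20, 21, 22, 23, 24, 25, 26, 27, 28, 29, 30, 31, 32, 33, 34, 35, 36, 37, 38, 39}" by (metis atLeastLessThan_iff)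
  then show ?thesis
    by (elim insertE emptyE; simp add: rec_gap_def harm_numeral_real harm2_numeral harm_expand power2_eq_square)
qed

text \<open>Each term is majorised by a polynomial in \<open>x = 1 / n\<close> of degree at most
  two. Their sum is below a quadratic with negative discriminant.\<close>

lemma rec_gap_large:
  assumes "40 \<le> n"
  shows "rec_gap (real n) (harm (Suc n)) (harm2 (Suc n)) \<le> 0"
proof -
  define N h g x where "N = real n" "h = (harm (Suc n) :: real)" "g = harm2 (Suc n)" "x = 1 / real n"
  have N: "N \<ge> 40" "N > 0" "N + 1 > 0" using assms by (auto simp: N_h_g_x_def)
  have x: "0 < x" "x \<le> 1 / 40" "N * x = 1" "1 / N = x"
    using assms by (auto simp: N_h_g_x_def divide_simps)
  have h41: "(harm 41 :: real) \<ge> 43/10" "(harm 41 :: real) \<le> 431/100"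
    by (simp_all add: harm_numeral_real harm_expand)
  have hlow: "h \<ge> 43/10"
  proof -
    have "(harm 41 :: real) \<le> h" unfolding N_h_g_x_def harm_def using assms by (intro sum_mono2) auto
    then show ?thesis using h41 by simp
  qed
  \<comment> \<open>The reciprocals after \<open>harm 41\<close> are at most 1/42. Linear growth of
    this bound is harmless, as \<open>h\<close> enters the positive terms divided by something of
    order \<open>n\<close>.\<close>
  have hup: "h \<le> 431/100 + (N - 40) / 42"
  proof -
    have "(harm (Suc k) :: real) \<le> 431/100 + (real k - 40) / 42" if "40 \<le> k" for k
      using that
    proof (induction k rule: dec_induct)
      case base
      then show ?case using h41 by simp
    next
      case (step k)
      have "1 / (real k + 2) \<le> 1 / 42" using step by (intro divide_left_mono) auto
      moreover have "harm (Suc (Suc k)) = (harm (Suc k) :: real) + 1 / (real k + 2)"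
        unfolding harm_Suc_real[of "Suc k"] by (simp add: add.commute)
      ultimately show ?case using step.IH unfolding of_nat_Suc by argo
    qed
    then show ?thesis using assms by (simp add: N_h_g_x_def)
  qed
  have gup: "g \<le> 16453 / 10000"
  proof -
    have "harm2 (Suc n) - harm2 40 \<le> 1 / real 40 - 1 / real (Suc n)"
      by (rule harm2_diff_bounds(2)) (use assms in auto)
    moreover have "harm2 40 \<le> 16203 / 10000" by (simp add: harm2_numeral power2_eq_square)
    moreover have "1 / real (Suc n) \<ge> 0" "1 / real 40 = 1 / 40" by simp_all
    ultimately show ?thesis unfolding N_h_g_x_def by argo
  qed
  have t1: "6 / N\<^sup>2 * ((N + 1) * h - 1 - 2 * N) \<le> 143/1000 + 83/10 * x + 142/10 * x\<^sup>2"
  proof -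
    have "(N + 1) * h \<le> (N + 1) * (431/100 + (N - 40) / 42)" using hup N by (intro mult_left_mono) auto
    then have "6 / N\<^sup>2 * ((N + 1) * h - 1 - 2 * N) \<le> 6 / N\<^sup>2 * ((N + 1) * (431/100 + (N - 40) / 42) - 1 - 2 * N)"
      by (intro mult_left_mono) auto
    also have "\<dots> = 6 * ((1 + x) * (1/42 + (431/100 - 40/42) * x) - x\<^sup>2 - 2 * x)"
      using N unfolding x(4)[symmetric] by (simp add: field_simps power2_eq_square)
    also have "\<dots> \<le> 143/1000 + 83/10 * x + 142/10 * x\<^sup>2"
      using x by (simp add: field_simps power2_eq_square)
    finally show ?thesis .
  qed
  have t2: "912 / 100 / N = 912/100 * x" unfolding x(4)[symmetric] by simp
  have t3: "(N + 1) * (N + 2 - 2 * h) / N\<^sup>2 \<le> 1 - 56/10 * x - 66/10 * x\<^sup>2"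
  proof -
    have "(N + 1) * (N + 2 - 2 * h) \<le> (N + 1) * (N - 66/10)" using hlow N by (intro mult_left_mono) auto
    then have "(N + 1) * (N + 2 - 2 * h) / N\<^sup>2 \<le> (N + 1) * (N - 66/10) / N\<^sup>2"
      by (intro divide_right_mono) auto
    also have "\<dots> = 1 - 56/10 * x - 66/10 * x\<^sup>2"
      using N unfolding x(4)[symmetric] by (simp add: field_simps power2_eq_square)
    finally show ?thesis .
  qed
  have t4: "(1 + 8 / (N + 4)) * (4 / 3) * ((2 * (N + 1) - 1/2) * g - h\<^sup>2 - 2 * h + h / (N + 1) + 1 / (2 * (N + 1)\<^sup>2)) / N
     \<le> 439/100 + 3 * x - 250 * x\<^sup>2"
  proof -
    have "h * (h + 2 - 1 / (N + 1)) \<ge> 43/10 * (43/10 + 2 - 1/40)"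
      using hlow N by (intro mult_mono diff_mono add_mono divide_left_mono) (auto simp: divide_simps)
    then have 1: "h\<^sup>2 + 2 * h - h / (N + 1) \<ge> 2698/100"
      by (simp add: algebra_simps power2_eq_square)
    have "1 / (2 * (N + 1)\<^sup>2) \<le> 1 / 8"
    proof -
      have "2\<^sup>2 \<le> (N + 1)\<^sup>2" using N by (intro power_mono) auto
      then show ?thesis by (intro divide_left_mono) auto
    qed
    moreover have "(2 * (N + 1) - 1/2) * g \<le> (2 * (N + 1) - 1/2) * (16453 / 10000)"
      using gup N by (intro mult_left_mono) auto
    ultimately have 2: "(2 * (N + 1) - 1/2) * g - h\<^sup>2 - 2 * h + h / (N + 1) + 1 / (2 * (N + 1)\<^sup>2)
       \<le> (2 * N + 3/2) * (16453 / 10000) - 268/10"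
      using 1 by (simp add: algebra_simps)
    have 3: "1 + 8 / (N + 4) \<le> 1 + 8 * x"
    proof -
      have "8 / (N + 4) \<le> 8 / N" using N by (intro divide_left_mono) auto
      then show ?thesis unfolding x(4)[symmetric] by simp
    qed
    have 4: "(2 * N + 3/2) * (16453 / 10000) - 268/10 \<ge> 0" using N by simp
    have "(1 + 8 / (N + 4)) * (4 / 3) * ((2 * (N + 1) - 1/2) * g - h\<^sup>2 - 2 * h + h / (N + 1) + 1 / (2 * (N + 1)\<^sup>2)) / N
      \<le> (1 + 8 * x) * (4 / 3) * ((2 * N + 3/2) * (16453 / 10000) - 268/10) / N"
    proof (intro divide_right_mono)
      have "(1 + 8 / (N + 4)) * (4 / 3) * ((2 * (N + 1) - 1/2) * g - h\<^sup>2 - 2 * h + h / (N + 1) + 1 / (2 * (N + 1)\<^sup>2))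
        \<le> (1 + 8 / (N + 4)) * (4 / 3) * ((2 * N + 3/2) * (16453 / 10000) - 268/10)"
        using 2 N by (intro mult_left_mono) auto
      also have "\<dots> \<le> (1 + 8 * x) * (4 / 3) * ((2 * N + 3/2) * (16453 / 10000) - 268/10)"
        using 3 4 by (intro mult_right_mono) auto
      finally show "(1 + 8 / (N + 4)) * (4 / 3) * ((2 * (N + 1) - 1/2) * g - h\<^sup>2 - 2 * h + h / (N + 1) + 1 / (2 * (N + 1)\<^sup>2))
        \<le> (1 + 8 * x) * (4 / 3) * ((2 * N + 3/2) * (16453 / 10000) - 268/10)" .
    qed (use N in simp)
    also have "\<dots> = (1 + 8 * x) * (4 / 3) * (2 * (16453 / 10000) + (3/2 * (16453 / 10000) - 268/10) * x)"
      using N unfolding x(4)[symmetric] by (simp add: field_simps)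
    also have "\<dots> \<le> 439/100 + 3 * x - 250 * x\<^sup>2"
      using x by (simp add: field_simps power2_eq_square)
    finally show ?thesis .
  qed
  have t5: "((N + 12) / 8) * ((4 + (N + 1) / N) / 3 + ((N + 1) / N)\<^sup>2 / 16)
        * (2 * (g - 1 / (N + 1)\<^sup>2) + 4 * (h - 1 / (N + 1)) / (N + 1)) / N \<le> 82/100 + 10 * x"
  proof -
    have c: "(N + 1) / N = 1 + x" using N unfolding x(4)[symmetric] by (simp add: field_simps)
    have "(1 + x)\<^sup>2 \<le> (1 + 1/40)\<^sup>2" using x by (intro power_mono) auto
    then have y: "(1 + x)\<^sup>2 \<le> 1681/1600" by (simp add: power2_eq_square)
    have k: "(4 + (1 + x)) / 3 + (1 + x)\<^sup>2 / 16 \<le> 1741/1000" using y x(2) by argo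
    have "4 * (h - 1 / (N + 1)) / (N + 1) \<le> 4 * (11/100)"
    proof -
      have "h - 1 / (N + 1) \<le> h" using N by simp
      also have "\<dots> \<le> 11/100 * (N + 1)" using hup N by (simp add: field_simps)
      finally have "(h - 1 / (N + 1)) / (N + 1) \<le> 11/100" using N by (simp add: pos_divide_le_eq)
      then have "4 * ((h - 1 / (N + 1)) / (N + 1)) \<le> 4 * (11/100)" by (rule mult_left_mono) simp
      then show ?thesis by (simp only: times_divide_eq_right)
    qed
    moreover have "2 * (g - 1 / (N + 1)\<^sup>2) \<le> 2 * (16453 / 10000)"
    proof -
      have "1 / (N + 1)\<^sup>2 \<ge> 0" by simp
      then show ?thesis using gup by argo
    qed
    ultimately have z: "2 * (g - 1 / (N + 1)\<^sup>2) + 4 * (h - 1 / (N + 1)) / (N + 1) \<le> 3731/1000"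
      by argo
    have k0: "(4 + (1 + x)) / 3 + (1 + x)\<^sup>2 / 16 \<ge> 0" using x by (intro add_nonneg_nonneg) auto
    have "((N + 12) / 8) * ((4 + (N + 1) / N) / 3 + ((N + 1) / N)\<^sup>2 / 16)
        * (2 * (g - 1 / (N + 1)\<^sup>2) + 4 * (h - 1 / (N + 1)) / (N + 1)) / N
      \<le> ((N + 12) / 8) * (1741/1000) * (3731/1000) / N"
      unfolding c
    proof (intro divide_right_mono)
      have "((N + 12) / 8) * ((4 + (1 + x)) / 3 + (1 + x)\<^sup>2 / 16) * (2 * (g - 1 / (N + 1)\<^sup>2) + 4 * (h - 1 / (N + 1)) / (N + 1))
        \<le> ((N + 12) / 8) * ((4 + (1 + x)) / 3 + (1 + x)\<^sup>2 / 16) * (3731/1000)"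
        using z k0 N by (intro mult_left_mono mult_nonneg_nonneg) auto
      also have "\<dots> \<le> ((N + 12) / 8) * (1741/1000) * (3731/1000)"
        using k N by (intro mult_right_mono mult_left_mono) auto
      finally show "((N + 12) / 8) * ((4 + (1 + x)) / 3 + (1 + x)\<^sup>2 / 16) * (2 * (g - 1 / (N + 1)\<^sup>2) + 4 * (h - 1 / (N + 1)) / (N + 1))
        \<le> ((N + 12) / 8) * (1741/1000) * (3731/1000)" .
    qed (use N in simp)
    also have "\<dots> = (1 + 12 * x) / 8 * (1741/1000) * (3731/1000)"
      using N unfolding x(4)[symmetric] by (simp add: field_simps)
    also have "\<dots> \<le> 82/100 + 10 * x" using x by simp
    finally show ?thesis .
  qed
  have sq: "x\<^sup>2 \<ge> 0" by simp
  have quad: "- 33/100 + 7 * x - 242 * x\<^sup>2 \<le> (0::real)"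
  proof -
    have "242 * x\<^sup>2 - 7 * x + 33/100 = 242 * (x - 7/484)\<^sup>2 + (33/100 - 49/968)"
      by (simp add: power2_eq_square field_simps)
    then show ?thesis using zero_le_power2[of "x - 7/484"] by argo
  qed
  have "rec_gap N h g \<le> - 6 + (143/1000 + 83/10 * x + 142/10 * x\<^sup>2) - 912/100 * x
     + (1 - 56/10 * x - 66/10 * x\<^sup>2) + 22 / 75 + (439/100 + 3 * x - 250 * x\<^sup>2) + (82/100 + 10 * x) - 98 / 100"
    unfolding rec_gap_def t2 by (intro diff_mono add_mono t1 t3 t4 t5 order_refl)
  also have "\<dots> \<le> - 33/100 + 7 * x - 242 * x\<^sup>2" using x(1) sq by argo
  finally show ?thesis using quad by (simp add: N_h_g_x_def)
qed

lemma rec_gap_nonpos: "6 \<le> n \<Longrightarrow> rec_gap (real n) (harm (Suc n)) (harm2 (Suc n)) \<le> 0"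
  using rec_gap_small[of n] rec_gap_large[of n] by (cases "n < 40") auto

lemma harm_Suc_le_half: "harm (Suc n) \<le> (1 + real n / 2 :: real)"
proof (induction n)
  case 0
  show ?case by (simp add: harm_expand)
next
  case (Suc n)
  have "1 / (real (Suc n) + 1) \<le> 1 / 2" by (intro divide_left_mono) auto
  then show ?case using Suc unfolding harm_Suc_real[of "Suc n"] of_nat_Suc by argo
qed

lemma cost_var_le: "cost_var n \<le> 7 * (real n + 1)\<^sup>2"
proof -
  have "(real n + 1) * (2 * harm (Suc n) + 1) \<ge> 0" by (simp add: harm_nonneg)
  moreover have "(real n + 1)\<^sup>2 * harm2 (Suc n) \<ge> 0"
    unfolding harm2_def by (intro mult_nonneg_nonneg sum_nonneg) auto
  ultimately show ?thesis unfolding cost_var_eq right_diff_distrib by linarith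
qed

text \<open>Induction on the number of iterates, for all sizes up to \<open>N\<close> at once: the
  step for \<open>n\<close> draws on every smaller size at the previous iterate, and on the grid
  being a multiple of \<open>n\<close>. The remainder starts at the independent coupling, with 14 =
  7 + 7 bounding both variances, and then decays geometrically.\<close>

lemma coupled_dist_bound:
  assumes dvd: "\<And>n. 1 \<le> n \<Longrightarrow> n \<le> N \<Longrightarrow> n dvd K" and K: "100 * (N + 1) \<le> K"
  shows "n \<le> N \<Longrightarrow> coupled n (split_law K k) (dist_bound n + 14 * (2/3)^k * (real n + 1)\<^sup>2)"
proof (induction k arbitrary: n)
  have K10: "K \<ge> 10" "K \<ge> 1" using K by auto
  have v: "split_var K \<le> 11/25" using split_var_le[OF K10(1)] .
  case 0
  have "(real n + 1)\<^sup>2 * split_var K \<le> (real n + 1)\<^sup>2 * 7" using v by (intro mult_left_mono) auto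
  then have "cost_var n + (real n + 1)\<^sup>2 * split_var K \<le> dist_bound n + 14 * (2/3)^0 * (real n + 1)\<^sup>2"
    using cost_var_le[of n] dist_bound_nonneg[of n] unfolding power_0 mult_1_right by linarith
  then show ?case using coupled_indep[OF K10(2)] coupled_mono by blast
next
  case (Suc k)
  have K10: "K \<ge> 10" "K \<ge> 1" using K by auto
  have v: "split_var K \<le> 11/25" using split_var_le[OF K10(1)] .
  define C :: real where "C = 14 * (2/3)^k"
  have C: "C \<ge> 0" by (simp add: C_def)
  show ?case
  proof (cases "n \<le> 5")
    case True
    have "cost_var n + (real n + 1)\<^sup>2 * split_var K \<le> dist_bound n" by (rule small_dist_bound[OF True v])
    moreover have "14 * (2/3)^Suc k * (real n + 1)\<^sup>2 \<ge> 0" by simp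
    ultimately have "cost_var n + (real n + 1)\<^sup>2 * split_var K \<le> dist_bound n + 14 * (2/3)^Suc k * (real n + 1)\<^sup>2"
      by linarith
    then show ?thesis using coupled_indep[OF K10(2)] coupled_mono by blast
  next
    case False
    then have n: "n \<ge> 6" "n \<ge> 1" by auto
    define R where "R = K div n"
    have KR: "K = n * R" using dvd[of n] n Suc.prems by (simp add: R_def)
    have R: "R \<ge> 1" using KR K10 by (cases R) auto
    have n0: "real n > 0" using n by simp
    \<comment> \<open>The sum of \<open>split_lin\<close> squared grows linearly in
      \<open>n\<close>, that of \<open>split_inv\<close> squared stays bounded. So \<open>a\<close>
      may shrink like \<open>1 / n\<close>: the first is then inflated only by a bounded amount in
      total, and the factor \<open>1 + 1 / a = (n + 12) / 8\<close> of the second is absorbed by the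
      division by \<open>n\<close>.\<close>
    define a where "a = 8 / (real n + 4)"
    have a: "a > 0" by (simp add: a_def)
    define th where "th = (real R - 1) / (2 * (real K + 1))"
    define c where "c = (real n + 1) / real n"
    define m where "m = real n + 1"
    define h where "h = (harm (Suc n) :: real)"
    define g where "g = harm2 (Suc n)"
    define D where "D s = dist_bound (s - 1) + C * (real s)\<^sup>2" for s
    have IH: "coupled (s - 1) (split_law K k) (D s)" if "s \<in> {1..n}" for s
    proof -
      have "s - 1 \<le> N" "real (s - 1) + 1 = real s" using that Suc.prems by auto
      then show ?thesis using Suc.IH[of "s - 1"] by (simp add: D_def C_def)
    qed
    have th: "0 \<le> th" "th \<le> 1 / (2 * real n)"
    proof -
      show "0 \<le> th" using R by (simp add: th_def)
      have "(real R - 1) * real n \<le> real K + 1" using n0 by (simp add: KR algebra_simps)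
      then have "(real R - 1) * real n / (real K + 1) \<le> 1" by (simp add: pos_divide_le_eq)
      moreover have "(real R - 1) * real n / (real K + 1) = th * (2 * real n)"
        unfolding th_def by (metis mult.left_commute mult_divide_mult_cancel_left times_divide_eq_left zero_neq_numeral)
      ultimately have "th * (2 * real n) \<le> 1" by simp
      then show "th \<le> 1 / (2 * real n)" using n0 by (subst pos_le_divide_eq) auto
    qed
    let ?w = "\<lambda>s. 1 + th * (2 * real s - m) / real s"
    have T1: "2 / real n * (\<Sum>s=1..n. ?w s * D s)
       \<le> 4 * real n - 8 + 6 / (real n)\<^sup>2 * (m * h - 1 - 2 * real n) - 912 / 100 / real n + C * (2/3 * m\<^sup>2)"
    proof -
      have "2 / real n * (\<Sum>s=1..n. ?w s * D s)
         = 2 / real n * (\<Sum>s=1..n. ?w s * dist_bound (s - 1)) + C * (2 / real n * (\<Sum>s=1..n. ?w s * (real s)\<^sup>2))"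
      proof -
        have "?w s * D s = ?w s * dist_bound (s - 1) + C * (?w s * (real s)\<^sup>2)" for s
          unfolding D_def distrib_left by (simp only: mult.left_commute)
        then have "(\<Sum>s=1..n. ?w s * D s) = (\<Sum>s=1..n. ?w s * dist_bound (s - 1)) + C * (\<Sum>s=1..n. ?w s * (real s)\<^sup>2)"
          by (simp only: sum.distrib sum_distrib_left)
        then show ?thesis by (simp only: distrib_left mult.left_commute)
      qed
      also have "C * (2 / real n * (\<Sum>s=1..n. ?w s * (real s)\<^sup>2)) \<le> C * (2/3 * m\<^sup>2)"
        unfolding m_def using C square_weight_sum_le[OF n(2) th(2)] by (intro mult_left_mono) auto
      finally show ?thesis using dist_bound_sum[OF n(1) th] unfolding m_def h_def by linarith
    qed
    have T2: "2 / real n * th * (\<Sum>s=1..n. (2 * real s - m) * (real s * split_var K - cost_var (s - 1) / real s))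
       \<le> m * (real n + 2 - 2 * h) / (real n)\<^sup>2"
    proof -
      have "n < K" using K Suc.prems by simp
      from cross_term_le[OF this]
      have "2 / real n * th * (\<Sum>s=1..n. (2 * real s - m) * (real s * split_var K - cost_var (s - 1) / real s))
        \<le> 2 / real n * th * (m * (real n + 2 - 2 * h))"
        using th n0 unfolding m_def h_def by (intro mult_left_mono) auto
      also have "\<dots> \<le> 2 / real n * (1 / (2 * real n)) * (m * (real n + 2 - 2 * h))"
        using th n0 harm_Suc_le_half[of n] by (intro mult_right_mono mult_left_mono mult_nonneg_nonneg) (auto simp: m_def h_def)
      also have "\<dots> = m * (real n + 2 - 2 * h) / (real n)\<^sup>2" by (simp add: power2_eq_square)
      finally show ?thesis .
    qed
    have T3: "2 / 3 * split_var K \<le> 22 / 75" using v by simp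
    have T4: "(1 + a) * (4 / 3) * (\<Sum>s=1..n. (split_lin n s)\<^sup>2) / real n
       = (1 + 8 / (real n + 4)) * (4 / 3) * ((2 * m - 1/2) * g - h\<^sup>2 - 2 * h + h / m + 1 / (2 * m\<^sup>2)) / real n"
      unfolding sum_split_lin_square a_def m_def h_def g_def ..
    have T5: "(1 + 1 / a) * ((4 + c) / 3 + c\<^sup>2 / 16) * (\<Sum>s=1..n. (split_inv n s)\<^sup>2) / real n
       = ((real n + 12) / 8) * ((4 + m / real n) / 3 + (m / real n)\<^sup>2 / 16)
        * (2 * (g - 1 / m\<^sup>2) + 4 * (h - 1 / m) / m) / real n"
    proof -
      have "1 + 1 / a = (real n + 12) / 8" by (simp add: a_def field_simps)
      moreover have "2 * (g - 1 / m\<^sup>2) + 4 * (h - 1 / m) / m = 2 * harm2 n + 4 * harm n / (real n + 1)"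
        unfolding g_def h_def m_def harm_Suc_real harm2_simps by simp
      ultimately show ?thesis unfolding sum_split_inv_square c_def m_def by (simp only:)
    qed
    \<comment> \<open>Here the fineness \<open>100 * (N + 1) \<le> K\<close> enters: the gain of
      almost 1 must be kept nearly intact.\<close>
    have T6: "(1 - m / (real K + 1))\<^sup>2 \<ge> 98 / 100"
    proof -
      have "real (100 * (N + 1)) \<le> real K" using K by (rule of_nat_mono)
      then have "m / (real K + 1) \<le> 1 / 100" using Suc.prems by (simp add: m_def pos_divide_le_eq)
      then have "(99/100)\<^sup>2 \<le> (1 - m / (real K + 1))\<^sup>2" by (intro power_mono) auto
      moreover have "(99/100)\<^sup>2 \<ge> (98/100 :: real)" by (simp add: power2_eq_square)
      ultimately show ?thesis by linarith
    qed
    have g0: "rec_gap (real n) h g \<le> 0" unfolding h_def g_def by (rule rec_gap_nonpos[OF n(1)])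
    have db: "dist_bound n = 4 * real n - 2" using n by (simp add: dist_bound_def)
    have "coupled n (split_law K (Suc k)) (2 / real n * (\<Sum>s=1..n. ?w s * D s)
        + 2 / real n * th * (\<Sum>s=1..n. (2 * real s - m) * (real s * split_var K - cost_var (s - 1) / real s))
        + 2 / 3 * split_var K
        + (1 + a) * (4 / 3) * (\<Sum>s=1..n. (split_lin n s)\<^sup>2) / real n
        + (1 + 1 / a) * ((4 + c) / 3 + c\<^sup>2 / 16) * (\<Sum>s=1..n. (split_inv n s)\<^sup>2) / real n
        - (1 - m / (real K + 1))\<^sup>2)"
      unfolding th_def c_def m_def by (rule coupled_recursion[OF n(2) R KR a IH])
    moreover have "2 / real n * (\<Sum>s=1..n. ?w s * D s)
        + 2 / real n * th * (\<Sum>s=1..n. (2 * real s - m) * (real s * split_var K - cost_var (s - 1) / real s))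
        + 2 / 3 * split_var K
        + (1 + a) * (4 / 3) * (\<Sum>s=1..n. (split_lin n s)\<^sup>2) / real n
        + (1 + 1 / a) * ((4 + c) / 3 + c\<^sup>2 / 16) * (\<Sum>s=1..n. (split_inv n s)\<^sup>2) / real n
        - (1 - m / (real K + 1))\<^sup>2 \<le> dist_bound n + 14 * (2/3)^Suc k * m\<^sup>2"
    proof -
      have "C * (2/3 * m\<^sup>2) = 14 * (2/3)^Suc k * m\<^sup>2" by (simp add: C_def)
      then show ?thesis
        using T1 T2 T3 T6 g0[unfolded rec_gap_def, folded m_def] unfolding T4 T5 db by argo
    qed
    ultimately show ?thesis unfolding m_def by (rule coupled_mono)
  qed
qed

text \<open>The factorial makes the grid a refinement of every split up to \<open>N\<close>, and
  \<open>k\<close> is taken so large that the geometric remainder stays below 1. What matters is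
  that \<open>q\<close> depends on \<open>N\<close> alone and not on \<open>n\<close>.\<close>

lemma exists_common_coupling:
  "\<exists>q::real pmf. \<forall>n. 1 \<le> n \<and> n \<le> N \<longrightarrow> (\<exists>Q. fin_pmf Q \<and> map_pmf fst Q = cost_law n \<and> map_pmf snd Q = q \<and>
     expect Q (\<lambda>p. (fst p - real n * snd p)\<^sup>2) \<le> 4 * real n)"
proof -
  define K where "K = fact N * (100 * (N + 1))"
  have dvd: "n dvd K" if "1 \<le> n" "n \<le> N" for n
    using that by (simp add: K_def dvd_fact dvd_mult2)
  have "fact N \<ge> (1::nat)" by (rule fact_ge_1)
  then have K: "100 * (N + 1) \<le> K" unfolding K_def by (metis mult_le_mono1 mult_1)
  then have K1: "K \<ge> 1" "K \<ge> 10" by auto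
  have "(\<lambda>k. 14 * (2/3::real)^k * (real N + 1)\<^sup>2) \<longlonglongrightarrow> 14 * 0 * (real N + 1)\<^sup>2"
    by (intro tendsto_intros LIMSEQ_power_zero) auto
  then have "\<forall>\<^sub>F k in sequentially. 14 * (2/3::real)^k * (real N + 1)\<^sup>2 < 1"
    by (rule order_tendstoD) simp
  then obtain k where k: "14 * (2/3::real)^k * (real N + 1)\<^sup>2 < 1"
    by (meson eventually_happens sequentially_bot)
  show ?thesis
  proof (intro exI[of _ "split_law K k"] allI impI)
    fix n assume "1 \<le> n \<and> n \<le> N"
    then have n: "1 \<le> n" "n \<le> N" by auto
    obtain Q where Q: "fin_pmf Q" "map_pmf fst Q = cost_law n" "map_pmf snd Q = split_law K k"
      "expect Q (\<lambda>p. (fst p - (real n + 1) * snd p)\<^sup>2) \<le> dist_bound n + 14 * (2/3)^k * (real n + 1)\<^sup>2"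
      using coupled_dist_bound[OF dvd K n(2), of k] unfolding coupled_def by blast
    define E where "E = expect Q (\<lambda>p. (fst p - (real n + 1) * snd p)\<^sup>2)"
    define v where "v = split_var K"
    have E0: "E \<ge> 0" unfolding E_def by (intro Bochner_Integration.integral_nonneg) auto
    have KN: "real K \<ge> 100 * (real n + 1)"
    proof -
      have "100 * (n + 1) \<le> K" using K n by simp
      then have "real (100 * (n + 1)) \<le> real K" by (rule of_nat_mono)
      then show ?thesis by simp
    qed
    have "14 * (2/3::real)^k * (real n + 1)\<^sup>2 \<le> 14 * (2/3::real)^k * (real N + 1)\<^sup>2"
      using n by (intro mult_left_mono power_mono) auto
    then have E4: "E \<le> 4 * real n - 1"
      using Q(4) k dist_bound_le[OF n(1)] unfolding E_def by linarith
    have "cost_var n \<le> (real n + 1)\<^sup>2 * (v + 11 / real K)"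
      unfolding v_def using n K by (intro cost_var_le_split_var) auto
    then have "cost_var n / (real n + 1) \<le> (real n + 1)\<^sup>2 * (v + 11 / real K) / (real n + 1)"
      by (intro divide_right_mono) auto
    also have "\<dots> = (real n + 1) * v + 11 * ((real n + 1) / real K)"
    proof -
      define z w where "z = real n + 1" "w = v + 11 / real K"
      have "z \<noteq> 0" by (simp add: z_w_def add_eq_0_iff)
      then have "z\<^sup>2 * w / z = z * w" by (simp add: power2_eq_square)
      then show ?thesis unfolding z_w_def by (simp add: distrib_left)
    qed
    also have "(real n + 1) / real K \<le> 1 / 100" using KN K1 by (simp add: pos_divide_le_eq)
    finally have V: "cost_var n / (real n + 1) \<le> (real n + 1) * v + 11 / 100" by simp
    \<comment> \<open>Multiplier \<open>n\<close> instead of \<open>n + 1\<close>: by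
      \<open>V\<close> the correction costs at most \<open>v + 11/100\<close>, less than the unit
      that \<open>E4\<close> leaves below \<open>4 n\<close>.\<close>
    have "expect Q (\<lambda>p. (fst p - real n * snd p)\<^sup>2) = real n / (real n + 1) * E - (real n * v - cost_var n / (real n + 1))"
      using expect_scaled_diff_square(1)[OF Q(1,2,3) K1(1), of "real n"] unfolding E_def v_def by simp
    also have "real n / (real n + 1) * E \<le> 1 * E" using E0 by (intro mult_right_mono) auto
    also have "1 * E - (real n * v - cost_var n / (real n + 1)) \<le> E + v + 11 / 100"
      using V by (simp add: distrib_right)
    also have "\<dots> \<le> 4 * real n" using E4 split_var_le[OF K1(2)] unfolding v_def by simp
    finally have "expect Q (\<lambda>p. (fst p - real n * snd p)\<^sup>2) \<le> 4 * real n" by simp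
    then show "\<exists>Q. fin_pmf Q \<and> map_pmf fst Q = cost_law n \<and> map_pmf snd Q = split_law K k \<and>
      expect Q (\<lambda>p. (fst p - real n * snd p)\<^sup>2) \<le> 4 * real n"
      using Q by blast
  qed
qed

section \<open>Passage to the limit\<close>

text \<open>For \<open>r > 0\<close>, the pointwise smallest function admissible in the certificate
  below, namely the supremum over \<open>a\<close> of the indicator at \<open>a\<close> minus
  \<open>r^2 (a - b)^2\<close>, as a function of \<open>u = b - x\<close>.\<close>

definition ramp :: "real \<Rightarrow> real \<Rightarrow> real" where
  "ramp r u = 1 - (min 1 (max 0 (r * u)))\<^sup>2"

lemma ramp_le_1: "ramp r u \<le> 1"
  by (simp add: ramp_def)

lemma ramp_nonneg: "0 \<le> ramp r u"
proof -
  have "(min 1 (max 0 (r * u)))\<^sup>2 \<le> 1\<^sup>2" by (intro power_mono) auto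
  then show ?thesis by (simp add: ramp_def)
qed

lemma ramp_lipschitz:
  assumes "r > 0"
  shows "\<bar>ramp r u - ramp r v\<bar> \<le> 2 * r * \<bar>u - v\<bar>"
proof -
  define c d where "c = min 1 (max 0 (r * u))" "d = min 1 (max 0 (r * v))"
  have "ramp r u - ramp r v = (d - c) * (d + c)"
    by (simp add: ramp_def c_d_def power2_eq_square algebra_simps)
  then have "\<bar>ramp r u - ramp r v\<bar> = \<bar>d - c\<bar> * (d + c)"
    by (simp add: abs_mult c_d_def)
  also have "\<dots> \<le> \<bar>r * u - r * v\<bar> * 2"
    by (intro mult_mono) (auto simp: c_d_def min_def max_def)
  also have "\<bar>r * u - r * v\<bar> = r * \<bar>u - v\<bar>"
    using assms by (simp add: abs_mult right_diff_distrib[symmetric])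
  finally show ?thesis by simp
qed

text \<open>Dual certificate for the quadratic transport cost: integrating it against any coupling
  bounds a distribution function by a smoothed one.\<close>

lemma ramp_certificate:
  fixes A B x r s :: real
  assumes "r > 0" "s = 1 \<or> s = -1" "s * (A - x) \<le> 0"
  shows "1 \<le> ramp r (s * (B - x)) + r\<^sup>2 * (A - B)\<^sup>2"
proof (cases "s * (B - x) \<le> 0")
  case True
  then have "r * (s * (B - x)) \<le> 0" using assms(1) by (simp add: mult_nonneg_nonpos)
  then show ?thesis using assms(1) by (simp add: ramp_def max_def)
next
  case False
  define u where "u = s * (B - x)"
  have "u \<le> s * (B - A)" using assms(3) by (simp add: u_def algebra_simps)
  then have "u\<^sup>2 \<le> (s * (B - A))\<^sup>2" using False by (intro power_mono) (auto simp: u_def)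
  also have "\<dots> = (A - B)\<^sup>2" using assms(2) by (auto simp: power2_commute)
  finally have "r\<^sup>2 * u\<^sup>2 \<le> r\<^sup>2 * (A - B)\<^sup>2" by (intro mult_left_mono) auto
  moreover have "(min 1 (max 0 (r * u)))\<^sup>2 \<le> (r * u)\<^sup>2"
    using False assms(1) by (intro power_mono) (auto simp: u_def)
  ultimately show ?thesis unfolding ramp_def u_def[symmetric] by (simp add: power_mult_distrib)
qed

text \<open>Two couplings with the same \<open>q\<close> are chained. For \<open>n\<close> the
  certificate is used, since this loss stays in the result; for \<open>N\<close> the Lipschitz bound
  is enough, since its loss vanishes as \<open>N\<close> grows. The sign \<open>s\<close> treats
  both tails together.\<close>

lemma ramp_transfer:
  fixes x r s \<epsilon> :: real
  assumes n: "1 \<le> n" "n \<le> N" and r: "r > 0" and s: "s = 1 \<or> s = -1" and \<epsilon>: "\<epsilon> > 0"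
  shows "measure_pmf.prob (cost_law n) {z. s * (z / real n - x) \<le> 0}
    \<le> expect (cost_law N) (\<lambda>z. ramp r (s * (z / real N - x))) + 4 * r\<^sup>2 / real n + r * \<epsilon> + 4 * r / (real N * \<epsilon>)"
proof -
  obtain q where q: "\<And>m. 1 \<le> m \<Longrightarrow> m \<le> N \<Longrightarrow> \<exists>Q. fin_pmf Q \<and> map_pmf fst Q = cost_law m \<and> map_pmf snd Q = q \<and>
     expect Q (\<lambda>p. (fst p - real m * snd p)\<^sup>2) \<le> 4 * real m"
    using exists_common_coupling[of N] by blast
  obtain Q where Q: "fin_pmf Q" "map_pmf fst Q = cost_law n" "map_pmf snd Q = q"
      "expect Q (\<lambda>p. (fst p - real n * snd p)\<^sup>2) \<le> 4 * real n"
    using q[OF n] by blast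
  obtain Q' where Q': "fin_pmf Q'" "map_pmf fst Q' = cost_law N" "map_pmf snd Q' = q"
      "expect Q' (\<lambda>p. (fst p - real N * snd p)\<^sup>2) \<le> 4 * real N"
    using q[of N] n by auto
  have scaled: "expect P (\<lambda>p. (fst p / real m - snd p)\<^sup>2) \<le> 4 / real m"
    if "m \<ge> 1" "expect P (\<lambda>p. (fst p - real m * snd p)\<^sup>2) \<le> 4 * real m" for m and P :: "(real \<times> real) pmf"
  proof -
    have "(fst p / real m - snd p)\<^sup>2 = (fst p - real m * snd p)\<^sup>2 / (real m)\<^sup>2" for p :: "real \<times> real"
      using that(1) by (simp add: power_divide[symmetric] diff_divide_distrib)
    then have "expect P (\<lambda>p. (fst p / real m - snd p)\<^sup>2) = expect P (\<lambda>p. (fst p - real m * snd p)\<^sup>2) / (real m)\<^sup>2"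
      by simp
    also have "\<dots> \<le> 4 * real m / (real m)\<^sup>2" using that(2) by (intro divide_right_mono) auto
    also have "\<dots> = 4 / real m" using that(1) by (simp add: power2_eq_square)
    finally show ?thesis .
  qed
  define \<phi> where "\<phi> y = ramp r (s * (y - x))" for y
  have "measure_pmf.prob (cost_law n) {z. s * (z / real n - x) \<le> 0}
    = expect (cost_law n) (indicator {z. s * (z / real n - x) \<le> 0})" by simp
  also have "\<dots> = expect Q (\<lambda>p. indicator {z. s * (z / real n - x) \<le> 0} (fst p))"
    unfolding Q(2)[symmetric] integral_map_pmf ..
  also have "\<dots> \<le> expect Q (\<lambda>p. \<phi> (snd p) + r\<^sup>2 * (fst p / real n - snd p)\<^sup>2)"
  proof (rule expect_mono[OF Q(1)])
    fix p :: "real \<times> real"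
    show "indicator {z. s * (z / real n - x) \<le> 0} (fst p) \<le> \<phi> (snd p) + r\<^sup>2 * (fst p / real n - snd p)\<^sup>2"
      using ramp_certificate[OF r s, of "fst p / real n" x "snd p"] ramp_nonneg[of r "s * (snd p - x)"]
      by (auto simp: \<phi>_def indicator_def)
  qed
  also have "\<dots> = expect Q (\<lambda>p. \<phi> (snd p)) + r\<^sup>2 * expect Q (\<lambda>p. (fst p / real n - snd p)\<^sup>2)"
    by (simp add: expect_linear Q(1))
  also have "expect Q (\<lambda>p. \<phi> (snd p)) = expect q \<phi>"
    unfolding Q(3)[symmetric] integral_map_pmf ..
  also have "r\<^sup>2 * expect Q (\<lambda>p. (fst p / real n - snd p)\<^sup>2) \<le> r\<^sup>2 * (4 / real n)"
    using scaled[OF n(1) Q(4)] by (intro mult_left_mono) auto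
  also have "expect q \<phi> = expect Q' (\<lambda>p. \<phi> (snd p))"
    unfolding Q'(3)[symmetric] integral_map_pmf ..
  also have "\<dots> \<le> expect Q' (\<lambda>p. \<phi> (fst p / real N) + (r * \<epsilon> + r / \<epsilon> * (fst p / real N - snd p)\<^sup>2))"
  proof (rule expect_mono[OF Q'(1)])
    fix p :: "real \<times> real"
    define d where "d = fst p / real N - snd p"
    have "\<bar>\<phi> (snd p) - \<phi> (fst p / real N)\<bar> \<le> 2 * r * \<bar>s * (snd p - x) - s * (fst p / real N - x)\<bar>"
      unfolding \<phi>_def by (rule ramp_lipschitz[OF r])
    also have "\<bar>s * (snd p - x) - s * (fst p / real N - x)\<bar> = \<bar>d\<bar>" using s by (auto simp: d_def)
    \<comment> \<open>Weighted arithmetic-geometric mean inequality, so that the second moment of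
      the coupling bounds a first moment.\<close>
    also have "2 * r * \<bar>d\<bar> \<le> r * \<epsilon> + r / \<epsilon> * d\<^sup>2"
    proof -
      have "r / \<epsilon> * (\<epsilon> - \<bar>d\<bar>)\<^sup>2 \<ge> 0" using r \<epsilon> by simp
      moreover have "r / \<epsilon> * (\<epsilon> - \<bar>d\<bar>)\<^sup>2 = r * \<epsilon> + r / \<epsilon> * d\<^sup>2 - 2 * r * \<bar>d\<bar>"
        using \<epsilon> by (simp add: power2_diff field_simps) (simp add: power2_eq_square)
      ultimately show ?thesis by simp
    qed
    finally show "\<phi> (snd p) \<le> \<phi> (fst p / real N) + (r * \<epsilon> + r / \<epsilon> * (fst p / real N - snd p)\<^sup>2)"
      by (simp add: d_def)
  qed
  also have "\<dots> = expect Q' (\<lambda>p. \<phi> (fst p / real N)) + (r * \<epsilon> + r / \<epsilon> * expect Q' (\<lambda>p. (fst p / real N - snd p)\<^sup>2))"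
    by (simp add: expect_linear Q'(1))
  also have "expect Q' (\<lambda>p. \<phi> (fst p / real N)) = expect (cost_law N) (\<lambda>z. \<phi> (z / real N))"
    unfolding Q'(2)[symmetric] integral_map_pmf ..
  also have "r / \<epsilon> * expect Q' (\<lambda>p. (fst p / real N - snd p)\<^sup>2) \<le> r / \<epsilon> * (4 / real N)"
    using scaled[OF _ Q'(4)] n r \<epsilon> by (intro mult_left_mono) auto
  finally show ?thesis unfolding \<phi>_def by (simp add: mult_ac)
qed

section \<open>Passing to the weak limit\<close>

lemma real_distribution_qs_law: "real_distribution (qs_law n)"
  unfolding qs_law_def by (rule prob_space.real_distribution_distr) (auto intro: measure_pmf.prob_space_axioms)

lemma integral_qs_law:
  fixes g :: "real \<Rightarrow> real"
  assumes [measurable]: "g \<in> borel_measurable borel"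
  shows "integral\<^sup>L (qs_law n) g = expect (cost_law n) (\<lambda>z. g (z / real n))"
  unfolding qs_law_def cost_law_def by (subst integral_distr) auto

text \<open>First \<open>N\<close> tends to infinity with \<epsilon> fixed, the ramp being bounded
  and continuous; then \<epsilon> tends to 0.\<close>

lemma ramp_limit_bound:
  fixes x r s :: real and \<mu> :: "real measure"
  assumes n: "1 \<le> n" and r: "r > 0" and s: "s = 1 \<or> s = -1"
    and \<mu>: "real_distribution \<mu>" and lim: "weak_conv_m qs_law \<mu>"
  shows "measure_pmf.prob (cost_law n) {z. s * (z / real n - x) \<le> 0}
    \<le> (LINT y|\<mu>. ramp r (s * (y - x))) + 4 * r\<^sup>2 / real n"
proof -
  let ?\<phi> = "\<lambda>y. ramp r (s * (y - x))"
  have cont: "continuous_on UNIV ?\<phi>"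
    unfolding ramp_def by (intro continuous_intros)
  have conv: "(\<lambda>N. integral\<^sup>L (qs_law N) ?\<phi>) \<longlonglongrightarrow> (LINT y|\<mu>. ?\<phi> y)"
  proof (rule weak_conv_imp_integral_bdd_continuous_conv[OF real_distribution_qs_law \<mu> lim])
    show "isCont ?\<phi> y" for y using cont by (simp add: continuous_on_eq_continuous_at)
    show "norm (?\<phi> y) \<le> 1" for y using ramp_le_1[of r] ramp_nonneg[of r] by (simp add: abs_le_iff)
  qed
  have meas: "?\<phi> \<in> borel_measurable borel" using cont by (rule borel_measurable_continuous_onI)
  have eps: "measure_pmf.prob (cost_law n) {z. s * (z / real n - x) \<le> 0}
    \<le> (LINT y|\<mu>. ?\<phi> y) + 4 * r\<^sup>2 / real n + r * \<epsilon>" if \<epsilon>: "\<epsilon> > 0" for \<epsilon>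
  proof (rule LIMSEQ_le_const)
    have "(\<lambda>N. 4 * r / (real N * \<epsilon>)) \<longlonglongrightarrow> 0"
      using lim_const_over_n[of "4 * r / \<epsilon>"] by (simp add: divide_simps mult_ac)
    then have "(\<lambda>N. integral\<^sup>L (qs_law N) ?\<phi> + 4 * r\<^sup>2 / real n + r * \<epsilon> + 4 * r / (real N * \<epsilon>))
      \<longlonglongrightarrow> (LINT y|\<mu>. ?\<phi> y) + 4 * r\<^sup>2 / real n + r * \<epsilon> + 0"
      by (intro tendsto_add conv tendsto_const)
    then show "(\<lambda>N. integral\<^sup>L (qs_law N) ?\<phi> + 4 * r\<^sup>2 / real n + r * \<epsilon> + 4 * r / (real N * \<epsilon>))
      \<longlonglongrightarrow> (LINT y|\<mu>. ?\<phi> y) + 4 * r\<^sup>2 / real n + r * \<epsilon>" by simp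
    show "\<exists>N0. \<forall>N\<ge>N0. measure_pmf.prob (cost_law n) {z. s * (z / real n - x) \<le> 0}
      \<le> integral\<^sup>L (qs_law N) ?\<phi> + 4 * r\<^sup>2 / real n + r * \<epsilon> + 4 * r / (real N * \<epsilon>)"
      unfolding integral_qs_law[OF meas] using ramp_transfer[OF n _ r s \<epsilon>] by blast
  qed
  show ?thesis
  proof (rule field_le_epsilon)
    fix e :: real assume "e > 0"
    then show "measure_pmf.prob (cost_law n) {z. s * (z / real n - x) \<le> 0}
      \<le> (LINT y|\<mu>. ?\<phi> y) + 4 * r\<^sup>2 / real n + e"
      using eps[of "e / r"] r by simp
  qed
qed

lemma qs_cdf_eq: "qs_cdf n x = measure_pmf.prob (cost_law n) {z. z / real n \<le> x}"
  by (simp add: qs_cdf_def cost_law_def vimage_def)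

lemma cdf_qs_law: "cdf (qs_law n) x = qs_cdf n x"
  by (simp add: cdf_def qs_law_def qs_cdf_def measure_distr vimage_def)

text \<open>Chebyshev's inequality, uniform in \<open>n\<close>, so that no mass escapes in the
  limit. The 28 is 7 times 4, from \<open>n + 1 \<le> 2 n\<close>.\<close>

lemma qs_cdf_tail:
  assumes "n \<ge> 1" "a > 0"
  shows "qs_cdf n a \<ge> 1 - 28 / a\<^sup>2"
proof -
  have n: "real n \<ge> 1" using assms by simp
  have "measure_pmf.prob (cost_law n) {z. \<not> z / real n \<le> a} = expect (cost_law n) (indicator {z. \<not> z / real n \<le> a})"
    by simp
  also have "\<dots> \<le> expect (cost_law n) (\<lambda>z. z\<^sup>2 / (a * real n)\<^sup>2)"
  proof (rule expect_mono[OF fin_cost_law])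
    fix z
    show "indicator {z. \<not> z / real n \<le> a} z \<le> z\<^sup>2 / (a * real n)\<^sup>2"
    proof (cases "z / real n \<le> a")
      case False
      then have "a * real n \<le> z" using n by (simp add: pos_divide_le_eq)
      then have "(a * real n)\<^sup>2 \<le> z\<^sup>2" using assms by (intro power_mono) auto
      then show ?thesis using False assms n by (simp add: divide_simps)
    qed simp
  qed
  also have "\<dots> = cost_var n / (a * real n)\<^sup>2" by (simp add: cost_var_def)
  also have "\<dots> \<le> 28 * (real n)\<^sup>2 / (a * real n)\<^sup>2"
  proof (intro divide_right_mono)
    have "(real n + 1)\<^sup>2 \<le> (2 * real n)\<^sup>2" using n by (intro power_mono) auto
    then show "cost_var n \<le> 28 * (real n)\<^sup>2" using cost_var_le[of n] by (simp add: power_mult_distrib)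
  qed simp
  also have "\<dots> = 28 / a\<^sup>2" using n by (simp add: power_mult_distrib)
  finally have "measure_pmf.prob (cost_law n) {z. \<not> z / real n \<le> a} \<le> 28 / a\<^sup>2" .
  moreover have "measure_pmf.prob (cost_law n) {z. \<not> z / real n \<le> a} = 1 - qs_cdf n a"
  proof -
    have "{z. \<not> z / real n \<le> a} = space (measure_pmf (cost_law n)) - {z. z / real n \<le> a}" by auto
    then show ?thesis
      using measure_pmf.prob_compl[of "{z. z / real n \<le> a}" "cost_law n"] by (simp add: qs_cdf_eq)
  qed
  ultimately show ?thesis by simp
qed

section \<open>The limiting density has total mass one\<close>

lemma emeasure_density_interval_le:
  fixes f :: "real \<Rightarrow> real"
  assumes f: "f \<in> borel_measurable borel" "\<And>x. f x \<le> M" and xy: "x \<le> y" and M: "M \<ge> 0"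
  shows "emeasure (density lborel f) {x<..y} \<le> ennreal (M * (y - x))"
proof -
  have "emeasure (density lborel f) {x<..y} = (\<integral>\<^sup>+ z. ennreal (f z) * indicator {x<..y} z \<partial>lborel)"
    using f(1) by (intro emeasure_density) auto
  also have "\<dots> \<le> (\<integral>\<^sup>+ z. ennreal M * indicator {x<..y} z \<partial>lborel)"
    using f(2) by (intro nn_integral_mono mult_right_mono ennreal_leI) auto
  also have "\<dots> = ennreal M * emeasure lborel {x<..y}"
    by (intro nn_integral_cmult_indicator) auto
  also have "\<dots> = ennreal (M * (y - x))" using xy M by (simp add: ennreal_mult)
  finally show ?thesis .
qed

lemma cdf_density_lipschitz:
  fixes f :: "real \<Rightarrow> real"
  assumes f: "f \<in> borel_measurable borel" "\<And>x. f x \<le> M" and xy: "x \<le> y" and M: "M \<ge> 0"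
  shows "\<bar>cdf (density lborel f) y - cdf (density lborel f) x\<bar> \<le> M * (y - x)"
proof -
  let ?\<mu> = "density lborel f"
  have U: "{..y} = {..x} \<union> {x<..y}" using xy by auto
  have e: "emeasure ?\<mu> {..y} = emeasure ?\<mu> {..x} + emeasure ?\<mu> {x<..y}"
    unfolding U by (intro plus_emeasure[symmetric]) auto
  have le: "emeasure ?\<mu> {x<..y} \<le> ennreal (M * (y - x))"
    by (rule emeasure_density_interval_le[OF f xy M])
  show ?thesis
  \<comment> \<open>\<open>density lborel f\<close> is not yet known to be finite. On sets of
    infinite mass \<open>measure\<close> takes the default value 0, and both values of
    \<open>cdf\<close> are then 0.\<close>
  proof (cases "emeasure ?\<mu> {..x} = \<infinity>")
    case True
    then have "cdf ?\<mu> y = 0" "cdf ?\<mu> x = 0" using e by (simp_all add: cdf_def measure_def)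
    then show ?thesis using M xy by simp
  next
    case False
    have fin: "emeasure ?\<mu> {x<..y} \<noteq> \<infinity>" using le by (auto simp: top_unique)
    have "cdf ?\<mu> y = cdf ?\<mu> x + measure ?\<mu> {x<..y}"
      using False fin e unfolding cdf_def measure_def by (simp add: enn2real_plus less_top[symmetric])
    moreover have "measure ?\<mu> {x<..y} \<le> M * (y - x)"
      unfolding measure_def using le M xy by (intro enn2real_leI) auto
    ultimately show ?thesis by simp
  qed
qed

text \<open>Weak convergence here speaks only about \<open>cdf\<close>, so that the limit is a
  probability measure has to be derived. A bounded density makes \<open>cdf\<close> continuous,
  hence convergence holds at every point, and the uniform tail bound forces the limit at infinity to
  be 1.\<close>

lemma qs_limit_density_real_distribution:
  fixes f :: "real \<Rightarrow> real"
  assumes lim: "weak_conv_m qs_law (density lborel f)"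
    and f: "f \<in> borel_measurable borel" "\<And>x. f x \<le> M" and M: "M \<ge> 0"
  shows "real_distribution (density lborel f)"
proof -
  let ?\<mu> = "density lborel f"
  have cont: "isCont (cdf ?\<mu>) x" for x
  proof -
    have lip: "\<bar>cdf ?\<mu> y - cdf ?\<mu> x\<bar> \<le> M * \<bar>y - x\<bar>" for y
      using cdf_density_lipschitz[OF f, of x y] cdf_density_lipschitz[OF f, of y x] M
      by (cases "x \<le> y") (auto simp: abs_minus_commute)
    have lim0: "(\<lambda>y. M * \<bar>y - x\<bar>) \<midarrow>x\<rightarrow> 0"
    proof -
      have "(\<lambda>y. M * \<bar>y - x\<bar>) \<midarrow>x\<rightarrow> M * \<bar>x - x\<bar>" by (intro tendsto_intros)
      then show ?thesis by simp
    qed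
    have "(\<lambda>y. cdf ?\<mu> y - cdf ?\<mu> x) \<midarrow>x\<rightarrow> 0"
      by (rule Lim_null_comparison[OF _ lim0]) (use lip in simp)
    then show ?thesis unfolding isCont_def by (simp add: LIM_zero_iff)
  qed
  have conv: "(\<lambda>n. qs_cdf n x) \<longlonglongrightarrow> cdf ?\<mu> x" for x
    using lim cont[of x] unfolding weak_conv_m_def weak_conv_def by (simp add: cdf_qs_law)
  have upper: "cdf ?\<mu> x \<le> 1" for x
    by (rule LIMSEQ_le_const2[OF conv]) (auto simp: qs_cdf_def)
  have lower: "cdf ?\<mu> a \<ge> 1 - 28 / a\<^sup>2" if "a > 0" for a
    by (rule LIMSEQ_le_const[OF conv]) (use qs_cdf_tail[OF _ that] in auto)
  \<comment> \<open>From 6 on \<open>28 / n^2 < 1\<close>, so \<open>cdf\<close> is positive there;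
    this rules out that it is the default value of an infinite mass.\<close>
  have fin: "emeasure ?\<mu> {..real n} = ennreal (cdf ?\<mu> (real n))" if "n \<ge> 6" for n
  proof -
    have "(6::real)\<^sup>2 \<le> (real n)\<^sup>2" using that by (intro power_mono) auto
    then have "28 < (real n)\<^sup>2" by simp
    then have "28 / (real n)\<^sup>2 < 1" by (subst divide_less_eq_1_pos) linarith+
    moreover have "real n > 0" using that by simp
    ultimately have "cdf ?\<mu> (real n) > 0" using lower[of "real n"] by linarith
    then have "emeasure ?\<mu> {..real n} \<noteq> \<infinity>" by (auto simp: cdf_def measure_def)
    then show ?thesis unfolding cdf_def by (intro emeasure_eq_ennreal_measure) auto
  qed
  have "(\<lambda>n. cdf ?\<mu> (real n)) \<longlonglongrightarrow> 1"
  proof (rule tendsto_sandwich)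
    show "\<forall>\<^sub>F n in sequentially. 1 - 28 / (real n)\<^sup>2 \<le> cdf ?\<mu> (real n)"
      using eventually_gt_at_top[of 0] by eventually_elim (rule lower, simp)
    show "\<forall>\<^sub>F n in sequentially. cdf ?\<mu> (real n) \<le> 1" using upper by simp
    have "(\<lambda>n. 1 - 28 * (1 / real n)\<^sup>2) \<longlonglongrightarrow> 1 - 28 * 0\<^sup>2"
      by (intro tendsto_intros lim_const_over_n)
    then show "(\<lambda>n. 1 - 28 / (real n)\<^sup>2) \<longlonglongrightarrow> 1" by (simp add: power_divide)
  qed simp
  then have "(\<lambda>n. ennreal (cdf ?\<mu> (real n))) \<longlonglongrightarrow> ennreal 1" by (rule tendsto_ennrealI)
  moreover have "(\<lambda>n. emeasure ?\<mu> {..real n}) \<longlonglongrightarrow> emeasure ?\<mu> (\<Union>n. {..real n})"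
    by (rule Lim_emeasure_incseq) (auto simp: incseq_def)
  then have "(\<lambda>n. ennreal (cdf ?\<mu> (real n))) \<longlonglongrightarrow> emeasure ?\<mu> (\<Union>n. {..real n})"
    by (rule Lim_transform_eventually) (use eventually_ge_at_top[of 6] in \<open>eventually_elim, simp add: fin\<close>)
  ultimately have "emeasure ?\<mu> (\<Union>n. {..real n}) = ennreal 1" using LIMSEQ_unique by blast
  moreover have "(\<Union>n. {..real n}) = UNIV" by (auto intro: real_arch_simple)
  ultimately have "prob_space ?\<mu>" by (intro prob_spaceI) simp
  then show ?thesis by (intro real_distribution.intro real_distribution_axioms.intro) auto
qed

lemma measure_density_singleton:
  fixes f :: "real \<Rightarrow> real"
  assumes "f \<in> borel_measurable borel"
  shows "measure (density lborel f) {x} = 0"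
proof -
  have "{x} \<in> null_sets lborel" by (intro null_setsI) auto
  then have "{x} \<in> null_sets (density lborel f)"
    using absolutely_continuousI_density[of f lborel] assms
    by (auto simp: absolutely_continuous_def)
  then show ?thesis by (simp add: null_sets_def measure_def)
qed

text \<open>Beyond the threshold the ramp lives on an interval of length \<open>1 / r\<close>, where
  its integral is that of \<open>1 - (r u)^2\<close>, namely \<open>2 / (3 r)\<close>; the density
  is at most \<open>M\<close> there.\<close>

lemma ramp_integral_le:
  fixes f :: "real \<Rightarrow> real"
  assumes \<mu>: "real_distribution (density lborel f)"
    and f: "f \<in> borel_measurable borel" "\<And>x. 0 \<le> f x" "\<And>x. f x \<le> M"
    and r: "r > 0" and s: "s = 1 \<or> s = -1"
  shows "(LINT y|density lborel f. ramp r (s * (y - x)))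
     \<le> measure (density lborel f) {y. s * (y - x) \<le> 0} + 2 / 3 * M / r"
proof -
  let ?\<mu> = "density lborel f"
  interpret real_distribution ?\<mu> by (rule \<mu>)
  note f(1)[measurable]
  define a b where "a = (if s = 1 then x else x - 1 / r)" "b = (if s = 1 then x + 1 / r else x)"
  have ab: "a \<le> b" using r by (simp add: a_b_def)
  define k where "k y = 1 - (r * (y - x))\<^sup>2" for y
  have k: "0 \<le> k y" if "y \<in> {a..b}" for y
  proof -
    have "\<bar>r * (y - x)\<bar> \<le> 1"
    proof -
      have "\<bar>y - x\<bar> \<le> 1 / r" using that s by (auto simp: a_b_def)
      then have "r * \<bar>y - x\<bar> \<le> r * (1 / r)" using r by (intro mult_left_mono) auto
      then show ?thesis using r by (simp add: abs_mult)
    qed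
    then show ?thesis by (simp add: k_def abs_square_le_1)
  qed
  define h where "h y = indicator {a..b} y * k y" for y
  have kc: "continuous_on {a..b} k" unfolding k_def by (intro continuous_intros)
  have h0: "0 \<le> h y" for y using k by (simp add: h_def indicator_def)
  have hm[measurable]: "h \<in> borel_measurable borel" unfolding h_def k_def by measurable
  have hint: "integrable lborel h"
    using borel_integrable_compact[OF compact_Icc kc] by (simp add: h_def[abs_def])
  have h1: "h y \<le> 1" for y by (simp add: h_def k_def indicator_def)
  have hI: "(LINT y|lborel. h y) = 2 / (3 * r)"
  proof -
    define P where "P y = (y - x) - r\<^sup>2 * (y - x) ^ 3 / 3" for y
    have "(LINT y|lborel. indicator {a..b} y *\<^sub>R k y) = P b - P a"
    proof (rule integral_FTC_atLeastAtMost[OF ab _ kc])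
      fix y
      have "(P has_real_derivative k y) (at y)" unfolding P_def k_def
        by (auto intro!: derivative_eq_intros simp: power2_eq_square power_mult_distrib)
      then show "(P has_vector_derivative k y) (at y within {a..b})"
        by (simp add: has_real_derivative_iff_has_vector_derivative has_vector_derivative_at_within)
    qed
    also have "\<dots> = 2 / (3 * r)"
      using r s by (auto simp: P_def a_b_def power2_eq_square power3_eq_cube field_simps)
    finally show ?thesis by (simp add: h_def)
  qed
  have "(LINT y|?\<mu>. ramp r (s * (y - x))) \<le> (LINT y|?\<mu>. indicator {y. s * (y - x) \<le> 0} y + h y)"
  proof (rule integral_mono_AE)
    have "continuous_on UNIV (\<lambda>y. ramp r (s * (y - x)))" unfolding ramp_def by (intro continuous_intros)
    then have "(\<lambda>y. ramp r (s * (y - x))) \<in> borel_measurable borel" by (rule borel_measurable_continuous_onI)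
    then show "integrable ?\<mu> (\<lambda>y. ramp r (s * (y - x)))"
      by (intro integrable_const_bound[where B=1]) (auto simp: ramp_le_1 ramp_nonneg)
    show "integrable ?\<mu> (\<lambda>y. indicator {y. s * (y - x) \<le> 0} y + h y)"
    proof (rule integrable_const_bound[where B=2])
      show "AE y in ?\<mu>. norm (indicator {y. s * (y - x) \<le> 0} y + h y) \<le> 2"
      proof (rule AE_I2)
        fix y show "norm (indicator {y. s * (y - x) \<le> 0} y + h y) \<le> 2"
          using h0[of y] h1[of y] by (simp add: indicator_def)
      qed
    qed simp
    show "AE y in ?\<mu>. ramp r (s * (y - x)) \<le> indicator {y. s * (y - x) \<le> 0} y + h y"
    proof (rule AE_I2)
      fix y
      show "ramp r (s * (y - x)) \<le> indicator {y. s * (y - x) \<le> 0} y + h y"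
      proof (cases "s * (y - x) \<le> 0")
        case True
        then show ?thesis using ramp_le_1[of r "s * (y - x)"] h0[of y] by simp
      next
        case False
        define u where "u = s * (y - x)"
        have u: "u > 0" using False by (simp add: u_def)
        show ?thesis
        proof (cases "r * u \<le> 1")
          case True
          have "y \<in> {a..b}" using True u s r by (auto simp: a_b_def u_def field_simps)
          moreover have "(y - x)\<^sup>2 = u\<^sup>2" using s by (auto simp: u_def power2_commute)
          ultimately have "h y = 1 - (r * u)\<^sup>2" by (simp add: h_def k_def power_mult_distrib)
          moreover have "ramp r u = 1 - (r * u)\<^sup>2" using True u r by (simp add: ramp_def)
          ultimately show ?thesis by (simp add: u_def)
        next
          case F: False
          then have "ramp r u = 0" by (simp add: ramp_def)
          then show ?thesis using h0[of y] by (simp add: u_def)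
        qed
      qed
    qed
  qed
  also have "\<dots> = (LINT y|?\<mu>. indicator {y. s * (y - x) \<le> 0} y) + (LINT y|?\<mu>. h y)"
    by (intro Bochner_Integration.integral_add integrable_const_bound[where B=1])
       (auto simp: indicator_def h0 h1)
  also have "(LINT y|?\<mu>. indicator {y. s * (y - x) \<le> 0} y) = measure ?\<mu> {y. s * (y - x) \<le> 0}"
    by simp
  also have "(LINT y|?\<mu>. h y) = (LINT y|lborel. f y * h y)"
    using f(2) by (subst integral_density) auto
  also have "\<dots> \<le> (LINT y|lborel. M * h y)"
  proof (rule integral_mono_AE)
    show "integrable lborel (\<lambda>y. M * h y)" using hint by simp
    then show "integrable lborel (\<lambda>y. f y * h y)"
      by (rule Bochner_Integration.integrable_bound)
         (auto simp: abs_mult f h0 intro!: mult_mono order_trans[OF f(3)])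
    show "AE y in lborel. f y * h y \<le> M * h y" using f(3) h0 by (auto intro: mult_right_mono)
  qed
  also have "\<dots> = M * (2 / (3 * r))" using hI by simp
  finally show ?thesis by simp
qed

lemma kolmogorov_distance_le:
  fixes f :: "real \<Rightarrow> real"
  assumes lim: "weak_conv_m qs_law (density lborel f)"
    and f: "f \<in> borel_measurable borel" "\<And>x. 0 \<le> f x" "\<And>x. f x \<le> M" and M: "M > 0" and n: "n \<ge> 1"
  shows "\<bar>qs_cdf n x - cdf (density lborel f) x\<bar> \<le> (12 * M\<^sup>2 / real n) powr (1/3)"
proof -
  let ?\<mu> = "density lborel f"
  have M0: "M \<ge> 0" using M by simp
  have rd: "real_distribution ?\<mu>" by (rule qs_limit_density_real_distribution[OF lim f(1,3) M0])
  interpret real_distribution ?\<mu> by (rule rd)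
  \<comment> \<open>The minimiser of \<open>2/3 * M / r + 4 * r^2 / n\<close>. There the first term
    is twice the second, and the sum is \<open>M / r\<close>.\<close>
  define r where "r = (M * real n / 12) powr (1/3)"
  have n0: "real n > 0" using n by simp
  have r0: "r > 0" using M n0 by (simp add: r_def)
  have r3: "r ^ 3 = M * real n / 12"
    using M n0 by (simp add: r_def powr_power)
  have opt: "2 / 3 * M / r + 4 * r\<^sup>2 / real n = (12 * M\<^sup>2 / real n) powr (1/3)"
  proof -
    have "4 * r\<^sup>2 / real n = 4 * r ^ 3 / (real n * r)" using r0 by (simp add: power2_eq_square power3_eq_cube)
    also have "\<dots> = M / 3 / r" using n0 r0 unfolding r3 by simp
    finally have 1: "2 / 3 * M / r + 4 * r\<^sup>2 / real n = M / r" by (simp add: field_simps)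
    have "(M / r) ^ 3 = 12 * M\<^sup>2 / real n"
      using M n0 unfolding power_divide r3 by (simp add: power2_eq_square power3_eq_cube)
    moreover have "(M / r) powr 3 = (M / r) ^ 3" using M r0 by (intro powr_numeral) simp
    ultimately have "(12 * M\<^sup>2 / real n) powr (1/3) = ((M / r) powr 3) powr (1/3)"
      by (simp only:)
    also have "\<dots> = (M / r) powr (3 * (1/3))" by (simp only: powr_powr)
    also have "\<dots> = M / r" using M r0 by simp
    finally show ?thesis using 1 by simp
  qed
  have bound: "measure_pmf.prob (cost_law n) {z. s * (z / real n - x) \<le> 0}
    \<le> measure ?\<mu> {y. s * (y - x) \<le> 0} + (12 * M\<^sup>2 / real n) powr (1/3)" if "s = 1 \<or> s = -1" for s
    using ramp_limit_bound[OF n r0 that rd lim, of x] ramp_integral_le[OF rd f r0 that, of x] opt by linarith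
  have "qs_cdf n x \<le> cdf ?\<mu> x + (12 * M\<^sup>2 / real n) powr (1/3)"
    using bound[of 1] by (simp add: qs_cdf_eq cdf_def atMost_def)
  \<comment> \<open>The opposite inequality is the bound for the upper tail, \<open>s = -1\<close>.
    It yields closed half-lines; the extra point \<open>x\<close> is a null set of the
    limit.\<close>
  moreover have "1 - qs_cdf n x \<le> 1 - cdf ?\<mu> x + (12 * M\<^sup>2 / real n) powr (1/3)"
  proof -
    have "1 - qs_cdf n x = measure_pmf.prob (cost_law n) (space (measure_pmf (cost_law n)) - {z. z / real n \<le> x})"
      unfolding qs_cdf_eq by (subst measure_pmf.prob_compl) auto
    also have "\<dots> \<le> measure_pmf.prob (cost_law n) {z. -1 * (z / real n - x) \<le> 0}"
      by (intro measure_pmf.finite_measure_mono) auto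
    also have "\<dots> \<le> measure ?\<mu> {y. -1 * (y - x) \<le> 0} + (12 * M\<^sup>2 / real n) powr (1/3)"
      by (rule bound) simp
    also have "measure ?\<mu> {y. -1 * (y - x) \<le> 0} = measure ?\<mu> ({x<..} \<union> {x})"
      by (rule arg_cong[where f = "measure ?\<mu>"]) auto
    also have "\<dots> = measure ?\<mu> {x<..} + measure ?\<mu> {x}"
      by (intro finite_measure_Union) auto
    also have "measure ?\<mu> {x} = 0" by (rule measure_density_singleton[OF f(1)])
    also have "{x<..} = space ?\<mu> - {..x}" by auto
    also have "measure ?\<mu> (space ?\<mu> - {..x}) = 1 - cdf ?\<mu> x"
      unfolding cdf_def by (rule prob_compl) auto
    finally show ?thesis by simp
  qed
  ultimately show ?thesis by linarith
qed

text \<open>The difference, as a function of the half-width \<open>t\<close>, has derivative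
  \<open>f (x + t) + f (x - t) - 2 * f x\<close>, which is at most \<open>2 * M' * t\<close> in
  absolute value. Comparing with \<open>M' * t^2\<close> by monotonicity integrates this
  bound.\<close>

lemma cdf_density_symmetric_difference:
  fixes f f' :: "real \<Rightarrow> real"
  assumes \<mu>: "real_distribution (density lborel f)"
    and f0: "\<And>x. 0 \<le> f x" and f': "\<And>x. (f has_real_derivative f' x) (at x)"
    and M': "\<And>x. \<bar>f' x\<bar> \<le> M'" and d: "d > 0"
  shows "\<bar>cdf (density lborel f) (x + d) - cdf (density lborel f) (x - d) - 2 * d * f x\<bar> \<le> M' * d\<^sup>2"
proof -
  let ?\<mu> = "density lborel f"
  interpret real_distribution ?\<mu> by (rule \<mu>)
  have fc: "continuous_on S f" for S
    using f' by (intro continuous_at_imp_continuous_on ballI) (blast intro: DERIV_isCont)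
  have fm[measurable]: "f \<in> borel_measurable borel" using fc by (rule borel_measurable_continuous_onI)
  \<comment> \<open>The margin 1 puts \<open>x - d\<close> and \<open>x + d\<close> into the
    interior, where the derivative within the interval is a full derivative.\<close>
  obtain P where P: "\<And>y. y \<in> {x - d - 1..x + d + 1} \<Longrightarrow> (P has_vector_derivative f y) (at y within {x - d - 1..x + d + 1})"
    using antiderivative_continuous[OF fc] by blast
  have P': "(P has_real_derivative f y) (at y)" if "x - d \<le> y" "y \<le> x + d" for y
  proof -
    have "at y within {x - d - 1..x + d + 1} = at y" using that by (intro at_within_Icc_at) auto
    then show ?thesis using P[of y] that by (simp add: has_real_derivative_iff_has_vector_derivative)
  qed
  have "cdf ?\<mu> (x + d) - cdf ?\<mu> (x - d) = measure ?\<mu> {x - d<..x + d}"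
    using d by (intro cdf_diff_eq) auto
  also have "\<dots> = measure ?\<mu> {x - d..x + d}"
  proof -
    have "measure ?\<mu> {x - d..x + d} = measure ?\<mu> ({x - d<..x + d} \<union> {x - d})"
      using d by (intro arg_cong[where f = "measure ?\<mu>"]) auto
    also have "\<dots> = measure ?\<mu> {x - d<..x + d} + measure ?\<mu> {x - d}"
      by (intro finite_measure_Union) auto
    also have "measure ?\<mu> {x - d} = 0"
      by (rule measure_density_singleton[OF fm])
    finally show ?thesis by simp
  qed
  also have "\<dots> = P (x + d) - P (x - d)"
  proof -
    have "measure ?\<mu> {x - d..x + d} = (LINT y|?\<mu>. indicator {x - d..x + d} y)" by simp
    also have "\<dots> = (LINT y|lborel. f y * indicator {x - d..x + d} y)"
      using f0 by (subst integral_density) auto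
    also have "\<dots> = (LINT y|lborel. indicator {x - d..x + d} y *\<^sub>R f y)" by (simp add: mult.commute)
    also have "\<dots> = P (x + d) - P (x - d)"
      using d P' by (intro integral_FTC_atLeastAtMost fc)
        (auto simp: has_real_derivative_iff_has_vector_derivative intro: has_vector_derivative_at_within)
    finally show ?thesis .
  qed
  finally have cP: "cdf ?\<mu> (x + d) - cdf ?\<mu> (x - d) = P (x + d) - P (x - d)" .
  have lip: "\<bar>f y - f x\<bar> \<le> M' * \<bar>y - x\<bar>" for y
    using field_differentiable_bound[of UNIV f f' M' y x] f' M' by simp
  define G where "G t = P (x + t) - P (x - t) - 2 * t * f x" for t
  have G': "(G has_real_derivative (f (x + t) + f (x - t) - 2 * f x)) (at t)" if "0 \<le> t" "t \<le> d" for t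
  proof -
    have 1: "((\<lambda>t. P (x + t)) has_real_derivative f (x + t) * 1) (at t)"
      by (rule DERIV_chain2[OF P']) (use that in \<open>auto intro!: derivative_eq_intros\<close>)
    have 2: "((\<lambda>t. P (x - t)) has_real_derivative f (x - t) * (- 1)) (at t)"
      by (rule DERIV_chain2[OF P']) (use that in \<open>auto intro!: derivative_eq_intros\<close>)
    have 3: "((\<lambda>t. 2 * t * f x) has_real_derivative 2 * f x) (at t)"
      by (auto intro!: derivative_eq_intros)
    show ?thesis unfolding G_def using DERIV_diff[OF DERIV_diff[OF 1 2] 3] by simp
  qed
  have b: "\<bar>f (x + t) + f (x - t) - 2 * f x\<bar> \<le> 2 * M' * t" if "0 \<le> t" for t
    using lip[of "x + t"] lip[of "x - t"] that by simp
  have sq: "((\<lambda>t. M' * t\<^sup>2) has_real_derivative M' * (2 * t)) (at t)" for t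
    by (auto intro!: derivative_eq_intros)
  have "G d - M' * d\<^sup>2 \<le> G 0 - M' * 0\<^sup>2"
  proof (rule DERIV_nonpos_imp_nonincreasing[where f = "\<lambda>t. G t - M' * t\<^sup>2"])
    fix t assume t: "0 \<le> t" "t \<le> d"
    show "\<exists>y. ((\<lambda>t. G t - M' * t\<^sup>2) has_real_derivative y) (at t) \<and> y \<le> 0"
      using b[OF t(1)] DERIV_diff[OF G'[OF t] sq[of t]]
      by (intro exI[of _ "f (x + t) + f (x - t) - 2 * f x - M' * (2 * t)"] conjI) (auto simp: abs_le_iff)
  qed (use d in simp)
  moreover have "G d + M' * d\<^sup>2 \<ge> G 0 + M' * 0\<^sup>2"
  proof (rule DERIV_nonneg_imp_nondecreasing[where f = "\<lambda>t. G t + M' * t\<^sup>2"])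
    fix t assume t: "0 \<le> t" "t \<le> d"
    show "\<exists>y. ((\<lambda>t. G t + M' * t\<^sup>2) has_real_derivative y) (at t) \<and> y \<ge> 0"
      using b[OF t(1)] DERIV_add[OF G'[OF t] sq[of t]]
      by (intro exI[of _ "f (x + t) + f (x - t) - 2 * f x + M' * (2 * t)"] conjI) (auto simp: abs_le_iff)
  qed (use d in simp)
  ultimately show ?thesis unfolding cP by (simp add: G_def abs_le_iff)
qed

theorem theorem6p1:
  fixes f f' :: "real \<Rightarrow> real" and M M' :: real
  assumes limit: "weak_conv_m qs_law (density lborel f)"
    and f_nonneg: "\<And>x. f x \<ge> 0"
    and f_deriv: "\<And>x. (f has_real_derivative f' x) (at x)"
    and f_bdd: "bounded (range f)"
    and f'_bdd: "bounded (range f')"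
    and M_def: "M = (SUP x. \<bar>f x\<bar>)"
    and M'_def: "M' = (SUP x. \<bar>f' x\<bar>)"
  shows "(\<forall>x (n::nat) \<delta>::real. n \<ge> 1 \<and> \<delta> > 0 \<longrightarrow>
            \<bar>(qs_cdf n (x + \<delta>/2) - qs_cdf n (x - \<delta>/2)) / \<delta> - f x\<bar>
              \<le> (96 * M^2) powr (1/3) / (\<delta> * real n powr (1/3)) + M' / 4 * \<delta>)
       \<and> (\<forall>Mb Mb'. Mb \<ge> M \<and> Mb' \<ge> M' \<longrightarrow>
            (\<forall>x (n::nat). n \<ge> 1 \<longrightarrow>
              (let \<delta>n = 2 * (96 * Mb^2 * Mb' powr (-3)) powr (1/6) * real n powr (-1/6)
               in \<bar>(qs_cdf n (x + \<delta>n/2) - qs_cdf n (x - \<delta>n/2)) / \<delta>n - f x\<bar>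
                    \<le> (96 * Mb^2 * Mb'^3) powr (1/6) * real n powr (-1/6))))"
proof -
  let ?\<mu> = "density lborel f"
  have fc: "continuous_on UNIV f"
    using f_deriv by (intro continuous_at_imp_continuous_on ballI) (blast intro: DERIV_isCont)
  then have fm: "f \<in> borel_measurable borel" by (rule borel_measurable_continuous_onI)
  have absb: "\<bar>g x\<bar> \<le> (SUP x. \<bar>g x\<bar>)" if bdd: "bounded (range g)" for g :: "real \<Rightarrow> real" and x
  proof -
    obtain B where "\<And>y. \<bar>g y\<bar> \<le> B" using bdd by (auto simp: bounded_iff)
    then have "bdd_above (range (\<lambda>y. \<bar>g y\<bar>))" by (intro bdd_aboveI[of _ B]) auto
    then show ?thesis by (intro cSUP_upper) auto
  qed
  have Mb: "\<bar>f x\<bar> \<le> M" for x unfolding M_def by (rule absb[OF f_bdd])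
  have M'b: "\<bar>f' x\<bar> \<le> M'" for x unfolding M'_def by (rule absb[OF f'_bdd])
  have fM: "f x \<le> M" for x using Mb[of x] by simp
  have M0: "M \<ge> 0" "M' \<ge> 0" using Mb[of 0] M'b[of 0] by linarith+
  have rd: "real_distribution ?\<mu>"
    by (rule qs_limit_density_real_distribution[OF limit fm fM M0(1)])
  \<comment> \<open>A constant density on the line has mass 0 or infinity. This makes both suprema
    strictly positive, as needed for the optimal \<open>r\<close> and for the negative power in the
    window width.\<close>
  have not_const: False if "\<And>x. f x = c" for c
  proof -
    interpret real_distribution ?\<mu> by (rule rd)
    have "emeasure ?\<mu> UNIV = ennreal c * emeasure lborel (UNIV :: real set)"
      using that by (simp add: emeasure_density_const)
    moreover have "emeasure ?\<mu> UNIV = 1" using emeasure_space_1 by simp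
    ultimately show False by (cases "ennreal c = 0") (auto simp: ennreal_mult_top)
  qed
  have M: "M > 0"
  proof (rule ccontr)
    assume "\<not> M > 0"
    then have "f x = 0" for x using Mb[of x] by simp
    then show False by (rule not_const)
  qed
  have M': "M' > 0"
  proof (rule ccontr)
    assume "\<not> M' > 0"
    then have "f' x = 0" for x using M'b[of x] by simp
    then have "f x = f 0" for x
      using DERIV_isconst_all[of f x 0] f_deriv by metis
    then show False by (rule not_const)
  qed
  have first: "\<bar>(qs_cdf n (x + \<delta>/2) - qs_cdf n (x - \<delta>/2)) / \<delta> - f x\<bar>
              \<le> (96 * M\<^sup>2) powr (1/3) / (\<delta> * real n powr (1/3)) + M' / 4 * \<delta>"
    if n: "n \<ge> 1" and \<delta>: "\<delta> > 0" for x \<delta> n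
  proof -
    define D where "D = (12 * M\<^sup>2 / real n) powr (1/3)"
    define F where "F = cdf ?\<mu>"
    have ks: "\<bar>qs_cdf n y - F y\<bar> \<le> D" for y
      unfolding D_def F_def by (rule kolmogorov_distance_le[OF limit fm f_nonneg fM M n])
    have smooth: "\<bar>F (x + \<delta>/2) - F (x - \<delta>/2) - 2 * (\<delta>/2) * f x\<bar> \<le> M' * (\<delta>/2)\<^sup>2"
      unfolding F_def using \<delta>
      by (intro cdf_density_symmetric_difference[OF rd f_nonneg f_deriv M'b]) simp
    have D2: "2 * D = (96 * M\<^sup>2) powr (1/3) / real n powr (1/3)"
    proof -
      have "(8::real) powr (1/3) = (2 powr 3) powr (1/3)" by simp
      also have "\<dots> = 2" by (simp add: powr_powr del: powr_numeral)
      finally have 8: "(8::real) powr (1/3) = 2" .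
      have "(96 * M\<^sup>2) powr (1/3) = (8 * (12 * M\<^sup>2)) powr (1/3)" by simp
      also have "\<dots> = 8 powr (1/3) * (12 * M\<^sup>2) powr (1/3)" by (rule powr_mult)
      finally show ?thesis unfolding D_def 8 using n by (simp add: powr_divide)
    qed
    have "\<bar>(qs_cdf n (x + \<delta>/2) - qs_cdf n (x - \<delta>/2)) - \<delta> * f x\<bar> \<le> 2 * D + M' * (\<delta>/2)\<^sup>2"
      using ks[of "x + \<delta>/2"] ks[of "x - \<delta>/2"] smooth by (simp add: abs_le_iff)
    then have "\<bar>(qs_cdf n (x + \<delta>/2) - qs_cdf n (x - \<delta>/2)) - \<delta> * f x\<bar> / \<delta> \<le> (2 * D + M' * (\<delta>/2)\<^sup>2) / \<delta>"
      using \<delta> by (intro divide_right_mono) auto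
    also have "(2 * D + M' * (\<delta>/2)\<^sup>2) / \<delta> = 2 * D / \<delta> + M' / 4 * \<delta>"
      using \<delta> by (simp add: add_divide_distrib power2_eq_square)
    also have "2 * D / \<delta> = (96 * M\<^sup>2) powr (1/3) / (\<delta> * real n powr (1/3))"
      unfolding D2 by (simp add: mult.commute)
    also have "\<bar>(qs_cdf n (x + \<delta>/2) - qs_cdf n (x - \<delta>/2)) - \<delta> * f x\<bar> / \<delta>
       = \<bar>(qs_cdf n (x + \<delta>/2) - qs_cdf n (x - \<delta>/2)) / \<delta> - f x\<bar>"
    proof -
      define q where "q = qs_cdf n (x + \<delta>/2) - qs_cdf n (x - \<delta>/2)"
      have "q / \<delta> - f x = (q - \<delta> * f x) / \<delta>" using \<delta> by (simp add: diff_divide_distrib)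
      then show ?thesis using \<delta> by (simp add: q_def[symmetric])
    qed
    finally show ?thesis .
  qed
  have second: "\<bar>(qs_cdf n (x + \<delta>/2) - qs_cdf n (x - \<delta>/2)) / \<delta> - f x\<bar>
      \<le> (96 * Mb\<^sup>2 * Mb'^3) powr (1/6) * real n powr (-1/6)"
    if Mb: "Mb \<ge> M" and Mb': "Mb' \<ge> M'" and n: "n \<ge> 1"
      and \<delta>: "\<delta> = 2 * (96 * Mb\<^sup>2 * Mb' powr (-3)) powr (1/6) * real n powr (-1/6)" for x n \<delta> Mb Mb'
  proof -
    have pos: "Mb > 0" "Mb' > 0" "real n > 0" using Mb Mb' M M' n by auto
    define q where "q = 96 * Mb\<^sup>2"
    have q: "q > 0" using pos by (simp add: q_def)
    \<comment> \<open>In these roots the first bound is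
      \<open>a^2 c^2 / \<delta> + b^2 \<delta> / 4\<close>, after enlarging \<open>M\<close> and
      \<open>M'\<close>. The prescribed \<open>\<delta> = 2 a c / b\<close> balances the two terms
      at \<open>a b c / 2\<close> each.\<close>
    define a b c where "a = q powr (1/6)" "b = Mb' powr (1/2)" "c = real n powr (-1/6)"
    have abc: "a > 0" "b > 0" "c > 0" using q pos by (simp_all add: a_b_c_def)
    have a2: "q powr (1/3) = a\<^sup>2" using q by (simp add: a_b_c_def powr_power)
    have b2: "Mb' = b\<^sup>2" using pos by (simp add: a_b_c_def powr_power)
    have c2: "1 / real n powr (1/3) = c\<^sup>2" using pos by (simp add: a_b_c_def powr_power powr_minus_divide power_divide)
    have d: "\<delta> = 2 * a * c / b"
    proof -
      have "(q * Mb' powr (-3)) powr (1/6) = a * (Mb' powr (-3)) powr (1/6)"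
        using q pos by (simp add: powr_mult a_b_c_def)
      also have "(Mb' powr (-3)) powr (1/6) = 1 / b"
        unfolding powr_powr a_b_c_def by (simp add: powr_minus_divide)
      finally show ?thesis unfolding \<delta> q_def[symmetric] by (simp add: a_b_c_def)
    qed
    have rhs: "(q * Mb'^3) powr (1/6) * real n powr (-1/6) = a * b * c"
    proof -
      have b: "(Mb' powr 3) powr (1/6) = b" unfolding powr_powr a_b_c_def by simp
      have "Mb'^3 = Mb' powr 3" using pos by (intro powr_numeral[symmetric]) simp
      then have "(q * Mb'^3) powr (1/6) = (q * Mb' powr 3) powr (1/6)" by (simp only:)
      also have "\<dots> = q powr (1/6) * (Mb' powr 3) powr (1/6)" by (rule powr_mult)
      also have "\<dots> = a * b" unfolding b by (simp add: a_b_c_def)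
      finally show ?thesis by (simp add: a_b_c_def)
    qed
    have \<delta>0: "\<delta> > 0" using abc by (simp add: d)
    have "(96 * M\<^sup>2) powr (1/3) \<le> q powr (1/3)"
      unfolding q_def using Mb M by (intro powr_mono2 mult_left_mono power_mono) auto
    then have "(96 * M\<^sup>2) powr (1/3) / (\<delta> * real n powr (1/3)) \<le> q powr (1/3) / (\<delta> * real n powr (1/3))"
      using \<delta>0 by (intro divide_right_mono) auto
    also have "\<dots> = q powr (1/3) * (1 / real n powr (1/3)) / \<delta>" by simp
    also have "\<dots> = a\<^sup>2 * c\<^sup>2 / \<delta>" unfolding a2 c2 ..
    also have "\<dots> = a * b * c / 2" using abc by (simp add: d power2_eq_square)
    finally have 1: "(96 * M\<^sup>2) powr (1/3) / (\<delta> * real n powr (1/3)) \<le> a * b * c / 2" .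
    have "M' / 4 * \<delta> \<le> Mb' / 4 * \<delta>" using Mb' \<delta>0 by (intro mult_right_mono) auto
    also have "\<dots> = a * b * c / 2" unfolding b2 using abc by (simp add: d power2_eq_square)
    finally have 2: "M' / 4 * \<delta> \<le> a * b * c / 2" .
    have "\<bar>(qs_cdf n (x + \<delta>/2) - qs_cdf n (x - \<delta>/2)) / \<delta> - f x\<bar> \<le> a * b * c / 2 + a * b * c / 2"
      using first[OF n \<delta>0, of x] 1 2 by linarith
    then show ?thesis unfolding rhs[unfolded q_def] by simp
  qed
  show ?thesis
    unfolding Let_def using first second by (intro conjI allI impI) auto
qed

end
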